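(* Let $G$ be a locally compact abelian group, let $\mu$ be a translation bounded measure on $G$ and let $\gamma$ be an autocorrelation of $\mu$. If $\gamma$ is supported on a set with finite local complexity (FLC), then the following statements hold: (a) $\widehat{\gamma}_{d}\in\mathcal{SAP}(\widehat G)$ and $\widehat{\gamma}_{c}\in\mathcal{SAP}(\widehat G)$. (b) Each of the pure point spectrum and the continuous spectrum is either empty or relatively dense in $\widehat G$.
   Context: A set $\Lambda\subset G$ has FLC if $\Lambda-\Lambda$ is locally finite, i.e. $(\Lambda-\Lambda)\cap K$ is finite for every compact $K\subset G$. A subset $S$ of a locally compact abelian group $H$ is relatively dense if $S+C=H$ for some compact $C$. Measures on a locally compact abelian group are (complex) Radon measures; the vague topology is the weak-* topology of the duality with $C_c$ (continuous compactly supported functions). $\mu$ is translation bounded if $\sup_{x}|\mu|(x+K)<\infty$ for all compact $K$ ($|\mu|$ the variation). $\widetilde f(x)=\overline{f(-x)}$, $\widetilde\mu(f)=\overline{\mu(\widetilde f)}$. A van Hove sequence in $G$ (Haar measure $\theta_G$) is a sequence $(A_n)$ of compact sets of positive measure with $\theta_G(\partial^K(A_n))/\theta_G(A_n)\to0$ for all compact $K\subset G$, where $\partial^K(A)=\overline{(A+K)\setminus A}\cup((\overline{G\setminus A}-K)\cap A)$. An autocorrelation of $\mu$ is a measure $\gamma$ which, for some van Hove sequence $(A_n)$, is the vague limit $\gamma=\lim_n\frac1{\theta_G(A_n)}\mu|_{A_n}*\widetilde{\mu|_{A_n}}$. It is positive definite ($\gamma(f*\widetilde f)\ge0$ for $f\in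 C_c(G)$), hence has a Fourier transform: the unique positive measure $\widehat\gamma$ on the dual group $\widehat G$ with $\gamma(f*\widetilde f)=\int_{\widehat G}|\check f|^2d\widehat\gamma$ for all $f\in C_c(G)$, $\check f(\chi)=\int_G\chi(t)f(t)\,dt$. Write $\widehat\gamma=\widehat\gamma_d+\widehat\gamma_c$ for the decomposition into the discrete (pure point) part and the continuous part. The pure point spectrum is $\{\chi:\widehat\gamma(\{\chi\})\ne0\}$ and the continuous spectrum is $\operatorname{supp}(\widehat\gamma_c)$. For a locally compact abelian group $H$, $\mathcal{SAP}(H)$ is the set of translation bounded measures $\rho$ on $H$ such that for each $c\in C_c(H)$ the function $(c*\rho)(x)=\int_Hc(x-t)\,d\rho(t)$ is Bohr almost periodic, i.e. its set of translates is precompact in the sup norm in the bounded uniformly continuous functions on $H$. *)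

theory Defs
  imports "HOL-Analysis.Analysis"
begin

section \<open>Radon measures as functionals\<close>

definition supp :: "('a::topological_space \<Rightarrow> complex) \<Rightarrow> 'a set" where
  "supp f = closure {x. f x \<noteq> 0}"

definition Cc :: "('a::topological_space \<Rightarrow> complex) set" where
  "Cc = {f. continuous_on UNIV f \<and> compact (supp f)}"

text \<open>
  A complex Radon measure is a linear functional on \<open>Cc\<close> that is continuous for the
  inductive limit topology.  A functional is a total function here, but its values outside \<open>Cc\<close>
  are junk and no definition below depends on them.
\<close>

type_synonym 'a functional = "('a \<Rightarrow> complex) \<Rightarrow> complex"

definition radon_measure :: "'a::topological_space functional \<Rightarrow> bool" where
  "radon_measure \<mu> \<longleftrightarrow>
     (\<forall>f\<in>Cc. \<forall>g\<in>Cc. \<mu> (\<lambda>x. f x + g x) = \<mu> f + \<mu> g) \<and>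
     (\<forall>c. \<forall>f\<in>Cc. \<mu> (\<lambda>x. c * f x) = c * \<mu> f) \<and>
     (\<forall>K. compact K \<longrightarrow>
        (\<exists>C::real. \<forall>f\<in>Cc. \<forall>B. supp f \<subseteq> K \<and> (\<forall>x. norm (f x) \<le> B) \<longrightarrow> norm (\<mu> f) \<le> C * B))"

definition positive_radon_measure :: "'a::topological_space functional \<Rightarrow> bool" where
  "positive_radon_measure \<mu> \<longleftrightarrow>
     radon_measure \<mu> \<and>
     (\<forall>f\<in>Cc. (\<forall>x. f x \<in> \<real>\<^sub>\<ge>\<^sub>0) \<longrightarrow> \<mu> f \<in> \<real>\<^sub>\<ge>\<^sub>0)"

definition measure_support :: "'a::topological_space functional \<Rightarrow> 'a set" where
  "measure_support \<mu> = {x. \<forall>U. open U \<and> x \<in> U \<longrightarrow> (\<exists>f\<in>Cc. supp f \<subseteq> U \<and> \<mu> f \<noteq> 0)}"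

text \<open>
  The upper integral with respect to the variation \<open>|\<mu>|\<close>.  For \<open>f \<ge> 0\<close> in \<open>Cc\<close> the variation is
  \<open>|\<mu>|(f) = sup {|\<mu>(g)| : g \<in> Cc, |g| \<le> f}\<close>; it extends to lower semicontinuous \<open>h \<ge> 0\<close> as the
  supremum of \<open>|\<mu>|(f)\<close> over \<open>0 \<le> f \<le> h\<close> (the two suprema merge into one), and to arbitrary
  \<open>F \<ge> 0\<close> as the infimum over lower semicontinuous majorants.
\<close>

definition variation_integral :: "'a::topological_space functional \<Rightarrow> ('a \<Rightarrow> ennreal) \<Rightarrow> ennreal"
  where
  "variation_integral \<mu> F =
     (INF h\<in>{h. (\<forall>a. open {x. a < h x}) \<and> (\<forall>x. F x \<le> h x)}.
        SUP g\<in>{g\<in>Cc. \<forall>x. ennreal (norm (g x)) \<le> h x}. ennreal (norm (\<mu> g)))"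

definition variation :: "'a::topological_space functional \<Rightarrow> 'a set \<Rightarrow> ennreal" where
  "variation \<mu> A = variation_integral \<mu> (indicator A)"

text \<open>
  The integral with respect to \<open>\<mu>\<close> is the continuous extension of \<open>\<mu>\<close> from \<open>Cc\<close> to \<open>L\<^sup>1(|\<mu>|)\<close>,
  the closure of \<open>Cc\<close> for the seminorm \<open>F \<mapsto> \<integral>\<^sup>* |F| d|\<mu>|\<close>.
\<close>

definition has_radon_integral ::
  "'a::topological_space functional \<Rightarrow> ('a \<Rightarrow> complex) \<Rightarrow> complex \<Rightarrow> bool" where
  "has_radon_integral \<mu> F z \<longleftrightarrow>
     (\<forall>e>0. \<exists>g\<in>Cc. variation_integral \<mu> (\<lambda>x. ennreal (norm (F x - g x))) < ennreal e \<and>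
                    norm (\<mu> g - z) < e)"

definition radon_integral :: "'a::topological_space functional \<Rightarrow> ('a \<Rightarrow> complex) \<Rightarrow> complex"
  where "radon_integral \<mu> F = (THE z. has_radon_integral \<mu> F z)"

definition mass :: "'a::topological_space functional \<Rightarrow> 'a set \<Rightarrow> complex" where
  "mass \<mu> A = radon_integral \<mu> (indicator A)"

definition restrict_measure :: "'a::topological_space functional \<Rightarrow> 'a set \<Rightarrow> 'a functional"
  where "restrict_measure \<mu> A = (\<lambda>f. radon_integral \<mu> (\<lambda>x. indicator A x * f x))"

definition discrete_part :: "'a::topological_space functional \<Rightarrow> 'a functional" where
  "discrete_part \<mu> = (\<lambda>f. \<Sum>\<^sub>\<infinity>x. mass \<mu> {x} * f x)"

definition continuous_part :: "'a::topological_space functional \<Rightarrow> 'a functional" where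
  "continuous_part \<mu> = (\<lambda>f. \<mu> f - discrete_part \<mu> f)"

definition pure_point_spectrum :: "'a::topological_space functional \<Rightarrow> 'a set" where
  "pure_point_spectrum \<mu> = {x. mass \<mu> {x} \<noteq> 0}"

definition continuous_spectrum :: "'a::topological_space functional \<Rightarrow> 'a set" where
  "continuous_spectrum \<mu> = measure_support (continuous_part \<mu>)"


section \<open>Measures and sets in a topological abelian group\<close>

definition finite_local_complexity :: "'a::topological_ab_group_add set \<Rightarrow> bool" where
  "finite_local_complexity L \<longleftrightarrow>
     (\<forall>K. compact K \<longrightarrow> finite ({x - y | x y. x \<in> L \<and> y \<in> L} \<inter> K))"

definition relatively_dense :: "'a::topological_ab_group_add set \<Rightarrow> bool" where
  "relatively_dense S \<longleftrightarrow> (\<exists>C. compact C \<and> {s + c | s c. s \<in> S \<and> c \<in> C} = UNIV)"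

definition translation_bounded :: "'a::topological_ab_group_add functional \<Rightarrow> bool" where
  "translation_bounded \<mu> \<longleftrightarrow>
     (\<forall>K. compact K \<longrightarrow> (SUP x. variation \<mu> ((\<lambda>k. x + k) ` K)) < \<infinity>)"

definition tilde :: "('a::topological_ab_group_add \<Rightarrow> complex) \<Rightarrow> 'a \<Rightarrow> complex" where
  "tilde f = (\<lambda>x. cnj (f (- x)))"

definition tilde_measure :: "'a::topological_ab_group_add functional \<Rightarrow> 'a functional" where
  "tilde_measure \<mu> = (\<lambda>f. cnj (\<mu> (tilde f)))"

text \<open>
  Used only for compactly supported \<open>\<nu>\<close>; the inner function of \<open>s\<close> is then again in \<open>Cc\<close>.
\<close>

definition convolve_measures ::
  "'a::topological_ab_group_add functional \<Rightarrow> 'a functional \<Rightarrow> 'a functional" where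
  "convolve_measures \<mu> \<nu> = (\<lambda>f. \<mu> (\<lambda>s. \<nu> (\<lambda>t. f (s + t))))"

definition convolve_function_measure ::
  "('a::topological_ab_group_add \<Rightarrow> complex) \<Rightarrow> 'a functional \<Rightarrow> 'a \<Rightarrow> complex" where
  "convolve_function_measure c \<rho> = (\<lambda>x. \<rho> (\<lambda>t. c (x - t)))"

definition bounded_uniformly_continuous ::
  "('a::topological_ab_group_add \<Rightarrow> complex) \<Rightarrow> bool" where
  "bounded_uniformly_continuous f \<longleftrightarrow>
     bounded (range f) \<and>
     (\<forall>e>0. \<exists>U. open U \<and> 0 \<in> U \<and> (\<forall>x y. x - y \<in> U \<longrightarrow> dist (f x) (f y) < e))"

text \<open>
  The closure is taken in the space of all bounded continuous functions with the sup norm; the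
  bounded uniformly continuous functions form a closed subspace of it.
\<close>

definition bohr_almost_periodic :: "('a::topological_ab_group_add \<Rightarrow> complex) \<Rightarrow> bool" where
  "bohr_almost_periodic f \<longleftrightarrow>
     bounded_uniformly_continuous f \<and>
     compact (closure (range (\<lambda>t. Bcontfun (\<lambda>x. f (x - t)))))"

definition SAP :: "'a::topological_ab_group_add functional set" where
  "SAP = {\<rho>. radon_measure \<rho> \<and> translation_bounded \<rho> \<and>
             (\<forall>c\<in>Cc. bohr_almost_periodic (convolve_function_measure c \<rho>))}"

definition haar_measure :: "'a::topological_ab_group_add measure \<Rightarrow> bool" where
  "haar_measure \<theta> \<longleftrightarrow>
     sets \<theta> = sets borel \<and>
     emeasure \<theta> UNIV \<noteq> 0 \<and>
     (\<forall>K. compact K \<longrightarrow> emeasure \<theta> K < \<infinity>) \<and>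
     (\<forall>x. \<forall>A\<in>sets borel. emeasure \<theta> ((\<lambda>a. x + a) ` A) = emeasure \<theta> A) \<and>
     (\<forall>A\<in>sets borel. emeasure \<theta> A = (INF U\<in>{U. open U \<and> A \<subseteq> U}. emeasure \<theta> U)) \<and>
     (\<forall>U. open U \<longrightarrow> emeasure \<theta> U = (SUP K\<in>{K. compact K \<and> K \<subseteq> U}. emeasure \<theta> K))"

definition van_Hove_boundary :: "'a::topological_ab_group_add set \<Rightarrow> 'a set \<Rightarrow> 'a set" where
  "van_Hove_boundary K A =
     closure ({a + k | a k. a \<in> A \<and> k \<in> K} - A) \<union>
     ({b - k | b k. b \<in> closure (- A) \<and> k \<in> K} \<inter> A)"

definition van_Hove_sequence ::
  "'a::topological_ab_group_add measure \<Rightarrow> (nat \<Rightarrow> 'a set) \<Rightarrow> bool" where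
  "van_Hove_sequence \<theta> A \<longleftrightarrow>
     (\<forall>n. compact (A n) \<and> measure \<theta> (A n) > 0) \<and>
     (\<forall>K. compact K \<longrightarrow>
        (\<lambda>n. measure \<theta> (van_Hove_boundary K (A n)) / measure \<theta> (A n)) \<longlonglongrightarrow> 0)"

definition is_autocorrelation ::
  "'a::topological_ab_group_add measure \<Rightarrow> 'a functional \<Rightarrow> 'a functional \<Rightarrow> bool" where
  "is_autocorrelation \<theta> \<mu> \<gamma> \<longleftrightarrow>
     radon_measure \<gamma> \<and>
     (\<exists>A. van_Hove_sequence \<theta> A \<and>
        (\<forall>f\<in>Cc. (\<lambda>n. convolve_measures (restrict_measure \<mu> (A n))
                         (tilde_measure (restrict_measure \<mu> (A n))) f
                       / of_real (measure \<theta> (A n))) \<longlonglongrightarrow> \<gamma> f))"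


section \<open>The dual group\<close>

typedef (overloaded) 'a pontryagin_dual =
  "{\<xi>. continuous_on UNIV (\<xi> :: 'a::topological_ab_group_add \<Rightarrow> complex) \<and>
       (\<forall>x. norm (\<xi> x) = 1) \<and> (\<forall>x y. \<xi> (x + y) = \<xi> x * \<xi> y)}"
  morphisms eval_char Abs_char
  by (rule exI[of _ "\<lambda>_. 1"]) auto

setup_lifting type_definition_pontryagin_dual

lemma eval_char_continuous: "continuous_on UNIV (eval_char \<xi>)"
  and norm_eval_char [simp]: "norm (eval_char \<xi> x) = 1"
  and eval_char_add: "eval_char \<xi> (x + y) = eval_char \<xi> x * eval_char \<xi> y"
  by (transfer, simp)+

instantiation pontryagin_dual :: (topological_ab_group_add) ab_group_add
begin

lift_definition zero_pontryagin_dual :: "'a pontryagin_dual" is "\<lambda>_. 1"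
  by auto

lift_definition plus_pontryagin_dual ::
  "'a pontryagin_dual \<Rightarrow> 'a pontryagin_dual \<Rightarrow> 'a pontryagin_dual" is "\<lambda>\<xi> \<psi> x. \<xi> x * \<psi> x"
  by (auto simp: norm_mult intro: continuous_intros)

lift_definition uminus_pontryagin_dual :: "'a pontryagin_dual \<Rightarrow> 'a pontryagin_dual" is
  "\<lambda>\<xi> x. cnj (\<xi> x)"
  by (auto intro: continuous_intros)

definition minus_pontryagin_dual ::
  "'a pontryagin_dual \<Rightarrow> 'a pontryagin_dual \<Rightarrow> 'a pontryagin_dual" where
  "minus_pontryagin_dual \<xi> \<psi> = \<xi> + - \<psi>"

instance
proof
  fix a b c :: "'a pontryagin_dual"
  show "a + b + c = a + (b + c)" by transfer (simp add: mult.assoc)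
  show "a + b = b + a" by transfer (simp add: mult.commute)
  show "0 + a = a" by transfer simp
  show "- a + a = 0"
  proof transfer
    fix \<xi> :: "'a \<Rightarrow> complex"
    assume "continuous_on UNIV \<xi> \<and> (\<forall>x. norm (\<xi> x) = 1) \<and> (\<forall>x y. \<xi> (x + y) = \<xi> x * \<xi> y)"
    then show "(\<lambda>x. cnj (\<xi> x) * \<xi> x) = (\<lambda>_. 1)"
      by (simp add: complex_norm_square [symmetric] mult.commute)
  qed
  show "a - b = a + - b" by (rule minus_pontryagin_dual_def)
qed

end

text \<open>The compact-open topology, i.e. the topology of uniform convergence on compact sets.\<close>

instantiation pontryagin_dual :: (topological_ab_group_add) topological_space
begin

definition open_pontryagin_dual :: "'a pontryagin_dual set \<Rightarrow> bool" where
  "open_pontryagin_dual S \<longleftrightarrow>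
     (\<forall>\<xi>\<in>S. \<exists>K e. compact K \<and> e > 0 \<and>
        {\<psi>. \<forall>x\<in>K. dist (eval_char \<psi> x) (eval_char \<xi> x) < e} \<subseteq> S)"

instance
proof
  show "open (UNIV :: 'a pontryagin_dual set)"
    unfolding open_pontryagin_dual_def by (auto intro!: exI[of _ "{}"] exI[of _ 1])
next
  fix S T :: "'a pontryagin_dual set"
  assume S: "open S" and T: "open T"
  show "open (S \<inter> T)"
    unfolding open_pontryagin_dual_def
  proof
    fix \<xi> assume \<xi>: "\<xi> \<in> S \<inter> T"
    obtain K e where 1: "compact K" "e > 0"
      "{\<psi>. \<forall>x\<in>K. dist (eval_char \<psi> x) (eval_char \<xi> x) < e} \<subseteq> S"
      using S \<xi> unfolding open_pontryagin_dual_def by (meson IntD1)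
    obtain L d where 2: "compact L" "d > 0"
      "{\<psi>. \<forall>x\<in>L. dist (eval_char \<psi> x) (eval_char \<xi> x) < d} \<subseteq> T"
      using T \<xi> unfolding open_pontryagin_dual_def by (meson IntD2)
    have "{\<psi>. \<forall>x\<in>K \<union> L. dist (eval_char \<psi> x) (eval_char \<xi> x) < min e d} \<subseteq> S \<inter> T"
      using 1(3) 2(3) by auto
    then show "\<exists>K e. compact K \<and> e > 0 \<and>
        {\<psi>. \<forall>x\<in>K. dist (eval_char \<psi> x) (eval_char \<xi> x) < e} \<subseteq> S \<inter> T"
      using 1 2 by (intro exI[of _ "K \<union> L"] exI[of _ "min e d"]) auto
  qed
next
  fix F :: "'a pontryagin_dual set set"
  assume F: "\<forall>S\<in>F. open S"
  show "open (\<Union>F)"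
    unfolding open_pontryagin_dual_def
  proof
    fix \<xi> assume "\<xi> \<in> \<Union>F"
    then obtain S where S: "S \<in> F" "\<xi> \<in> S" by blast
    then obtain K e where "compact K" "e > 0"
      "{\<psi>. \<forall>x\<in>K. dist (eval_char \<psi> x) (eval_char \<xi> x) < e} \<subseteq> S"
      using F unfolding open_pontryagin_dual_def by meson
    with S(1) show "\<exists>K e. compact K \<and> e > 0 \<and>
        {\<psi>. \<forall>x\<in>K. dist (eval_char \<psi> x) (eval_char \<xi> x) < e} \<subseteq> \<Union>F"
      by (intro exI[of _ K] exI[of _ e]) blast
  qed
qed

end

definition char_nbhd :: "'a::topological_ab_group_add pontryagin_dual \<Rightarrow> 'a set \<Rightarrow> real \<Rightarrow>
    'a pontryagin_dual set" where
  "char_nbhd \<xi> K e = {\<psi>. \<forall>x\<in>K. dist (eval_char \<psi> x) (eval_char \<xi> x) < e}"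

lemma open_char_nbhd:
  assumes "compact K"
  shows "open (char_nbhd \<xi> K e)"
  unfolding open_pontryagin_dual_def
proof
  fix \<psi> assume \<psi>: "\<psi> \<in> char_nbhd \<xi> K e"
  show "\<exists>L d. compact L \<and> d > 0 \<and>
      {\<phi>. \<forall>x\<in>L. dist (eval_char \<phi> x) (eval_char \<psi> x) < d} \<subseteq> char_nbhd \<xi> K e"
  proof (cases "K = {}")
    case True
    then show ?thesis by (auto simp: char_nbhd_def intro!: exI[of _ "{}"] exI[of _ 1])
  next
    case False
    have "continuous_on K (\<lambda>x. dist (eval_char \<psi> x) (eval_char \<xi> x))"
      by (intro continuous_intros continuous_on_subset[OF eval_char_continuous]) auto
    from continuous_attains_sup[OF assms False this] obtain m where m: "m \<in> K"
      "\<And>x. x \<in> K \<Longrightarrow>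
        dist (eval_char \<psi> x) (eval_char \<xi> x) \<le> dist (eval_char \<psi> m) (eval_char \<xi> m)"
      by blast
    define d where "d = e - dist (eval_char \<psi> m) (eval_char \<xi> m)"
    have "d > 0" using m(1) \<psi> by (auto simp: d_def char_nbhd_def)
    moreover have "\<phi> \<in> char_nbhd \<xi> K e"
      if "\<forall>x\<in>K. dist (eval_char \<phi> x) (eval_char \<psi> x) < d" for \<phi>
      unfolding char_nbhd_def
    proof (intro CollectI ballI)
      fix x assume x: "x \<in> K"
      have "dist (eval_char \<phi> x) (eval_char \<xi> x)
          \<le> dist (eval_char \<phi> x) (eval_char \<psi> x) + dist (eval_char \<psi> x) (eval_char \<xi> x)"
        by (rule dist_triangle)
      also have "\<dots> < e" using that x m(2)[OF x] by (force simp: d_def)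
      finally show "dist (eval_char \<phi> x) (eval_char \<xi> x) < e" .
    qed
    ultimately show ?thesis using assms by (intro exI[of _ K] exI[of _ d]) auto
  qed
qed

lemma char_nbhd_self: "e > 0 \<Longrightarrow> \<xi> \<in> char_nbhd \<xi> K e"
  by (auto simp: char_nbhd_def)

lemma open_char_contains_nbhd:
  assumes "open S" "\<xi> \<in> S"
  obtains K e where "compact K" "e > 0" "char_nbhd \<xi> K e \<subseteq> S"
  using assms unfolding open_pontryagin_dual_def char_nbhd_def by meson

instance pontryagin_dual :: (topological_ab_group_add) topological_ab_group_add
proof
  fix a b :: "'a pontryagin_dual"
  show "((\<lambda>x. fst x + snd x) \<longlongrightarrow> a + b) (nhds a \<times>\<^sub>F nhds b)"
  proof (rule topological_tendstoI)
    fix S assume "open S" "a + b \<in> S"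
    then obtain K e where K: "compact K" "e > 0" "char_nbhd (a + b) K e \<subseteq> S"
      by (rule open_char_contains_nbhd)
    have "x + y \<in> S" if "x \<in> char_nbhd a K (e/2)" "y \<in> char_nbhd b K (e/2)" for x y
    proof -
      have "x + y \<in> char_nbhd (a + b) K e"
        unfolding char_nbhd_def
      proof (intro CollectI ballI)
        fix t assume t: "t \<in> K"
        have "eval_char (x + y) t - eval_char (a + b) t
          = (eval_char x t - eval_char a t) * eval_char y t
            + eval_char a t * (eval_char y t - eval_char b t)"
          by (simp add: plus_pontryagin_dual.rep_eq algebra_simps)
        then have "dist (eval_char (x + y) t) (eval_char (a + b) t)
          \<le> norm ((eval_char x t - eval_char a t) * eval_char y t)
            + norm (eval_char a t * (eval_char y t - eval_char b t))"
          by (simp only: dist_norm norm_triangle_ineq)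
        also have "\<dots> = dist (eval_char x t) (eval_char a t) + dist (eval_char y t) (eval_char b t)"
          by (simp add: norm_mult dist_norm)
        also have "\<dots> < e" using that t by (force simp: char_nbhd_def)
        finally show "dist (eval_char (x + y) t) (eval_char (a + b) t) < e" .
      qed
      then show ?thesis using K by blast
    qed
    moreover have "\<forall>\<^sub>F x in nhds a. x \<in> char_nbhd a K (e/2)"
      "\<forall>\<^sub>F y in nhds b. y \<in> char_nbhd b K (e/2)"
      using K by (auto intro!: eventually_nhds_in_open open_char_nbhd char_nbhd_self)
    ultimately show "\<forall>\<^sub>F x in nhds a \<times>\<^sub>F nhds b. fst x + snd x \<in> S"
      unfolding eventually_prod_filter
      by (intro exI[of _ "\<lambda>x. x \<in> char_nbhd a K (e/2)"] exI[of _ "\<lambda>y. y \<in> char_nbhd b K (e/2)"])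
        simp
  qed
  show "(uminus \<longlongrightarrow> - a) (nhds a)"
  proof (rule topological_tendstoI)
    fix S assume "open S" "- a \<in> S"
    then obtain K e where K: "compact K" "e > 0" "char_nbhd (- a) K e \<subseteq> S"
      by (rule open_char_contains_nbhd)
    have "- x \<in> char_nbhd (- a) K e" if "x \<in> char_nbhd a K e" for x
      using that unfolding char_nbhd_def
      by (simp add: uminus_pontryagin_dual.rep_eq dist_norm flip: complex_cnj_diff)
    then show "\<forall>\<^sub>F x in nhds a. - x \<in> S"
      using K eventually_nhds_in_open[OF open_char_nbhd[OF K(1)] char_nbhd_self[OF K(2)], of a]
      by (auto elim!: eventually_mono)
  qed
qed

instance pontryagin_dual :: (topological_ab_group_add) t2_space
proof
  fix a b :: "'a pontryagin_dual"
  assume "a \<noteq> b"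
  then obtain x where x: "eval_char a x \<noteq> eval_char b x"
    by (auto simp flip: eval_char_inject)
  define d where "d = dist (eval_char a x) (eval_char b x) / 2"
  have "d > 0" using x by (simp add: d_def)
  have "char_nbhd a {x} d \<inter> char_nbhd b {x} d = {}"
  proof (rule ccontr)
    assume "\<not> ?thesis"
    then obtain c where "dist (eval_char c x) (eval_char a x) < d"
      "dist (eval_char c x) (eval_char b x) < d"
      by (auto simp: char_nbhd_def)
    then show False
      using dist_triangle3[of "eval_char a x" "eval_char b x" "eval_char c x"] by (simp add: d_def)
  qed
  then show "\<exists>U V. open U \<and> open V \<and> a \<in> U \<and> b \<in> V \<and> U \<inter> V = {}"
    using open_char_nbhd[of "{x}" a d] open_char_nbhd[of "{x}" b d]
      char_nbhd_self[OF \<open>d > 0\<close>, of a "{x}"] char_nbhd_self[OF \<open>d > 0\<close>, of b "{x}"]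
    by - (rule exI[of _ "char_nbhd a {x} d"], rule exI[of _ "char_nbhd b {x} d"], simp)
qed


section \<open>The Fourier transform\<close>

definition convolve_functions :: "'a::topological_ab_group_add measure \<Rightarrow>
    ('a \<Rightarrow> complex) \<Rightarrow> ('a \<Rightarrow> complex) \<Rightarrow> 'a \<Rightarrow> complex" where
  "convolve_functions \<theta> f g = (\<lambda>x. LINT t|\<theta>. f t * g (x - t))"

definition inverse_Fourier :: "'a::topological_ab_group_add measure \<Rightarrow>
    ('a \<Rightarrow> complex) \<Rightarrow> 'a pontryagin_dual \<Rightarrow> complex" where
  "inverse_Fourier \<theta> f = (\<lambda>\<xi>. LINT t|\<theta>. eval_char \<xi> t * f t)"

text \<open>
  For a positive definite measure \<open>\<gamma>\<close>, the relation below determines \<open>\<nu>\<close> uniquely on \<open>Cc\<close>.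
\<close>

definition is_Fourier_transform :: "'a::topological_ab_group_add measure \<Rightarrow>
    'a functional \<Rightarrow> 'a pontryagin_dual functional \<Rightarrow> bool" where
  "is_Fourier_transform \<theta> \<gamma> \<nu> \<longleftrightarrow>
     positive_radon_measure \<nu> \<and>
     (\<forall>f\<in>Cc. has_radon_integral \<nu>
        (\<lambda>\<xi>. of_real ((norm (inverse_Fourier \<theta> f \<xi>))\<^sup>2))
        (\<gamma> (convolve_functions \<theta> f (tilde f))))"

end

theory Submission
  imports Defs
begin

text \<open>
  Write \<open>\<nu>\<close> for the Fourier transform of \<open>\<gamma>\<close>.  If \<open>Q\<close> is the product of two transforms of functions
  in \<open>Cc\<close>, then \<open>\<psi> \<mapsto> \<integral> \<xi>(t) Q(\<xi> - \<psi>) d\<nu>(\<xi>)\<close> is \<open>\<gamma>\<close> applied to a compactly supported function that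
  has been translated by \<open>t\<close> and multiplied by a character.  As \<open>\<gamma>\<close> lives on an FLC set, this is a
  trigonometric polynomial in \<open>\<psi>\<close> whose number of terms, coefficients and frequencies are bounded
  independently of \<open>t\<close>; such polynomials form a compact set for pointwise convergence.  By
  Stone--Weierstrass every \<open>c\<close> in \<open>Cc\<close> of the dual group is close to some \<open>Q\<close> relative to a
  \<open>\<nu>\<close>-integrable weight, so \<open>c * \<nu>\<close> is a uniform limit of trigonometric polynomials.  A Wiener
  argument with finite averages of characters, combined with the pigeonhole principle, yields \<open>t\<close>
  for which multiplication by \<open>\<xi>(t)\<close> nearly annihilates the continuous part of \<open>\<nu>\<close> on given test
  functions and nearly fixes the discrete part.  Hence \<open>c * \<nu>\<^sub>d\<close> is, on finite sets, close to the
      same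
  compact family of polynomials, and it is a uniform limit of them as well.  Relative density
      follows
  since an almost periodic function that does not vanish identically is nonzero on a relatively
  dense set.
\<close>

section \<open>Locally compact spaces and groups\<close>

text \<open>Neither the group nor its dual is assumed metrizable or sigma-compact. This shapes the
  argument: \<open>Wiener\<close> handles only finitely many test functions at a time, so a suitable
  \<open>t\<close> is found for finitely many \<open>\<psi>\<close> at once, and the finite
  intersection property replaces passage to a limit along a sequence. Multiplying
  \<open>\<nu>\<close> by \<open>\<xi>(t)\<close> corresponds to translating
  \<open>\<gamma>\<close>, which is why the discrete part inherits exactly those bounds that are
  insensitive to translation; the continuous part is reached only as a difference. Uniform
  approximation of \<open>c\<close> alone would be worthless, since \<open>\<nu>\<close> may have
  infinite mass. The weight is the squared modulus of a transform: its integrals against all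
  translates of \<open>\<nu>\<close> share one bound, because on the side of \<open>\<gamma>\<close>
  a translate of \<open>\<nu>\<close> is a modulation, which changes neither the support nor the
  modulus of a test function. Measures are functionals on \<open>Cc\<close>, so integrals of other
  functions are accessible only through the upper seminorm of the variation, and atoms have to be
  computed from \<open>Cc\<close> functions.\<close>

lemma lc_compact_nbhd:
  assumes lc: "locally compact (UNIV :: 'a::t2_space set)"
    and K: "compact K" and U: "open U" "K \<subseteq> (U :: 'a set)"
  obtains V L where "open V" "compact L" "K \<subseteq> V" "V \<subseteq> L" "L \<subseteq> U"
proof -
  have "\<exists>u v. open u \<and> compact v \<and> x \<in> u \<and> u \<subseteq> v \<and> v \<subseteq> U" if "x \<in> K" for x
    using lc U(1) subsetD[OF U(2) that] unfolding locally_def by simp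
  then obtain u v where uv: "\<And>x. x \<in> K \<Longrightarrow> open (u x) \<and> compact (v x) \<and> x \<in> u x \<and> u x \<subseteq> v x \<and> v x \<subseteq> U"
    by metis
  obtain F where F: "F \<subseteq> K" "finite F" "K \<subseteq> (\<Union>x\<in>F. u x)"
    by (rule compactE_image[OF K, of K u]) (use uv in auto)
  show thesis
  proof
    show "open (\<Union>x\<in>F. u x)" "compact (\<Union>x\<in>F. v x)" using uv F by (auto intro!: compact_UN)
  qed (use uv F in blast)+
qed

lemma lc_point_nbhd:
  assumes lc: "locally compact (UNIV :: 'a::t2_space set)" and U: "open U" "x \<in> (U :: 'a set)"
  obtains V L where "open V" "compact L" "x \<in> V" "V \<subseteq> L" "L \<subseteq> U"
  using lc_compact_nbhd[OF lc, of "{x}" U] U that by auto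

section \<open>Functions of compact support and cut-off functions\<close>

lemma supp_subset:
  assumes "closed K" "\<And>x. x \<notin> K \<Longrightarrow> f x = 0"
  shows "supp f \<subseteq> K"
  unfolding supp_def using assms by (intro closure_minimal) auto

lemma notin_supp: "x \<notin> supp f \<Longrightarrow> f x = 0"
  unfolding supp_def using closure_subset[of "{x. f x \<noteq> 0}"] by auto

lemma closed_supp: "closed (supp f)"
  by (simp add: supp_def)

lemma supp_mult_subset: "supp (\<lambda>x. g x * f x) \<subseteq> supp f"
  by (rule supp_subset[OF closed_supp]) (simp add: notin_supp)

lemma CcI:
  fixes K :: "'a::t2_space set"
  assumes "continuous_on UNIV f" "compact K" "\<And>x. x \<notin> K \<Longrightarrow> f x = 0"
  shows "f \<in> Cc"
proof -
  have "supp f \<subseteq> K" using assms by (intro supp_subset compact_imp_closed)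
  then have "compact (K \<inter> supp f)" using assms(2)
    by (intro compact_Int_closed) (auto simp: supp_def)
  then show ?thesis using \<open>supp f \<subseteq> K\<close> assms(1) by (simp add: Cc_def Int_absorb1)
qed

lemma Cc_continuous: "f \<in> Cc \<Longrightarrow> continuous_on A f"
  unfolding Cc_def using continuous_on_subset by blast

lemma Cc_compact: "f \<in> Cc \<Longrightarrow> compact (supp f)"
  by (simp add: Cc_def)

lemma Cc_bounded:
  assumes "f \<in> Cc"
  obtains B where "B > 0" "\<And>x. norm (f x) \<le> B"
proof -
  have "bounded (f ` supp f)"
    using assms by (intro compact_imp_bounded compact_continuous_image Cc_continuous Cc_compact)
  then obtain B where B: "B > 0" "\<forall>y\<in>f ` supp f. norm y \<le> B" unfolding bounded_pos by blast
  have "norm (f x) \<le> B" for x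
    by (cases "x \<in> supp f") (use B notin_supp[of x f] in auto)
  with B(1) that show thesis by blast
qed

lemma Cc_zero [simp]: "(\<lambda>x::'a::t2_space. 0) \<in> Cc"
  by (rule CcI[where K="{}"]) auto

lemma Cc_add: "f \<in> Cc \<Longrightarrow> g \<in> Cc \<Longrightarrow> (\<lambda>x::'a::t2_space. f x + g x) \<in> Cc"
  by (rule CcI[where K="supp f \<union> supp g"])
    (auto intro!: continuous_intros compact_Un simp: notin_supp Cc_continuous Cc_compact)

lemma Cc_diff: "f \<in> Cc \<Longrightarrow> g \<in> Cc \<Longrightarrow> (\<lambda>x::'a::t2_space. f x - g x) \<in> Cc"
  by (rule CcI[where K="supp f \<union> supp g"])
    (auto intro!: continuous_intros compact_Un simp: notin_supp Cc_continuous Cc_compact)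

lemma Cc_mult: "continuous_on UNIV g \<Longrightarrow> f \<in> Cc \<Longrightarrow> (\<lambda>x::'a::t2_space. g x * f x) \<in> Cc"
  by (rule CcI[where K="supp f"])
    (auto intro!: continuous_intros simp: notin_supp Cc_continuous Cc_compact)

lemma Cc_mult2: "continuous_on UNIV g \<Longrightarrow> f \<in> Cc \<Longrightarrow> (\<lambda>x::'a::t2_space. f x * g x) \<in> Cc"
  using Cc_mult[of g f] by (simp add: mult.commute)

lemma Cc_cmult: "f \<in> Cc \<Longrightarrow> (\<lambda>x::'a::t2_space. c * f x) \<in> Cc"
  by (rule Cc_mult) auto

lemma Cc_cnj: "f \<in> Cc \<Longrightarrow> (\<lambda>x::'a::t2_space. cnj (f x)) \<in> Cc"
  by (rule CcI[where K="supp f"])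
    (auto intro!: continuous_intros simp: notin_supp Cc_continuous Cc_compact)

lemma Cc_norm: "f \<in> Cc \<Longrightarrow> (\<lambda>x::'a::t2_space. complex_of_real (norm (f x))) \<in> Cc"
  by (rule CcI[where K="supp f"])
    (auto intro!: continuous_intros simp: notin_supp Cc_continuous Cc_compact)

lemma Cc_sum:
  "(\<And>i. i \<in> I \<Longrightarrow> f i \<in> Cc) \<Longrightarrow> (\<lambda>x::'a::t2_space. \<Sum>i\<in>I. f i x) \<in> Cc"
  by (induction I rule: infinite_finite_induct) (auto intro: Cc_add)

text \<open>The open plateau \<open>W\<close> is what later splittings need: \<open>1 - b\<close>
  vanishes near \<open>K\<close>, so the support of \<open>(1 - b) * g\<close> avoids
  \<open>K\<close>.\<close>

lemma lc_bump:
  fixes K U :: "'a::t2_space set"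
  assumes lc: "locally compact (UNIV :: 'a set)" and K: "compact K" and U: "open U" "K \<subseteq> U"
  obtains b :: "'a \<Rightarrow> real" and W where "(\<lambda>x. complex_of_real (b x)) \<in> Cc"
    "supp (\<lambda>x. complex_of_real (b x)) \<subseteq> U" "\<And>x. 0 \<le> b x" "\<And>x. b x \<le> 1"
    "open W" "K \<subseteq> W" "\<And>x. x \<in> W \<Longrightarrow> b x = 1" "continuous_on UNIV b"
proof -
  obtain V L where V: "open V" "compact L" "K \<subseteq> V" "V \<subseteq> L" "L \<subseteq> U"
    using lc_compact_nbhd[OF lc K U] .
  have Haus: "Hausdorff_space (euclidean :: 'a topology)"
    unfolding Hausdorff_space_def disjnt_def using hausdorff by (metis open_openin)
  have "locally_compact_space (euclidean :: 'a topology)"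
    unfolding locally_compact_space_def
    using lc_point_nbhd[OF lc open_UNIV UNIV_I] by (metis compactin_euclidean_iff open_openin)
  then have cr: "completely_regular_space (euclidean :: 'a topology)"
    using Haus locally_compact_regular_imp_completely_regular_space
      locally_compact_Hausdorff_imp_regular_space by blast
  obtain f :: "'a \<Rightarrow> real" where f: "continuous_map euclidean (subtopology euclidean {0..1}) f"
    "f ` (- V) \<subseteq> {0}" "f ` K \<subseteq> {1}"
    by (rule Urysohn_completely_regular_compact_closed[OF _ cr, of 0 1 K "- V"])
      (use V K in \<open>auto simp: disjnt_def\<close>)
  have cf: "continuous_on UNIV f" and f01: "0 \<le> f x" "f x \<le> 1" for x
    using f(1) by (auto simp: continuous_map_in_subtopology Pi_iff image_subset_iff)
  \<comment> \<open>Urysohn's function is known to be 1 only on \<open>K\<close>; doubling and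
    truncating makes it 1 on the open set where \<open>f\<close> exceeds 1/2.\<close>
  define b where "b x = min 1 (2 * f x)" for x
  have cb: "continuous_on UNIV b" unfolding b_def using cf by (intro continuous_intros)
  have bz: "b x = 0" if "x \<notin> L" for x
    using that f(2) V(4) by (fastforce simp: b_def)
  show thesis
  proof
    show "(\<lambda>x. complex_of_real (b x)) \<in> Cc"
      by (rule CcI[OF _ V(2)]) (use cb bz in \<open>auto intro: continuous_intros\<close>)
    show "supp (\<lambda>x. complex_of_real (b x)) \<subseteq> U"
      using supp_subset[of L "\<lambda>x. complex_of_real (b x)"] bz V compact_imp_closed by fastforce
    show "0 \<le> b x" "b x \<le> 1" for x using f01[of x] by (auto simp: b_def)
    show "open {x. 1/2 < f x}" using cf by (intro open_Collect_less) auto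
    show "K \<subseteq> {x. 1/2 < f x}" using f(3) by force
    show "x \<in> {x. 1/2 < f x} \<Longrightarrow> b x = 1" for x by (auto simp: b_def)
    show "continuous_on UNIV b" by (rule cb)
  qed
qed

lemma lc_point_bump:
  fixes U :: "'a::t2_space set"
  assumes lc: "locally compact (UNIV :: 'a set)" and U: "open U" "x \<in> U"
  obtains b :: "'a \<Rightarrow> real" and W where "(\<lambda>x. complex_of_real (b x)) \<in> Cc"
    "supp (\<lambda>x. complex_of_real (b x)) \<subseteq> U" "\<And>x. 0 \<le> b x" "\<And>x. b x \<le> 1"
    "open W" "x \<in> W" "\<And>y. y \<in> W \<Longrightarrow> b y = 1" "continuous_on UNIV b"
  using lc_bump[OF lc, of "{x}" U] U that by (metis compact_sing empty_subsetI insert_subset)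

section \<open>The uniform structure of a topological abelian group\<close>

lemma group_nbhd_half:
  assumes U: "open U" "(0::'a::topological_ab_group_add) \<in> U"
  obtains V where "open V" "0 \<in> V" "\<And>x y. x \<in> V \<Longrightarrow> y \<in> V \<Longrightarrow> x + y \<in> U"
    "\<And>x. x \<in> V \<Longrightarrow> - x \<in> V" "\<And>x y. x \<in> V \<Longrightarrow> y \<in> V \<Longrightarrow> x - y \<in> U"
proof -
  have "\<forall>\<^sub>F p in nhds (0::'a) \<times>\<^sub>F nhds 0. fst p + snd p \<in> U"
    using tendsto_add_Pair[of "0::'a" 0] U by (simp add: tendsto_def)
  then obtain P Q where "eventually P (nhds (0::'a))" "eventually Q (nhds (0::'a))"
    and PQ: "\<And>x y. P x \<Longrightarrow> Q y \<Longrightarrow> x + y \<in> U"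
    unfolding eventually_prod_filter by auto
  then obtain A B where A: "open A" "0 \<in> A" "\<And>x. x \<in> A \<Longrightarrow> P x"
    and B: "open B" "0 \<in> B" "\<And>x. x \<in> B \<Longrightarrow> Q x"
    unfolding eventually_nhds by metis
  define V where "V = (A \<inter> B) \<inter> uminus -` (A \<inter> B)"
  have "open (uminus -` (A \<inter> B))"
    using A B by (intro open_vimage) (auto intro!: continuous_intros)
  then have "open V" unfolding V_def using A B by auto
  then show thesis
  proof (rule that)
    show "0 \<in> V" using A B by (auto simp: V_def)
    show a: "x + y \<in> U" if "x \<in> V" "y \<in> V" for x y using that A B PQ by (auto simp: V_def)
    show m: "- x \<in> V" if "x \<in> V" for x using that by (auto simp: V_def)
    show "x - y \<in> U" if "x \<in> V" "y \<in> V" for x y using a[OF that(1) m[OF that(2)]] by simp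
  qed
qed

lemma continuous_on_shifts:
  fixes a :: "'a::topological_ab_group_add"
  shows "continuous_on A (\<lambda>x. x - a)" "continuous_on A (\<lambda>x. a - x)"
    "continuous_on A (\<lambda>x. x + a)" "continuous_on A (\<lambda>x. a + x)" "continuous_on A (\<lambda>x. - x)"
  by (intro continuous_intros)+

lemma open_translation:
  fixes U :: "'a::topological_ab_group_add set"
  assumes "open U"
  shows "open {x. x - a \<in> U}" "open {x. a - x \<in> U}" "open {x. x + a \<in> U}"
  using assms[THEN open_vimage, OF continuous_on_shifts(1), of a]
    assms[THEN open_vimage, OF continuous_on_shifts(2), of a]
    assms[THEN open_vimage, OF continuous_on_shifts(3), of a]
  by (simp_all add: vimage_def)

lemma compact_minus_set:
  fixes A B :: "'a::topological_ab_group_add set"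
  assumes "compact A" "compact B"
  shows "compact ((\<lambda>(x, y). x - y) ` (A \<times> B))"
  using assms unfolding split_def
  by (intro compact_continuous_image compact_Times continuous_intros)

lemma compact_uminus_image:
  fixes A :: "'a::topological_ab_group_add set"
  shows "compact A \<Longrightarrow> compact (uminus ` A)"
  by (intro compact_continuous_image continuous_intros)

lemma compact_translation_image:
  fixes A :: "'a::topological_ab_group_add set"
  shows "compact A \<Longrightarrow> compact ((\<lambda>x. x + a) ` A)"
  by (intro compact_continuous_image continuous_intros)

lemma Cc_comp_homeo:
  fixes \<phi> :: "'a::t2_space \<Rightarrow> 'a"
  assumes "f \<in> Cc" "continuous_on UNIV \<phi>" "continuous_on UNIV \<phi>'" "\<And>x. \<phi>' (\<phi> x) = x"
  shows "(\<lambda>x. f (\<phi> x)) \<in> Cc"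
proof (rule CcI)
  show "continuous_on UNIV (\<lambda>x. f (\<phi> x))"
    using assms by (intro continuous_on_compose2[OF Cc_continuous[of f UNIV]]) auto
  show "compact (\<phi>' ` supp f)" using assms
    by (intro compact_continuous_image Cc_compact continuous_on_subset[OF assms(3)]) auto
  show "f (\<phi> x) = 0" if "x \<notin> \<phi>' ` supp f" for x
    using that assms(4) by (metis notin_supp imageI)
qed

lemma Cc_translate:
  fixes f :: "'a::{topological_ab_group_add,t2_space} \<Rightarrow> complex"
  assumes "f \<in> Cc"
  shows "(\<lambda>x. f (x - a)) \<in> Cc" "(\<lambda>x. f (a - x)) \<in> Cc" "(\<lambda>x. f (- x)) \<in> Cc"
    "(\<lambda>x. f (x + a)) \<in> Cc" "(\<lambda>x. f (a + x)) \<in> Cc"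
  by (rule Cc_comp_homeo[OF assms, of _ "\<lambda>x. x + a"] Cc_comp_homeo[OF assms, of _ "\<lambda>x. a - x"]
      Cc_comp_homeo[OF assms, of _ "\<lambda>x. - x"] Cc_comp_homeo[OF assms, of _ "\<lambda>x. x - a"],
      auto intro: continuous_on_shifts)+

lemma Cc_tilde:
  fixes f :: "'a::{topological_ab_group_add,t2_space} \<Rightarrow> complex"
  shows "f \<in> Cc \<Longrightarrow> tilde f \<in> Cc"
  unfolding tilde_def by (intro Cc_cnj Cc_translate)

lemma Cc_uniformly_continuous:
  fixes f :: "'a::{topological_ab_group_add,t2_space} \<Rightarrow> complex"
  assumes f: "f \<in> Cc" and e: "e > 0"
  obtains U where "open U" "0 \<in> U" "\<And>x y. x - y \<in> U \<Longrightarrow> dist (f x) (f y) < e"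
proof -
  \<comment> \<open>Two increments are allowed: one leads from the centre \<open>a\<close> of a
    covering set to \<open>y\<close>, the other is the displacement \<open>x - y\<close>.\<close>
  have "\<exists>W. open W \<and> 0 \<in> W \<and> (\<forall>u\<in>W. \<forall>v\<in>W. dist (f (a + (u + v))) (f a) < e/2)" for a
  proof -
    have "open {x. dist (f x) (f a) < e/2}"
      using f by (intro open_Collect_less continuous_intros Cc_continuous)
    then have "open {x. x + a \<in> {x. dist (f x) (f a) < e/2}}" by (rule open_translation)
    moreover have "0 \<in> {x. x + a \<in> {x. dist (f x) (f a) < e/2}}" using e by simp
    ultimately obtain W where "open W" "0 \<in> W"
      "\<And>u v. u \<in> W \<Longrightarrow> v \<in> W \<Longrightarrow> u + v \<in> {x. x + a \<in> {x. dist (f x) (f a) < e/2}}"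
      using group_nbhd_half by metis
    then show ?thesis by (auto simp: add_ac intro!: exI[of _ W])
  qed
  then obtain W where W: "\<And>a. open (W a)" "\<And>a. 0 \<in> W a"
    "\<And>a u v. u \<in> W a \<Longrightarrow> v \<in> W a \<Longrightarrow> dist (f (a + (u + v))) (f a) < e/2" by metis
  obtain F where F: "F \<subseteq> supp f" "finite F" "supp f \<subseteq> (\<Union>a\<in>F. {x. x - a \<in> W a})"
    by (rule compactE_image[OF Cc_compact[OF f], of "supp f" "\<lambda>a. {x. x - a \<in> W a}"])
      (use W in \<open>auto intro: open_translation\<close>)
  define V where "V = (\<Inter>a\<in>F. W a)"
  \<comment> \<open>The estimate below requires \<open>y\<close> to lie in the support. Symmetry of
    \<open>U\<close> lets \<open>x\<close> and \<open>y\<close> change roles; if neither lies in the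
    support, both values are 0.\<close>
  define U where "U = V \<inter> uminus -` V"
  have "open V" unfolding V_def using W F by (intro open_INT) auto
  then have "open U" unfolding U_def by (intro open_Int open_vimage continuous_intros) auto
  have "0 \<in> U" using W by (auto simp: U_def V_def)
  have *: "dist (f x) (f y) < e" if V: "x - y \<in> V" and y: "y \<in> supp f" for x y
  proof -
    obtain a where a: "a \<in> F" "y - a \<in> W a" using F(3) y by auto
    have "dist (f y) (f a) < e/2" using W(3)[OF a(2) W(2)[of a]] by simp
    moreover have "dist (f x) (f a) < e/2"
      using W(3)[OF a(2), of "x - y"] V a(1) by (simp add: V_def)
    ultimately show ?thesis by (metis dist_triangle_half_l dist_commute)
  qed
  show thesis
  proof
    show "dist (f x) (f y) < e" if "x - y \<in> U" for x y
    proof -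
      have "x - y \<in> V" "y - x \<in> V" using that by (auto simp: U_def)
      then show ?thesis
        using *[of x y] *[of y x] e notin_supp[of x f] notin_supp[of y f]
        by (cases "y \<in> supp f"; cases "x \<in> supp f") (auto simp: dist_commute)
    qed
  qed (use \<open>open U\<close> \<open>0 \<in> U\<close> in auto)
qed

section \<open>Radon measures\<close>

lemma radon_add: "radon_measure \<mu> \<Longrightarrow> f \<in> Cc \<Longrightarrow> g \<in> Cc \<Longrightarrow> \<mu> (\<lambda>x. f x + g x) = \<mu> f + \<mu> g"
  by (simp add: radon_measure_def)

lemma radon_cmult: "radon_measure \<mu> \<Longrightarrow> f \<in> Cc \<Longrightarrow> \<mu> (\<lambda>x. c * f x) = c * \<mu> f"
  by (simp add: radon_measure_def)

lemma radon_diff: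
  "radon_measure \<mu> \<Longrightarrow> f \<in> Cc \<Longrightarrow> g \<in> Cc \<Longrightarrow> \<mu> (\<lambda>x::'a::t2_space. f x - g x) = \<mu> f - \<mu> g"
  using radon_add[of \<mu> f "\<lambda>x. - 1 * g x"] radon_cmult[of \<mu> g "- 1"] Cc_cmult[of g "- 1"] by simp

lemma radon_zero: "radon_measure \<mu> \<Longrightarrow> \<mu> (\<lambda>x::'a::t2_space. 0) = 0"
  using radon_cmult[of \<mu> "\<lambda>x. 0" 0] by simp

lemma radon_sum:
  "radon_measure \<mu> \<Longrightarrow> (\<And>i. i \<in> I \<Longrightarrow> f i \<in> Cc) \<Longrightarrow>
    \<mu> (\<lambda>x::'a::t2_space. \<Sum>i\<in>I. f i x) = (\<Sum>i\<in>I. \<mu> (f i))"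
proof (induction I rule: infinite_finite_induct)
  case (insert i I)
  have "\<mu> (\<lambda>x. f i x + (\<Sum>j\<in>I. f j x)) = \<mu> (f i) + \<mu> (\<lambda>x. \<Sum>j\<in>I. f j x)"
    using insert.prems by (intro radon_add Cc_sum) auto
  then show ?case using insert by simp
qed (auto simp: radon_zero)

lemma radon_bound:
  assumes "radon_measure \<mu>" "compact K"
  obtains C where "C > 0"
    "\<And>f B. f \<in> Cc \<Longrightarrow> supp f \<subseteq> K \<Longrightarrow> (\<And>x. norm (f x) \<le> B) \<Longrightarrow> norm (\<mu> f) \<le> C * B"
proof -
  obtain C where C: "\<forall>f\<in>Cc. \<forall>B. supp f \<subseteq> K \<and> (\<forall>x. norm (f x) \<le> B) \<longrightarrow> norm (\<mu> f) \<le> C * B"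
    using assms unfolding radon_measure_def by blast
  show thesis
  proof (rule that[of "max C 1"])
    fix f B assume f: "f \<in> Cc" "supp f \<subseteq> K" "\<And>x. norm (f x) \<le> B"
    have "0 \<le> B" using f(3)[of undefined] norm_ge_zero order_trans by blast
    then have "C * B \<le> max C 1 * B" by (intro mult_right_mono) auto
    moreover have "norm (\<mu> f) \<le> C * B" using C f by blast
    ultimately show "norm (\<mu> f) \<le> max C 1 * B" by linarith
  qed auto
qed

text \<open>Each point off the support has an open neighbourhood on which the functional vanishes.
  Finitely many of these cover \<open>supp f\<close>, and cut-offs split \<open>f\<close> into
  pieces supported in one of them each.\<close>

lemma measure_support_disjoint_imp_zero:
  fixes \<mu> :: "'a::t2_space functional"
  assumes lc: "locally compact (UNIV :: 'a set)" and \<mu>: "radon_measure \<mu>"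
    and f: "f \<in> Cc" "supp f \<inter> measure_support \<mu> = {}"
  shows "\<mu> f = 0"
proof -
  let ?null = "\<lambda>U. open U \<and> (\<forall>g\<in>Cc. supp g \<subseteq> U \<longrightarrow> \<mu> g = 0)"
  have cover: "\<mu> g = 0" if "finite \<U>" "\<forall>U\<in>\<U>. ?null U" "g \<in> Cc" "supp g \<subseteq> \<Union>\<U>" for \<U> g
    using that
  proof (induction \<U> arbitrary: g rule: finite_induct)
    case empty
    then have "g = (\<lambda>x. 0)" using notin_supp[of _ g] by auto
    then show ?case using radon_zero[OF \<mu>] by simp
  next
    case (insert U \<U>)
    have "open (\<Union>\<U>)" using insert.prems by blast
    then have "compact (supp g - \<Union>\<U>)"
      using insert.prems by (intro compact_diff Cc_compact)
    moreover have "supp g - \<Union>\<U> \<subseteq> U" "open U" using insert.prems by auto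
    ultimately obtain b W where b: "(\<lambda>x. complex_of_real (b x)) \<in> Cc"
      "supp (\<lambda>x. complex_of_real (b x)) \<subseteq> U" "open W" "supp g - \<Union>\<U> \<subseteq> W"
      "\<And>x. x \<in> W \<Longrightarrow> b x = 1" "continuous_on UNIV b"
      using lc_bump[OF lc, of "supp g - \<Union>\<U>" U] by metis
    have g1: "(\<lambda>x. complex_of_real (b x) * g x) \<in> Cc"
      and g2: "(\<lambda>x. complex_of_real (1 - b x) * g x) \<in> Cc"
      using b insert.prems by (auto intro!: Cc_mult continuous_intros)
    have "supp (\<lambda>x. complex_of_real (b x) * g x) \<subseteq> U"
      using b(2) unfolding supp_def by (smt (verit) Collect_mono closure_mono mult_eq_0_iff
          order_trans)
    then have 1: "\<mu> (\<lambda>x. complex_of_real (b x) * g x) = 0" using insert.prems g1 by blast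
    have "supp (\<lambda>x. complex_of_real (1 - b x) * g x) \<subseteq> supp g - W"
    proof (rule supp_subset)
      show "closed (supp g - W)" using b(3) by (auto simp: supp_def)
    qed (use b(5) notin_supp[of _ g] in auto)
    then have 2: "\<mu> (\<lambda>x. complex_of_real (1 - b x) * g x) = 0"
      using insert.prems g2 b(4) by (intro insert.IH) auto
    have "\<mu> g = \<mu> (\<lambda>x. complex_of_real (b x) * g x + complex_of_real (1 - b x) * g x)"
      by (simp add: algebra_simps)
    then show ?case using 1 2 radon_add[OF \<mu> g1 g2] by simp
  qed
  have "\<exists>U. ?null U \<and> x \<in> U" if "x \<in> supp f" for x
  proof -
    have "x \<notin> measure_support \<mu>" using that f(2) by blast
    then show ?thesis unfolding measure_support_def by auto
  qed
  then obtain U where U: "\<And>x. x \<in> supp f \<Longrightarrow> ?null (U x) \<and> x \<in> U x" by metis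
  obtain F where F: "F \<subseteq> supp f" "finite F" "supp f \<subseteq> (\<Union>x\<in>F. U x)"
    by (rule compactE_image[OF Cc_compact[OF f(1)], of "supp f" U]) (use U in auto)
  show ?thesis using F U f(1) by (intro cover[of "U ` F"]) auto
qed

section \<open>Haar integration of compactly supported functions\<close>

lemma eval_char_zero [simp]: "eval_char \<xi> 0 = 1"
proof -
  have "eval_char \<xi> 0 * eval_char \<xi> 0 = eval_char \<xi> 0 * 1"
    using eval_char_add[of \<xi> 0 0] by simp
  moreover have "eval_char \<xi> 0 \<noteq> 0" using norm_eval_char[of \<xi> 0] by (metis norm_zero zero_neq_one)
  ultimately show ?thesis by simp
qed

lemma eval_char_mult_cnj: "eval_char \<xi> x * cnj (eval_char \<xi> x) = 1"
  using complex_norm_square[of "eval_char \<xi> x"] by simp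

lemma eval_char_uminus: "eval_char \<xi> (- x) = cnj (eval_char \<xi> x)"
proof -
  have "eval_char \<xi> (- x) = eval_char \<xi> (- x) * (eval_char \<xi> x * cnj (eval_char \<xi> x))"
    by (simp add: eval_char_mult_cnj)
  also have "\<dots> = eval_char \<xi> (- x + x) * cnj (eval_char \<xi> x)"
    unfolding eval_char_add by (simp add: mult_ac)
  finally show ?thesis by simp
qed

lemma eval_char_diff: "eval_char \<xi> (x - y) = eval_char \<xi> x * cnj (eval_char \<xi> y)"
  using eval_char_add[of \<xi> x "- y"] by (simp add: eval_char_uminus)

lemma eval_dual_add: "eval_char (\<xi> + \<psi>) x = eval_char \<xi> x * eval_char \<psi> x"
  by (simp add: plus_pontryagin_dual.rep_eq)

lemma eval_dual_zero [simp]: "eval_char 0 x = 1"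
  by (simp add: zero_pontryagin_dual.rep_eq)

lemma eval_dual_uminus: "eval_char (- \<xi>) x = cnj (eval_char \<xi> x)"
  by (simp add: uminus_pontryagin_dual.rep_eq)

lemma eval_dual_diff: "eval_char (\<xi> - \<psi>) x = eval_char \<xi> x * cnj (eval_char \<psi> x)"
  using eval_dual_add[of \<xi> "- \<psi>" x] by (simp add: eval_dual_uminus)

text \<open>A tube argument: finitely many product neighbourhoods cover the fibre over
  \<open>x0\<close>, and the intersection of their first factors serves all of
  \<open>L\<close>.\<close>

lemma uniform_continuity_on_compact_fibres:
  fixes F :: "'b::topological_space \<Rightarrow> 'c::topological_space \<Rightarrow> complex"
  assumes F: "continuous_on UNIV (\<lambda>p. F (fst p) (snd p))" and L: "compact L" and e: "e > 0"
  obtains U where "open U" "x0 \<in> U" "\<And>x y. x \<in> U \<Longrightarrow> y \<in> L \<Longrightarrow> dist (F x y) (F x0 y) < e"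
proof -
  have "\<exists>A B. open A \<and> open B \<and> x0 \<in> A \<and> y \<in> B \<and>
      (\<forall>x\<in>A. \<forall>z\<in>B. dist (F x z) (F x0 z) < e)" for y
  proof -
    have "open {p. dist (F (fst p) (snd p)) (F x0 y) < e/2}"
      using F by (intro open_Collect_less continuous_intros) auto
    moreover have "(x0, y) \<in> {p. dist (F (fst p) (snd p)) (F x0 y) < e/2}" using e by simp
    ultimately obtain A B where AB: "open A" "open B" "(x0, y) \<in> A \<times> B"
      "A \<times> B \<subseteq> {p. dist (F (fst p) (snd p)) (F x0 y) < e/2}"
      by (rule open_prod_elim)
    have "dist (F x z) (F x0 z) < e" if "x \<in> A" "z \<in> B" for x z
    proof -
      have "(x, z) \<in> A \<times> B" "(x0, z) \<in> A \<times> B" using that AB(3) by auto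
      then have "dist (F x z) (F x0 y) < e/2" "dist (F x0 z) (F x0 y) < e/2"
        using AB(4) by auto
      then show ?thesis by (metis dist_triangle_half_l dist_commute)
    qed
    then show ?thesis using AB by (intro exI[of _ A] exI[of _ B]) auto
  qed
  then obtain A B where AB: "\<And>y. open (A y)" "\<And>y. open (B y)" "\<And>y. x0 \<in> A y" "\<And>y. y \<in> B y"
    "\<And>y x z. x \<in> A y \<Longrightarrow> z \<in> B y \<Longrightarrow> dist (F x z) (F x0 z) < e" by metis
  obtain T where T: "T \<subseteq> L" "finite T" "L \<subseteq> (\<Union>y\<in>T. B y)"
    by (rule compactE_image[OF L, of L B]) (use AB in auto)
  show thesis
  proof (rule that[of "\<Inter>y\<in>T. A y"])
    show "open (\<Inter>y\<in>T. A y)" "x0 \<in> (\<Inter>y\<in>T. A y)" using AB T by auto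
    show "dist (F x y) (F x0 y) < e" if "x \<in> (\<Inter>y\<in>T. A y)" "y \<in> L" for x y
      using that T(3) AB(5) by blast
  qed
qed

locale haar =
  fixes \<theta> :: "'a::{topological_ab_group_add, t2_space} measure"
  assumes lc: "locally compact (UNIV :: 'a set)" and haar: "haar_measure \<theta>"
begin

lemma sets_haar: "sets \<theta> = sets borel"
  using haar by (simp add: haar_measure_def)

lemma space_haar: "space \<theta> = UNIV"
  using sets_eq_imp_space_eq[OF sets_haar] by simp

lemma compact_sets: "compact K \<Longrightarrow> K \<in> sets \<theta>"
  using sets_haar by (simp add: compact_imp_closed)

lemma emeasure_compact: "compact K \<Longrightarrow> emeasure \<theta> K < \<infinity>"
  using haar by (simp add: haar_measure_def)

lemma emeasure_translate: "A \<in> sets borel \<Longrightarrow> emeasure \<theta> ((\<lambda>a. x + a) ` A) = emeasure \<theta> A"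
  using haar by (simp add: haar_measure_def)

lemma continuous_measurable: "continuous_on UNIV f \<Longrightarrow> f \<in> borel_measurable \<theta>"
  using borel_measurable_continuous_onI measurable_cong_sets[OF sets_haar refl] by blast

lemma Cc_integrable: "f \<in> Cc \<Longrightarrow> integrable \<theta> f"
proof -
  assume f: "f \<in> Cc"
  obtain B where "\<And>x. norm (f x) \<le> B" using Cc_bounded[OF f] by metis
  then show ?thesis
    by (intro integrableI_bounded_set[of "supp f" _ _ B] compact_sets emeasure_compact
        Cc_compact[OF f] continuous_measurable Cc_continuous[OF f]) (auto simp: notin_supp)
qed

lemma norm_integral_le:
  assumes f: "f \<in> Cc" and K: "compact K" "\<And>x. x \<notin> K \<Longrightarrow> f x = 0"
    and B: "\<And>x. x \<in> K \<Longrightarrow> norm (f x) \<le> B"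
  shows "norm (LINT x|\<theta>. f x) \<le> B * measure \<theta> K"
proof -
  have "norm (LINT x|\<theta>. f x) \<le> (LINT x|\<theta>. norm (f x))" by (rule integral_norm_bound)
  also have "\<dots> \<le> (LINT x|\<theta>. B * indicator K x)"
    using K B Cc_integrable[OF f] emeasure_compact[OF K(1)] compact_sets[OF K(1)]
    by (intro integral_mono integrable_mult_right integrable_norm integrable_real_indicator)
      (auto simp: indicator_def)
  also have "\<dots> = B * measure \<theta> K"
    using compact_sets[OF K(1)] by (simp add: space_haar)
  finally show ?thesis .
qed

section \<open>Consequences of translation invariance\<close>

lemma distr_translation: "distr \<theta> \<theta> (\<lambda>x. x + a) = \<theta>"
proof (rule measure_eqI)
  have m: "(\<lambda>x. x + a) \<in> measurable \<theta> \<theta>"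
    using borel_measurable_continuous_onI[OF continuous_on_shifts(3)]
      measurable_cong_sets[OF sets_haar sets_haar] by blast
  fix A assume "A \<in> sets (distr \<theta> \<theta> (\<lambda>x. x + a))"
  then have A: "A \<in> sets \<theta>" by simp
  have "emeasure (distr \<theta> \<theta> (\<lambda>x. x + a)) A = emeasure \<theta> ((\<lambda>x. x + a) -` A)"
    using m A by (simp add: emeasure_distr space_haar)
  also have "(\<lambda>x. x + a) -` A = (\<lambda>x. - a + x) ` A"
    by (auto simp: image_iff algebra_simps intro!: bexI[of _ "_ + a"])
  also have "emeasure \<theta> \<dots> = emeasure \<theta> A"
    using A sets_haar by (intro emeasure_translate) auto
  finally show "emeasure (distr \<theta> \<theta> (\<lambda>x. x + a)) A = emeasure \<theta> A" .
qed simp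

lemma integral_translate:
  assumes "f \<in> Cc"
  shows "(LINT x|\<theta>. f (x + a)) = (LINT x|\<theta>. f x)" "(LINT x|\<theta>. f (x - a)) = (LINT x|\<theta>. f x)"
proof -
  have m: "(\<lambda>x. x + a) \<in> measurable \<theta> \<theta>" for a
    using borel_measurable_continuous_onI[OF continuous_on_shifts(3)]
      measurable_cong_sets[OF sets_haar sets_haar] by blast
  have "(LINT x|\<theta>. f (x + a)) = (LINT x|\<theta>. f x)" for a
    using integral_distr[OF m, of f a] continuous_measurable[OF Cc_continuous[OF assms]]
    by (simp add: distr_translation)
  from this[of a] this[of "- a"]
  show "(LINT x|\<theta>. f (x + a)) = (LINT x|\<theta>. f x)" "(LINT x|\<theta>. f (x - a)) = (LINT x|\<theta>. f x)"
    by auto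
qed

text \<open>Finitely many translates of a null open set would cover any compact set; every compact
  set, and by inner regularity the whole group, would then be null.\<close>

lemma emeasure_open_pos:
  assumes U: "open U" "U \<noteq> {}"
  shows "emeasure \<theta> U > 0"
proof (rule ccontr)
  assume "\<not> ?thesis"
  then have z: "emeasure \<theta> U = 0" by simp
  obtain u where u: "u \<in> U" using U by blast
  have tr: "emeasure \<theta> {x. x - a \<in> U} = 0" for a
  proof -
    have "{x. x - a \<in> U} = (\<lambda>x. a + x) ` U" by (auto simp: image_iff intro!: bexI[of _ "_ - a"])
    moreover have "emeasure \<theta> ((\<lambda>x. a + x) ` U) = emeasure \<theta> U"
      using U(1) by (intro emeasure_translate) auto
    ultimately show ?thesis using z by simp
  qed
  have "emeasure \<theta> K = 0" if K: "compact K" for K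
  proof -
    obtain T where T: "T \<subseteq> K" "finite T" "K \<subseteq> (\<Union>k\<in>T. {x. x - (k - u) \<in> U})"
      by (rule compactE_image[OF K, of K "\<lambda>k. {x. x - (k - u) \<in> U}"])
        (use U u in \<open>auto intro!: open_translation(1)\<close>)
    have ms: "{x. x - a \<in> U} \<in> sets \<theta>" for a
      using open_translation(1)[OF U(1)] sets_haar by simp
    have "emeasure \<theta> K \<le> emeasure \<theta> (\<Union>k\<in>T. {x. x - (k - u) \<in> U})"
      using T ms by (intro emeasure_mono sets.finite_UN) auto
    also have "\<dots> \<le> (\<Sum>k\<in>T. emeasure \<theta> {x. x - (k - u) \<in> U})"
      using T ms by (intro emeasure_subadditive_finite) auto
    finally show ?thesis by (simp add: tr)
  qed
  moreover have "emeasure \<theta> UNIV = (SUP K\<in>{K. compact K \<and> K \<subseteq> UNIV}. emeasure \<theta> K)"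
    using haar open_UNIV unfolding haar_measure_def by (elim conjE) (rule mp, drule spec,
        assumption+)
  ultimately have "emeasure \<theta> UNIV = 0" by (auto intro!: SUP_const)
  then show False using haar by (simp add: haar_measure_def)
qed

lemma integral_pos:
  fixes f :: "'a \<Rightarrow> real"
  assumes f: "(\<lambda>x. complex_of_real (f x)) \<in> Cc" "\<And>x. f x \<ge> 0" "f x > 0"
  shows "(LINT x|\<theta>. f x) > 0"
proof -
  have i: "integrable \<theta> f" using Cc_integrable[OF f(1)] by (simp add: complex_of_real_integrable_eq)
  have c: "continuous_on UNIV f"
    using continuous_on_Re[OF Cc_continuous[OF f(1)]] by simp
  have "open {y. f x / 2 < f y}" using c by (intro open_Collect_less) auto
  moreover have "x \<in> {y. f x / 2 < f y}" using f(3) by simp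
  ultimately have pos: "emeasure \<theta> {y. f x / 2 < f y} > 0" by (intro emeasure_open_pos) blast+
  show ?thesis
  proof (rule ccontr)
    assume "\<not> ?thesis"
    then have "(LINT x|\<theta>. f x) = 0" using integral_nonneg_AE[of f \<theta>] f(2) by (simp add:
        order_antisym)
    then have "AE y in \<theta>. f y = 0" using integral_nonneg_eq_0_iff_AE[OF i] f(2) by simp
    then have "AE y in \<theta>. \<not> f x / 2 < f y"
      by (rule eventually_mono) (use f(3) in auto)
    then have "emeasure \<theta> {y. f x / 2 < f y} = 0"
      using emeasure_eq_0_AE[of "\<lambda>y. f x / 2 < f y" \<theta>] by (simp add: space_haar)
    then show False using pos by simp
  qed
qed

section \<open>Fibre integrals, Fubini's theorem and invariance under inversion\<close>

lemma fibre_integral_Cc: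
  fixes F :: "'b::t2_space \<Rightarrow> 'a \<Rightarrow> complex"
  assumes F: "continuous_on UNIV (\<lambda>p. F (fst p) (snd p))" and K: "compact K" and L: "compact L"
    and z: "\<And>x y. x \<notin> K \<or> y \<notin> L \<Longrightarrow> F x y = 0"
  shows "F x \<in> Cc" "(\<lambda>x. LINT y|\<theta>. F x y) \<in> Cc"
proof -
  have c: "continuous_on UNIV (F x)" for x
    using continuous_on_compose2[OF F continuous_on_Pair[OF continuous_on_const continuous_on_id],
        of x UNIV]
    by simp
  show Fx: "F x \<in> Cc" for x using c L z by (intro CcI[where K=L]) auto
  have m: "measure \<theta> L \<ge> 0" by simp
  have "continuous_on UNIV (\<lambda>x. LINT y|\<theta>. F x y)"
    unfolding continuous_on_topological
  proof (intro ballI allI impI)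
    fix x0 B assume B: "open B" "(LINT y|\<theta>. F x0 y) \<in> B"
    then obtain e where e: "e > 0" "ball (LINT y|\<theta>. F x0 y) e \<subseteq> B" using open_contains_ball by blast
    have e': "e / (measure \<theta> L + 1) > 0" using e(1) m by (intro divide_pos_pos) linarith+
    obtain U where U: "open U" "x0 \<in> U"
      "\<And>x y. x \<in> U \<Longrightarrow> y \<in> L \<Longrightarrow> dist (F x y) (F x0 y) < e / (measure \<theta> L + 1)"
      using uniform_continuity_on_compact_fibres[OF F L e', of x0] by metis
    have "(LINT y|\<theta>. F x y) \<in> B" if "x \<in> U" for x
    proof -
      have "norm (LINT y|\<theta>. F x y - F x0 y) \<le> (e / (measure \<theta> L + 1)) * measure \<theta> L"
        using z U(3)[OF that]
        by (intro norm_integral_le Cc_diff Fx L) (auto simp: dist_norm intro: less_imp_le)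
      also have "\<dots> < e" using e(1) m add_nonneg_pos[OF m zero_less_one] by (simp add: field_simps)
      finally have "dist (LINT y|\<theta>. F x0 y) (LINT y|\<theta>. F x y) < e"
        using Fx by (simp add: dist_norm norm_minus_commute Bochner_Integration.integral_diff
            Cc_integrable)
      then show ?thesis using e(2) by auto
    qed
    then show "\<exists>A. open A \<and> x0 \<in> A \<and> (\<forall>y\<in>UNIV. y \<in> A \<longrightarrow> (LINT y'|\<theta>. F y y') \<in> B)"
      using U by blast
  qed
  moreover have "(LINT y|\<theta>. F x y) = 0" if "x \<notin> K" for x
  proof -
    have "F x = (\<lambda>_. 0)" using z that by blast
    then show ?thesis by simp
  qed
  ultimately show "(\<lambda>x. LINT y|\<theta>. F x y) \<in> Cc" using K by (intro CcI)
qed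

text \<open>
  The Haar measure need not be \<open>\<sigma>\<close>-finite and the product \<open>\<sigma>\<close>-algebra may be too small, so Fubini is
  proved by hand: on a compact rectangle both iterated integrals are approximated by the same
  Riemann sum over a finite Borel partition of \<open>K\<close>.
\<close>

lemma Fubini_Cc:
  fixes F :: "'a \<Rightarrow> 'a \<Rightarrow> complex"
  assumes F: "continuous_on UNIV (\<lambda>p. F (fst p) (snd p))" and K: "compact K" and L: "compact L"
    and z: "\<And>x y. x \<notin> K \<or> y \<notin> L \<Longrightarrow> F x y = 0"
  shows "(LINT x|\<theta>. LINT y|\<theta>. F x y) = (LINT y|\<theta>. LINT x|\<theta>. F x y)"
proof -
  note row = fibre_integral_Cc[OF F K L z]
  have "continuous_on UNIV ((\<lambda>p. F (fst p) (snd p)) \<circ> prod.swap)"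
    by (intro continuous_on_compose continuous_on_subset[OF F] continuous_on_swap) auto
  then have F': "continuous_on UNIV (\<lambda>p. F (snd p) (fst p))"
    by (simp add: o_def prod.swap_def)
  have col: "(\<lambda>x. F x y) \<in> Cc" "(\<lambda>y. LINT x|\<theta>. F x y) \<in> Cc" for y
    using fibre_integral_Cc[where F="\<lambda>y x. F x y", OF F' L K] z by blast+
  define k l where "k = measure \<theta> K" and "l = measure \<theta> L"
  have kl: "k \<ge> 0" "l \<ge> 0" by (auto simp: k_def l_def)
  have est: "norm ((LINT x|\<theta>. LINT y|\<theta>. F x y) - (LINT y|\<theta>. LINT x|\<theta>. F x y)) \<le> 2 * (e * k * l)"
    if e: "e > 0" for e
  proof -
    have "\<exists>U. open U \<and> x0 \<in> U \<and> (\<forall>x\<in>U. \<forall>y\<in>L. dist (F x y) (F x0 y) < e)" for x0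
      using uniform_continuity_on_compact_fibres[OF F L e, of x0] by metis
    then obtain U where U: "\<And>x0. open (U x0)" "\<And>x0. x0 \<in> U x0"
      "\<And>x0 x y. x \<in> U x0 \<Longrightarrow> y \<in> L \<Longrightarrow> dist (F x y) (F x0 y) < e" by metis
    obtain T where T: "T \<subseteq> K" "finite T" "K \<subseteq> (\<Union>x\<in>T. U x)"
      by (rule compactE_image[OF K, of K U]) (use U in auto)
    obtain xs where xs: "set xs = T" using finite_list[OF T(2)] by blast
    define n where "n = length xs"
    \<comment> \<open>This turns the finite cover of \<open>K\<close> into a Borel partition; all
      pieces from index \<open>n\<close> on are empty.\<close>
    define B where "B = disjointed (\<lambda>i. if i < n then K \<inter> U (xs ! i) else {})"
    have Kc: "K \<in> sets \<theta>" using compact_sets[OF K] .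
    have B_sub: "B i \<subseteq> (if i < n then K \<inter> U (xs ! i) else {})" for i
      unfolding B_def by (rule disjointed_subset)
    have "range (\<lambda>i. if i < n then K \<inter> U (xs ! i) else {}) \<subseteq> sets \<theta>"
      using Kc U(1) sets_haar by auto
    then have B_sets: "B i \<in> sets \<theta>" for i
      unfolding B_def by (rule subsetD[OF sets.range_disjointed_sets rangeI])
    have B_disj: "disjoint_family B" unfolding B_def by (rule disjoint_family_disjointed)
    have "(\<Union>i. B i) = (\<Union>i. if i < n then K \<inter> U (xs ! i) else {})"
      unfolding B_def by (rule UN_disjointed_eq)
    also have "\<dots> = K" using T(3) xs by (fastforce simp: in_set_conv_nth n_def split: if_splits)
    finally have B_UN: "(\<Union>i. B i) = K" .
    have B_K: "B i \<subseteq> K" for i using B_UN by blast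
    have B_fin: "emeasure \<theta> (B i) < \<infinity>" for i
      using emeasure_mono[OF B_K Kc] emeasure_compact[OF K] by (rule le_less_trans)
    have ind: "indicator K x = (\<Sum>i<n. indicator (B i) x :: real)" for x
    proof (cases "x \<in> K")
      case True
      then obtain j where j: "x \<in> B j" using B_UN by blast
      then have jn: "j < n" using B_sub[of j] by (auto split: if_splits)
      have "(indicator (B i) x :: real) = (if i = j then 1 else 0)" for i
        using B_disj j unfolding disjoint_family_on_def by (auto simp: indicator_def)
      then show ?thesis using True jn by simp
    next
      case False then show ?thesis using B_K by (auto simp: indicator_def intro!:
          sum.neutral[symmetric])
    qed
    define S where "S y = (\<Sum>i<n. of_real (measure \<theta> (B i)) * F (xs ! i) y)" for y
    \<comment> \<open>The sample point \<open>xs ! i\<close> need not belong to \<open>B i\<close>;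
      it is enough that \<open>B i\<close> is contained in \<open>U (xs ! i)\<close>.\<close>
    have approx: "norm ((LINT x|\<theta>. h x) - (\<Sum>i<n. of_real (measure \<theta> (B i)) * h (xs ! i))) \<le> c * k"
      if h: "h \<in> Cc" "\<And>x. x \<notin> K \<Longrightarrow> h x = 0"
        "\<And>x0 x. x \<in> K \<Longrightarrow> x \<in> U x0 \<Longrightarrow> norm (h x - h x0) \<le> c" for h c
    proof -
      let ?s = "\<lambda>x. \<Sum>i<n. indicator (B i) x *\<^sub>R h (xs ! i)"
      have si: "integrable \<theta> ?s"
        using B_sets B_fin
        by (intro Bochner_Integration.integrable_sum integrable_scaleR_left
            integrable_real_indicator) auto
      have "(LINT x|\<theta>. ?s x) = (\<Sum>i<n. measure \<theta> (B i) *\<^sub>R h (xs ! i))"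
        using B_sets B_fin
        by (subst Bochner_Integration.integral_sum)
          (auto intro!: integrable_scaleR_left integrable_real_indicator simp: space_haar)
      then have "(LINT x|\<theta>. h x) - (\<Sum>i<n. of_real (measure \<theta> (B i)) * h (xs ! i))
          = (LINT x|\<theta>. h x - ?s x)"
        using Cc_integrable[OF h(1)] si by (simp add: scaleR_conv_of_real)
      also have "norm \<dots> \<le> (LINT x|\<theta>. norm (h x - ?s x))" by (rule integral_norm_bound)
      also have "\<dots> \<le> (LINT x|\<theta>. c * indicator K x)"
      proof (rule integral_mono)
        show "integrable \<theta> (\<lambda>x. norm (h x - ?s x))" using Cc_integrable[OF h(1)] si by auto
        show "integrable \<theta> (\<lambda>x. c * indicator K x)"
          using Kc emeasure_compact[OF K] by (intro integrable_mult_right integrable_real_indicator)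
              auto
        fix x
        show "norm (h x - ?s x) \<le> c * indicator K x"
        proof (cases "x \<in> K")
          case False
          then have "x \<notin> B i" for i using B_K by blast
          then have "?s x = 0" by simp
          then show ?thesis using False h(2) by simp
        next
          case True
          then obtain j where j: "x \<in> B j" using B_UN by blast
          then have jn: "j < n" "x \<in> U (xs ! j)" using B_sub[of j] by (auto split: if_splits)
          have "(indicator (B i) x :: real) = (if i = j then 1 else 0)" for i
            using B_disj j unfolding disjoint_family_on_def by (auto simp: indicator_def)
          then have "?s x = h (xs ! j)" using jn by (simp add: if_distrib[of "\<lambda>c. c *\<^sub>R _"] cong:
              if_cong)
          then show ?thesis using True h(3)[OF True jn(2)] by simp
        qed
      qed
      also have "\<dots> = c * k" using Kc by (simp add: space_haar k_def)
      finally show ?thesis .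
    qed
    have "norm ((LINT x|\<theta>. LINT y|\<theta>. F x y) - (\<Sum>i<n. of_real (measure \<theta> (B i)) * (LINT y|\<theta>. F (xs ! i) y)))
      \<le> (e * l) * k"
    proof (rule approx[OF row(2)])
      show "norm ((LINT y|\<theta>. F x y) - (LINT y|\<theta>. F x0 y)) \<le> e * l" if "x \<in> K" "x \<in> U x0" for x x0
      proof -
        have "norm (LINT y|\<theta>. F x y - F x0 y) \<le> e * measure \<theta> L"
          using z U(3)[OF that(2)]
          by (intro norm_integral_le Cc_diff row(1) L) (auto simp: dist_norm intro: less_imp_le)
        then show ?thesis using row(1) by (simp add: l_def Bochner_Integration.integral_diff
            Cc_integrable)
      qed
      show "(LINT y|\<theta>. F x y) = 0" if "x \<notin> K" for x
      proof -
        have "F x = (\<lambda>_. 0)" using z that by blast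
        then show ?thesis by simp
      qed
    qed
    moreover have "(\<Sum>i<n. of_real (measure \<theta> (B i)) * (LINT y|\<theta>. F (xs ! i) y)) = (LINT y|\<theta>. S y)"
      unfolding S_def using row(1)
      by (subst Bochner_Integration.integral_sum) (auto intro!: Cc_integrable Cc_cmult)
    moreover have "norm ((LINT y|\<theta>. LINT x|\<theta>. F x y) - (LINT y|\<theta>. S y)) \<le> (e * k) * l"
    proof -
      have SC: "S \<in> Cc" unfolding S_def using row(1) by (auto intro!: Cc_sum Cc_cmult)
      have "norm (LINT y|\<theta>. (LINT x|\<theta>. F x y) - S y) \<le> (e * k) * measure \<theta> L"
      proof (intro norm_integral_le Cc_diff col(2) SC L)
        show "norm ((LINT x|\<theta>. F x y) - S y) \<le> e * k" if "y \<in> L" for y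
          unfolding S_def using z U(3)[OF _ that]
          by (intro approx[OF col(1)]) (auto simp: dist_norm intro: less_imp_le)
      qed (use z in \<open>simp add: S_def\<close>)
      then show ?thesis using col(2) SC
        by (simp add: l_def Bochner_Integration.integral_diff Cc_integrable)
    qed
    ultimately show ?thesis
      by (smt (verit) norm_triangle_ineq4 norm_minus_commute diff_diff_eq2 add_diff_cancel
          mult.assoc mult.commute
          norm_triangle_half_l norm_triangle_ineq dist_norm dist_triangle2)
  qed
  have "norm ((LINT x|\<theta>. LINT y|\<theta>. F x y) - (LINT y|\<theta>. LINT x|\<theta>. F x y)) \<le> d" if d: "d > 0" for d
  proof -
    have kl': "k * l \<ge> 0" using kl by simp
    have "2 * (d / (2 * (k * l + 1)) * k * l) \<le> d"
      using d kl' add_nonneg_pos[OF kl' zero_less_one] by (simp add: field_simps)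
    moreover have "d / (2 * (k * l + 1)) > 0" using d add_nonneg_pos[OF kl' zero_less_one] by simp
    ultimately show ?thesis using est order_trans by blast
  qed
  then have "norm ((LINT x|\<theta>. LINT y|\<theta>. F x y) - (LINT y|\<theta>. LINT x|\<theta>. F x y)) \<le> 0"
    by (rule field_le_epsilon[of _ 0, simplified])
  then show ?thesis by simp
qed

lemma ex_integral_nonzero: obtains f where "f \<in> Cc" "(LINT x|\<theta>. f x) \<noteq> 0"
proof -
  obtain b W where b: "(\<lambda>x. complex_of_real (b x)) \<in> Cc" "\<And>x. 0 \<le> b x" "(0::'a) \<in> W"
      "\<And>x. x \<in> W \<Longrightarrow> b x = 1"
    using lc_point_bump[OF lc open_UNIV, of 0] by (metis UNIV_I)
  have "(LINT x|\<theta>. b x) > 0" using b by (intro integral_pos[of b 0]) auto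
  then have "(LINT x|\<theta>. complex_of_real (b x)) \<noteq> 0" by simp
  with b(1) that show thesis by blast
qed

text \<open>The double integral of \<open>f (x + y) * g y\<close> is evaluated twice. Integrating
  over \<open>x\<close> before \<open>y\<close> gives the product of the integrals of
  \<open>f\<close> and \<open>g\<close>; shifting \<open>y\<close> by \<open>x\<close> beforehand
  gives the product of the integrals of \<open>f\<close> and of the reflected \<open>g\<close>. It
  remains to cancel the nonzero integral of \<open>f\<close>, and uniqueness of Haar measure is
  never invoked.\<close>

lemma integral_uminus:
  assumes g: "g \<in> Cc"
  shows "(LINT x|\<theta>. g (- x)) = (LINT x|\<theta>. g x)"
proof -
  obtain f where f: "f \<in> Cc" "(LINT x|\<theta>. f x) \<noteq> 0" by (rule ex_integral_nonzero)
  note cf = Cc_continuous[OF f(1), of UNIV] and cg = Cc_continuous[OF g, of UNIV]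
  let ?K = "(\<lambda>(x, y). x - y) ` (supp f \<times> supp g)"
  have K: "compact ?K" by (intro compact_minus_set Cc_compact f g)
  have sub: "(LINT y|\<theta>. f (x + y) * g y) = (LINT y|\<theta>. f y * g (y - x))" for x
  proof -
    have "(\<lambda>y. f (x + y) * g y) \<in> Cc"
      using Cc_mult[OF _ g, of "\<lambda>y. f (x + y)"] Cc_continuous[OF Cc_translate(5)[OF f(1)]] by simp
    from integral_translate(2)[OF this, of x] show ?thesis by (simp add: algebra_simps)
  qed
  have F1: "continuous_on UNIV (\<lambda>p. f (fst p + snd p) * g (snd p))"
    by (intro continuous_intros continuous_on_compose2[OF cf] continuous_on_compose2[OF cg])
      (auto intro!: continuous_intros)
  have F2: "continuous_on UNIV (\<lambda>p. f (snd p) * g (snd p - fst p))"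
    by (intro continuous_intros continuous_on_compose2[OF cf] continuous_on_compose2[OF cg])
      (auto intro!: continuous_intros)
  have z1: "f (x + y) * g y = 0" if "x \<notin> ?K \<or> y \<notin> supp g" for x y
  proof (rule ccontr)
    assume "\<not> ?thesis"
    then have "x + y \<in> supp f" "y \<in> supp g" using notin_supp by fastforce+
    then have "(\<lambda>(x, y). x - y) (x + y, y) \<in> ?K" by (intro imageI) auto
    then show False using that \<open>y \<in> supp g\<close> by simp
  qed
  have z2: "f y * g (y - x) = 0" if "x \<notin> ?K \<or> y \<notin> supp f" for x y
  proof (rule ccontr)
    assume "\<not> ?thesis"
    then have "y \<in> supp f" "y - x \<in> supp g" using notin_supp by fastforce+
    then have "(\<lambda>(x, y). x - y) (y, y - x) \<in> ?K" by (intro imageI) auto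
    then show False using that \<open>y \<in> supp f\<close> by simp
  qed
  have "(LINT x|\<theta>. LINT y|\<theta>. f (x + y) * g y) = (LINT y|\<theta>. LINT x|\<theta>. f (x + y) * g y)"
    by (rule Fubini_Cc[OF F1 K Cc_compact[OF g]]) (rule z1)
  also have "\<dots> = (LINT y|\<theta>. (LINT x|\<theta>. f x) * g y)"
    using integral_translate(1)[OF f(1)] by simp
  finally have 1: "(LINT x|\<theta>. LINT y|\<theta>. f (x + y) * g y) = (LINT x|\<theta>. f x) * (LINT y|\<theta>. g y)"
    by simp
  have refl: "(LINT x|\<theta>. g (y - x)) = (LINT x|\<theta>. g (- x))" for y
    using integral_translate(1)[OF Cc_translate(2)[OF g], of y y] by simp
  have "(LINT x|\<theta>. LINT y|\<theta>. f y * g (y - x)) = (LINT y|\<theta>. LINT x|\<theta>. f y * g (y - x))"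
    by (rule Fubini_Cc[OF F2 K Cc_compact[OF f(1)]]) (rule z2)
  also have "\<dots> = (LINT x|\<theta>. f x) * (LINT x|\<theta>. g (- x))" by (simp add: refl)
  finally have 2: "(LINT x|\<theta>. LINT y|\<theta>. f y * g (y - x)) = (LINT x|\<theta>. f x) * (LINT x|\<theta>. g (- x))" .
  show ?thesis using 1 2 f(2) by (simp add: sub)
qed

text \<open>These are the hypotheses of \<open>fibre_integral_Cc\<close> and
  \<open>Fubini_Cc\<close> for the convolution kernel. The sum of the two supports is written as a
  difference, with \<open>supp g\<close> reflected, so that \<open>compact_minus_set\<close>
  applies.\<close>

lemma convolve_functions_kernel:
  fixes f g :: "'a \<Rightarrow> complex"
  assumes f: "f \<in> Cc" and g: "g \<in> Cc"
  shows "continuous_on UNIV (\<lambda>p. f (snd p) * g (fst p - snd p))"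
    and "compact ((\<lambda>(x, y). x - y) ` (supp f \<times> uminus ` supp g))"
    and "x \<notin> (\<lambda>(x, y). x - y) ` (supp f \<times> uminus ` supp g) \<or> t \<notin> supp f \<Longrightarrow> f t * g (x - t) = 0"
proof -
  show "continuous_on UNIV (\<lambda>p. f (snd p) * g (fst p - snd p))"
    by (intro continuous_intros continuous_on_compose2[OF Cc_continuous[OF f, of UNIV]]
        continuous_on_compose2[OF Cc_continuous[OF g, of UNIV]]) (auto intro!: continuous_intros)
  show "compact ((\<lambda>(x, y). x - y) ` (supp f \<times> uminus ` supp g))"
    by (intro compact_minus_set compact_uminus_image Cc_compact f g)
  assume *: "x \<notin> (\<lambda>(x, y). x - y) ` (supp f \<times> uminus ` supp g) \<or> t \<notin> supp f"
  show "f t * g (x - t) = 0"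
  proof (rule ccontr)
    assume "\<not> ?thesis"
    then have t: "t \<in> supp f" "x - t \<in> supp g" using notin_supp by fastforce+
    then have "(\<lambda>(x, y). x - y) (t, - (x - t)) \<in> (\<lambda>(x, y). x - y) ` (supp f \<times> uminus ` supp g)"
      by (intro imageI SigmaI t)
    then show False using * t by simp
  qed
qed

lemma convolve_functions_Cc: 
  assumes f: "f \<in> Cc" and g: "g \<in> Cc"
  shows "convolve_functions \<theta> f g \<in> Cc"
  unfolding convolve_functions_def
  by (rule fibre_integral_Cc(2)[where F="\<lambda>x t. f t * g (x - t)",
        OF convolve_functions_kernel(1,2)[OF f g] Cc_compact[OF f]])
    (rule convolve_functions_kernel(3)[OF f g])

lemma convolve_functions_integrand:
  fixes f g :: "'a \<Rightarrow> complex"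
  assumes "f \<in> Cc" "g \<in> Cc"
  shows "(\<lambda>t. f t * g (x - t)) \<in> Cc"
  using Cc_mult2[OF Cc_continuous[OF Cc_translate(2)[OF assms(2)]] assms(1)] .

lemma char_mult_Cc:
  fixes f :: "'a \<Rightarrow> complex"
  shows "f \<in> Cc \<Longrightarrow> (\<lambda>t. eval_char \<xi> t * f t) \<in> Cc"
  by (intro Cc_mult eval_char_continuous)

section \<open>Algebraic rules for the transform on \<open>Cc\<close>\<close>

lemma inverse_Fourier_convolve:
  assumes f: "f \<in> Cc" and g: "g \<in> Cc"
  shows "inverse_Fourier \<theta> (convolve_functions \<theta> f g) \<xi> = inverse_Fourier \<theta> f \<xi> * inverse_Fourier \<theta>
      g \<xi>"
proof -
  note k = convolve_functions_kernel[OF f g]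
  have "continuous_on UNIV (\<lambda>p. eval_char \<xi> (fst p) * (f (snd p) * g (fst p - snd p)))"
    by (intro continuous_intros k(1) continuous_on_compose2[OF eval_char_continuous]) auto
  then have "(LINT x|\<theta>. LINT t|\<theta>. eval_char \<xi> x * (f t * g (x - t)))
      = (LINT t|\<theta>. LINT x|\<theta>. eval_char \<xi> x * (f t * g (x - t)))"
    by (rule Fubini_Cc[OF _ k(2) Cc_compact[OF f]]) (use k(3) in simp)
  also have "\<dots> = (LINT t|\<theta>. (eval_char \<xi> t * f t) * (LINT x|\<theta>. eval_char \<xi> x * g x))"
  proof (rule Bochner_Integration.integral_cong[OF refl])
    fix t
    have "(LINT x|\<theta>. eval_char \<xi> x * (f t * g (x - t)))
        = (LINT x|\<theta>. (eval_char \<xi> t * f t) * (eval_char \<xi> (x - t) * g (x - t)))"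
    proof (rule Bochner_Integration.integral_cong[OF refl])
      fix x
      have "eval_char \<xi> x = eval_char \<xi> t * eval_char \<xi> (x - t)"
        using eval_char_add[of \<xi> t "x - t"] by simp
      then show "eval_char \<xi> x * (f t * g (x - t)) = (eval_char \<xi> t * f t) * (eval_char \<xi> (x - t) *
          g (x - t))"
        by (simp add: mult_ac)
    qed
    also have "\<dots> = (eval_char \<xi> t * f t) * (LINT x|\<theta>. eval_char \<xi> x * g x)"
      using integral_translate(2)[OF char_mult_Cc[OF g], of \<xi> t] by simp
    finally show "(LINT x|\<theta>. eval_char \<xi> x * (f t * g (x - t)))
        = (eval_char \<xi> t * f t) * (LINT x|\<theta>. eval_char \<xi> x * g x)" .
  qed
  finally show ?thesis by (simp add: inverse_Fourier_def convolve_functions_def)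
qed

lemma inverse_Fourier_tilde:
  assumes f: "f \<in> Cc"
  shows "inverse_Fourier \<theta> (tilde f) \<xi> = cnj (inverse_Fourier \<theta> f \<xi>)"
proof -
  have "inverse_Fourier \<theta> (tilde f) \<xi> = (LINT t|\<theta>. cnj (eval_char \<xi> (- t) * f (- t)))"
    unfolding inverse_Fourier_def tilde_def by (simp add: eval_char_uminus)
  also have "\<dots> = cnj (LINT t|\<theta>. eval_char \<xi> (- t) * f (- t))" 
    by (rule integral_bounded_linear'[OF bounded_linear_cnj bounded_linear_cnj]) simp
  also have "\<dots> = cnj (LINT t|\<theta>. eval_char \<xi> t * f t)"
    using integral_uminus[OF char_mult_Cc[OF f], of \<xi>] by simp
  finally show ?thesis by (simp add: inverse_Fourier_def)
qed

lemma inverse_Fourier_add: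
  "f \<in> Cc \<Longrightarrow> g \<in> Cc \<Longrightarrow>
    inverse_Fourier \<theta> (\<lambda>x. f x + g x) \<xi> = inverse_Fourier \<theta> f \<xi> + inverse_Fourier \<theta> g \<xi>"
  unfolding inverse_Fourier_def
  by (simp add: distrib_left Bochner_Integration.integral_add Cc_integrable char_mult_Cc)

lemma inverse_Fourier_cmult: "inverse_Fourier \<theta> (\<lambda>x. c * f x) \<xi> = c * inverse_Fourier \<theta> f \<xi>"
  unfolding inverse_Fourier_def by (simp add: mult.left_commute)

lemma inverse_Fourier_translate:
  assumes "f \<in> Cc"
  shows "inverse_Fourier \<theta> (\<lambda>x. f (x - t)) \<xi> = eval_char \<xi> t * inverse_Fourier \<theta> f \<xi>"
proof -
  have "(LINT x|\<theta>. eval_char \<xi> x * f (x - t))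
      = (LINT x|\<theta>. eval_char \<xi> t * (eval_char \<xi> (x - t) * f (x - t)))"
  proof (rule Bochner_Integration.integral_cong[OF refl])
    fix x
    have "eval_char \<xi> x = eval_char \<xi> t * eval_char \<xi> (x - t)"
      using eval_char_add[of \<xi> t "x - t"] by simp
    then show "eval_char \<xi> x * f (x - t) = eval_char \<xi> t * (eval_char \<xi> (x - t) * f (x - t))"
      by (simp add: mult_ac)
  qed
  also have "\<dots> = eval_char \<xi> t * (LINT x|\<theta>. eval_char \<xi> x * f x)"
    using integral_translate(2)[OF char_mult_Cc[OF assms], of \<xi> t] by simp
  finally show ?thesis by (simp add: inverse_Fourier_def)
qed

lemma inverse_Fourier_modulate:
  "inverse_Fourier \<theta> (\<lambda>x. cnj (eval_char \<psi> x) * f x) \<xi> = inverse_Fourier \<theta> f (\<xi> - \<psi>)"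
  unfolding inverse_Fourier_def by (simp add: eval_dual_diff mult_ac)

end

section \<open>The dual group and the Fourier algebra\<close>

text \<open>Tychonoff's theorem for pointwise convergence on the function type.\<close>

lemma compact_function_box:
  fixes S :: "'i \<Rightarrow> 'b::topological_space set"
  assumes "\<And>i. compact (S i)"
  shows "compact {f. \<forall>i. f i \<in> S i}"
proof -
  have "compactin (product_topology (\<lambda>i. euclidean) UNIV) (Pi\<^sub>E UNIV S)"
    using assms by (simp add: compactin_PiE)
  moreover have "Pi\<^sub>E UNIV S = {f. \<forall>i. f i \<in> S i}" by auto
  ultimately show ?thesis by (simp add: euclidean_product_topology)
qed

text \<open>An Ascoli argument. Homomorphisms into the circle with modulus of continuity
  \<open>m\<close> at 0 form a closed subset \<open>T\<close> of a product of circles.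
  Equicontinuity makes the members of \<open>T\<close> continuous and upgrades pointwise closeness
  on a finite set to closeness on a compact set, so \<open>Abs_char\<close> is continuous on
  \<open>T\<close> and transports compactness to the dual.\<close>

lemma compact_equicontinuous_chars:
  fixes m :: "'a::topological_ab_group_add \<Rightarrow> real"
  assumes m: "\<And>e. e > 0 \<Longrightarrow> \<exists>U. open U \<and> 0 \<in> U \<and> (\<forall>x\<in>U. m x < e)"
  shows "compact {\<xi>. \<forall>x. norm (eval_char \<xi> x - 1) \<le> m x}"
proof -
  define T where "T = {\<phi> :: 'a \<Rightarrow> complex. \<forall>x. \<phi> x \<in> sphere 0 1} \<inter>
    {\<phi>. \<forall>x y. \<phi> (x + y) = \<phi> x * \<phi> y} \<inter> {\<phi>. \<forall>x. norm (\<phi> x - 1) \<le> m x}"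
  note cp = continuous_on_product_coordinates
  have "closed {\<phi> :: 'a \<Rightarrow> complex. \<forall>x y. \<phi> (x + y) = \<phi> x * \<phi> y}"
    by (intro closed_Collect_all closed_Collect_eq continuous_intros cp)
  moreover have "closed {\<phi> :: 'a \<Rightarrow> complex. \<forall>x. norm (\<phi> x - 1) \<le> m x}"
    by (intro closed_Collect_all closed_Collect_le continuous_intros cp)
  ultimately have T: "compact T"
    unfolding T_def by (intro compact_Int_closed compact_function_box compact_sphere)
  have dist_T: "norm (\<phi> x - \<phi> y) \<le> m (x - y)" if "\<phi> \<in> T" for \<phi> x y
  proof -
    have "\<phi> x = \<phi> (x - y) * \<phi> y" using that unfolding T_def by (metis (mono_tags, lifting) IntE
        diff_add_cancel mem_Collect_eq)
    then have "\<phi> x - \<phi> y = (\<phi> (x - y) - 1) * \<phi> y" by (simp add: algebra_simps)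
    then have "norm (\<phi> x - \<phi> y) = norm (\<phi> (x - y) - 1)"
      using that by (simp add: T_def norm_mult)
    then show ?thesis using that by (simp add: T_def)
  qed
  have cont: "continuous_on UNIV \<phi>" if "\<phi> \<in> T" for \<phi>
    unfolding continuous_on_topological
  proof (intro ballI allI impI)
    fix x B assume B: "open B" "\<phi> x \<in> B"
    then obtain e where e: "e > 0" "ball (\<phi> x) e \<subseteq> B" using open_contains_ball by blast
    obtain U where U: "open U" "0 \<in> U" "\<forall>x\<in>U. m x < e" using m[OF e(1)] by blast
    have "\<phi> y \<in> B" if "y - x \<in> U" for y
      using dist_T[OF \<open>\<phi> \<in> T\<close>, of y x] U that e(2) by (fastforce simp: dist_norm norm_minus_commute)
    then show "\<exists>A. open A \<and> x \<in> A \<and> (\<forall>y\<in>UNIV. y \<in> A \<longrightarrow> \<phi> y \<in> B)"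
      using U by (intro exI[of _ "{y. y - x \<in> U}"]) (auto intro: open_translation)
  qed
  have eval_Abs: "eval_char (Abs_char \<phi>) = \<phi>" if "\<phi> \<in> T" for \<phi>
    using that cont[OF that] by (intro Abs_char_inverse) (auto simp: T_def)
  have "continuous_on T Abs_char"
    unfolding continuous_on_topological
  proof (intro ballI allI impI)
    fix \<phi> B assume \<phi>: "\<phi> \<in> T" and B: "open B" "Abs_char \<phi> \<in> B"
    obtain K e where K: "compact K" "e > 0" "char_nbhd (Abs_char \<phi>) K e \<subseteq> B"
      using open_char_contains_nbhd[OF B] by metis
    have e3: "e / 3 > 0" using K(2) by simp
    obtain U where U: "open U" "0 \<in> U" "\<forall>x\<in>U. m x < e / 3" using m[OF e3] by blast
    obtain F where F: "F \<subseteq> K" "finite F" "K \<subseteq> (\<Union>a\<in>F. {x. x - a \<in> U})"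
      by (rule compactE_image[OF K(1), of K "\<lambda>a. {x. x - a \<in> U}"])
        (use U in \<open>auto intro: open_translation\<close>)
    have "open {\<psi> :: 'a \<Rightarrow> complex. \<forall>a\<in>F. \<psi> (id a) \<in> ball (\<phi> a) (e / 3)}"
      by (rule product_topology_basis'[OF F(2)]) auto
    moreover have "Abs_char \<psi> \<in> B" if \<psi>: "\<psi> \<in> T" "\<forall>a\<in>F. \<psi> a \<in> ball (\<phi> a) (e / 3)" for \<psi>
    proof -
      have "dist (\<psi> x) (\<phi> x) < e" if x: "x \<in> K" for x
      proof -
        obtain a where a: "a \<in> F" "x - a \<in> U" using F(3) x by auto
        have "norm (\<psi> x - \<psi> a) < e / 3" "norm (\<phi> x - \<phi> a) < e / 3"
          using dist_T[OF \<psi>(1), of x a] dist_T[OF \<phi>, of x a] U(3) a(2) by force+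
        moreover have "norm (\<phi> a - \<psi> a) < e / 3" using \<psi>(2) a(1) by (auto simp: dist_norm)
        moreover have "norm (\<psi> x - \<phi> x) = norm ((\<psi> x - \<psi> a) - (\<phi> a - \<psi> a) - (\<phi> x - \<phi> a))" by simp
        ultimately show ?thesis
          unfolding dist_norm
          using norm_triangle_ineq4[of "\<psi> x - \<psi> a" "\<phi> a - \<psi> a"]
            norm_triangle_ineq4[of "(\<psi> x - \<psi> a) - (\<phi> a - \<psi> a)" "\<phi> x - \<phi> a"] by linarith
      qed
      then have "Abs_char \<psi> \<in> char_nbhd (Abs_char \<phi>) K e"
        by (simp add: char_nbhd_def eval_Abs \<phi> \<psi>(1))
      then show ?thesis using K(3) by blast
    qed
    ultimately show "\<exists>A. open A \<and> \<phi> \<in> A \<and> (\<forall>\<psi>\<in>T. \<psi> \<in> A \<longrightarrow> Abs_char \<psi> \<in> B)"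
      using e3 by (intro exI[of _ "{\<psi>. \<forall>a\<in>F. \<psi> a \<in> ball (\<phi> a) (e / 3)}"]) auto
  qed
  then have "compact (Abs_char ` T)" using T by (rule compact_continuous_image)
  moreover have "Abs_char ` T = {\<xi>. \<forall>x. norm (eval_char \<xi> x - 1) \<le> m x}"
  proof
    show "Abs_char ` T \<subseteq> {\<xi>. \<forall>x. norm (eval_char \<xi> x - 1) \<le> m x}"
      using eval_Abs by (auto simp: T_def)
    show "{\<xi>. \<forall>x. norm (eval_char \<xi> x - 1) \<le> m x} \<subseteq> Abs_char ` T"
    proof
      fix \<xi> assume "\<xi> \<in> {\<xi>. \<forall>x. norm (eval_char \<xi> x - 1) \<le> m x}"
      then have "eval_char \<xi> \<in> T" by (simp add: T_def eval_char_add)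
      then show "\<xi> \<in> Abs_char ` T" by (metis eval_char_inverse imageI)
    qed
  qed
  ultimately show ?thesis by simp
qed

context haar
begin

text \<open>The topology of the dual controls characters on compact sets only; joint continuity
  therefore uses a compact neighbourhood of \<open>x\<close>.\<close>

lemma continuous_on_eval_pair:
  "continuous_on UNIV (\<lambda>p :: 'a \<times> 'a pontryagin_dual. eval_char (snd p) (fst p))"
  unfolding continuous_on_topological
proof (intro ballI allI impI)
  fix p :: "'a \<times> 'a pontryagin_dual" and B
  assume B: "open B" "eval_char (snd p) (fst p) \<in> B"
  obtain x \<xi> where p: "p = (x, \<xi>)" by fastforce
  obtain e where e: "e > 0" "ball (eval_char \<xi> x) e \<subseteq> B"
    using B(2) openE[OF B(1)] unfolding p by (metis fst_conv snd_conv)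
  obtain V L where V: "open V" "compact L" "x \<in> V" "V \<subseteq> L"
    using lc_point_nbhd[OF lc open_UNIV UNIV_I] by metis
  define A where "A = (V \<inter> {y. dist (eval_char \<xi> y) (eval_char \<xi> x) < e/2}) \<times> char_nbhd \<xi> L (e/2)"
  have "open {y. dist (eval_char \<xi> y) (eval_char \<xi> x) < e/2}"
    by (intro open_Collect_less continuous_intros eval_char_continuous)
  then have "open A" unfolding A_def using V by (intro open_Times open_Int open_char_nbhd)
  moreover have "p \<in> A" using e V by (auto simp: A_def p intro: char_nbhd_self)
  moreover have "eval_char (snd q) (fst q) \<in> B" if "q \<in> A" for q
  proof -
    obtain y \<psi> where q: "q = (y, \<psi>)" by fastforce
    have "dist (eval_char \<psi> y) (eval_char \<xi> y) < e/2" "dist (eval_char \<xi> y) (eval_char \<xi> x) < e/2"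
      using that V(4) by (auto simp: A_def q char_nbhd_def)
    then have "dist (eval_char \<xi> x) (eval_char \<psi> y) < e" by (metis dist_triangle_half_l
        dist_commute)
    then show ?thesis using e(2) by (auto simp: q)
  qed
  ultimately show "\<exists>A. open A \<and> p \<in> A \<and> (\<forall>q\<in>UNIV. q \<in> A \<longrightarrow> eval_char (snd q) (fst q) \<in> B)"
    by blast
qed

lemma continuous_on_eval_dual: "continuous_on A (\<lambda>\<xi> :: 'a pontryagin_dual. eval_char \<xi> x)"
  using continuous_on_compose2[OF continuous_on_eval_pair continuous_on_Pair[OF continuous_on_const
      continuous_on_id], of x A]
  by simp

lemma continuous_inverse_Fourier:
  assumes f: "f \<in> Cc"
  shows "continuous_on A (inverse_Fourier \<theta> f)"
proof -
  have "continuous_on UNIV (inverse_Fourier \<theta> f)"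
    unfolding continuous_on_topological
  proof (intro ballI allI impI)
    fix \<xi> B assume B: "open B" "inverse_Fourier \<theta> f \<xi> \<in> B"
    then obtain e where e: "e > 0" "ball (inverse_Fourier \<theta> f \<xi>) e \<subseteq> B" using open_contains_ball by
        blast
    obtain M where M: "M > 0" "\<And>x. norm (f x) \<le> M" using Cc_bounded[OF f] by metis
    define k where "k = measure \<theta> (supp f)"
    have k: "k \<ge> 0" by (simp add: k_def)
    define d where "d = e / (M * (k + 1))"
    have d: "d > 0" unfolding d_def using e M add_nonneg_pos[OF k zero_less_one] by simp
    have "inverse_Fourier \<theta> f \<psi> \<in> B" if \<psi>: "\<psi> \<in> char_nbhd \<xi> (supp f) d" for \<psi>
    proof -
      have "norm (LINT x|\<theta>. eval_char \<psi> x * f x - eval_char \<xi> x * f x) \<le> (d * M) * measure \<theta> (supp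
          f)"
      proof (intro norm_integral_le Cc_diff char_mult_Cc f Cc_compact)
        fix x assume "x \<in> supp f"
        then have "norm (eval_char \<psi> x - eval_char \<xi> x) \<le> d"
          using \<psi> by (auto simp: char_nbhd_def dist_norm intro: less_imp_le)
        then have "norm ((eval_char \<psi> x - eval_char \<xi> x) * f x) \<le> d * M"
          unfolding norm_mult using M d by (intro mult_mono) auto
        then show "norm (eval_char \<psi> x * f x - eval_char \<xi> x * f x) \<le> d * M" by (simp add:
            algebra_simps)
      qed (simp add: notin_supp)
      also have "\<dots> < e"
      proof -
        have "d * (M * (k + 1)) = e" using M add_nonneg_pos[OF k zero_less_one] by (simp add: d_def)
        moreover have "d * M > 0" using d M by simp
        ultimately show ?thesis unfolding k_def[symmetric] by (simp add: algebra_simps)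
      qed
      finally have "dist (inverse_Fourier \<theta> f \<xi>) (inverse_Fourier \<theta> f \<psi>) < e"
        unfolding inverse_Fourier_def dist_norm
        by (simp add: Bochner_Integration.integral_diff Cc_integrable char_mult_Cc f
            norm_minus_commute)
      then show ?thesis using e(2) by auto
    qed
    then show "\<exists>A. open A \<and> \<xi> \<in> A \<and> (\<forall>\<psi>\<in>UNIV. \<psi> \<in> A \<longrightarrow> inverse_Fourier \<theta> f \<psi> \<in> B)"
      using open_char_nbhd[OF Cc_compact[OF f]] char_nbhd_self[OF d]
      by (intro exI[of _ "char_nbhd \<xi> (supp f) d"]) auto
  qed
  then show ?thesis using continuous_on_subset by blast
qed

lemma L1_continuity_of_translation:
  assumes f: "f \<in> Cc" and e: "e > 0"
  shows "\<exists>U. open U \<and> 0 \<in> U \<and> (\<forall>x\<in>U. (LINT t|\<theta>. norm (f (t - x) - f t)) < e)"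
proof -
  obtain V L where V: "open V" "compact L" "(0::'a) \<in> V" "V \<subseteq> L"
    using lc_point_nbhd[OF lc open_UNIV UNIV_I] by metis
  \<comment> \<open>Contains the supports of all translates of \<open>f\<close> by elements of
    \<open>L\<close>, so that one finite measure serves for every small \<open>x\<close>.\<close>
  let ?K = "(\<lambda>(x, y). x - y) ` (supp f \<times> uminus ` L) \<union> supp f"
  define k where "k = measure \<theta> ?K"
  have k: "k \<ge> 0" by (simp add: k_def)
  have K: "compact ?K"
    by (intro compact_Un compact_minus_set compact_uminus_image Cc_compact f V)
  have d: "e / (k + 1) > 0" using e add_nonneg_pos[OF k zero_less_one] by simp
  obtain U where U: "open U" "0 \<in> U" "\<And>x y. x - y \<in> U \<Longrightarrow> dist (f x) (f y) < e / (k + 1)"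
    using Cc_uniformly_continuous[OF f d] by metis
  have "(LINT t|\<theta>. norm (f (t - x) - f t)) < e" if x: "x \<in> V \<inter> {x. 0 - x \<in> U}" for x
  proof -
    have "norm (LINT t|\<theta>. complex_of_real (norm (f (t - x) - f t))) \<le> (e / (k + 1)) * measure \<theta> ?K"
    proof (intro norm_integral_le Cc_norm Cc_diff Cc_translate f K)
      fix t assume t: "t \<notin> ?K"
      have "f (t - x) = 0"
      proof (rule ccontr)
        assume "f (t - x) \<noteq> 0"
        then have "t - x \<in> supp f" using notin_supp by fastforce
        moreover have "x \<in> L" using x V by auto
        ultimately have "(\<lambda>(x, y). x - y) (t - x, - x) \<in> ?K" by (intro UnI1 imageI SigmaI)
        then show False using t by simp
      qed
      then show "complex_of_real (norm (f (t - x) - f t)) = 0" using t by (simp add: notin_supp)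
    next
      fix t show "norm (complex_of_real (norm (f (t - x) - f t))) \<le> e / (k + 1)"
        using U(3)[of "t - x" t] x by (simp add: dist_norm)
    qed
    also have "\<dots> < e" unfolding k_def[symmetric]
      using e k add_nonneg_pos[OF k zero_less_one] by (simp add: field_simps)
    finally show ?thesis by simp
  qed
  moreover have "open (V \<inter> {x. 0 - x \<in> U})" by (intro open_Int V open_translation U)
  ultimately show ?thesis using V U by (intro exI[of _ "V \<inter> {x. 0 - x \<in> U}"]) auto
qed

text \<open>The Riemann--Lebesgue lemma; it also yields local compactness of the dual group.\<close>

lemma compact_inverse_Fourier_ge:
  assumes f: "f \<in> Cc" and e: "e > 0"
  shows "compact {\<xi>. e \<le> norm (inverse_Fourier \<theta> f \<xi>)}"
proof -
  \<comment> \<open>Translating \<open>f\<close> by \<open>x\<close> multiplies its transform by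
    \<open>\<xi>(x)\<close>; hence the distance of \<open>\<xi>(x)\<close> from 1, times the modulus
    of the transform, is at most the L1-distance of \<open>f\<close> to its translate. Where the
    transform is at least \<open>e\<close>, this makes \<open>m\<close> a common modulus of
    continuity.\<close>
  define m where "m x = (LINT t|\<theta>. norm (f (t - x) - f t)) / e" for x
  have "compact {\<xi>. \<forall>x. norm (eval_char \<xi> x - 1) \<le> m x}"
  proof (rule compact_equicontinuous_chars)
    fix d :: real assume "d > 0"
    then show "\<exists>U. open U \<and> 0 \<in> U \<and> (\<forall>x\<in>U. m x < d)"
      using L1_continuity_of_translation[OF f, of "d * e"] e by (simp add: m_def field_simps)
  qed
  moreover have "closed {\<xi>. e \<le> norm (inverse_Fourier \<theta> f \<xi>)}"
    by (intro closed_Collect_le continuous_intros continuous_inverse_Fourier f)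
  moreover have "norm (eval_char \<xi> x - 1) \<le> m x" if \<xi>: "e \<le> norm (inverse_Fourier \<theta> f \<xi>)" for \<xi> x
  proof -
    have C: "(\<lambda>t. f (t - x)) \<in> Cc" by (rule Cc_translate[OF f])
    have "norm (eval_char \<xi> x - 1) * e \<le> norm (eval_char \<xi> x - 1) * norm (inverse_Fourier \<theta> f \<xi>)"
      using \<xi> by (intro mult_left_mono) auto
    also have "\<dots> = norm (inverse_Fourier \<theta> (\<lambda>t. f (t - x)) \<xi> - inverse_Fourier \<theta> f \<xi>)"
      by (simp add: inverse_Fourier_translate[OF f] norm_mult[symmetric] algebra_simps)
    also have "\<dots> = norm (LINT t|\<theta>. eval_char \<xi> t * (f (t - x) - f t))"
      unfolding inverse_Fourier_def right_diff_distrib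
      by (simp add: Bochner_Integration.integral_diff Cc_integrable char_mult_Cc f C)
    also have "\<dots> \<le> (LINT t|\<theta>. norm (eval_char \<xi> t * (f (t - x) - f t)))" by (rule
        integral_norm_bound)
    also have "\<dots> = m x * e" using e by (simp add: norm_mult m_def)
    finally show ?thesis using e by simp
  qed
  ultimately have "compact ({\<xi>. \<forall>x. norm (eval_char \<xi> x - 1) \<le> m x} \<inter> {\<xi>. e \<le> norm (inverse_Fourier
      \<theta> f \<xi>)})"
    and "{\<xi>. e \<le> norm (inverse_Fourier \<theta> f \<xi>)} \<subseteq> {\<xi>. \<forall>x. norm (eval_char \<xi> x - 1) \<le> m x}"
    by (auto intro: compact_Int_closed)
  then show ?thesis by (simp add: Int_absorb1)
qed

text \<open>A bump supported so close to 0 that all characters in \<open>D\<close> are within 1/2 of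
  1 there: its transform on \<open>D\<close> differs from its positive integral by at most half of
  that integral.\<close>

lemma inverse_Fourier_nonzero_on_compact:
  assumes D: "compact D"
  obtains f where "f \<in> Cc" "\<And>\<xi>. \<xi> \<in> D \<Longrightarrow> inverse_Fourier \<theta> f \<xi> \<noteq> 0"
proof -
  obtain U where U: "open U" "(0::'a) \<in> U"
    "\<And>x \<xi>. x \<in> U \<Longrightarrow> \<xi> \<in> D \<Longrightarrow> dist (eval_char \<xi> x) (eval_char \<xi> 0) < 1/2"
    by (rule uniform_continuity_on_compact_fibres[where F="\<lambda>x \<xi>. eval_char \<xi> x" and e="1/2" and
        ?x0.0=0,
          OF continuous_on_eval_pair D]) (simp, rule that)
  obtain b W where b: "(\<lambda>x. complex_of_real (b x)) \<in> Cc" "supp (\<lambda>x. complex_of_real (b x)) \<subseteq> U"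
    "\<And>x. 0 \<le> b x" "(0::'a) \<in> W" "\<And>x. x \<in> W \<Longrightarrow> b x = 1"
    using lc_point_bump[OF lc U(1,2)] by metis
  have pos: "(LINT x|\<theta>. b x) > 0" using b by (intro integral_pos[of b 0]) auto
  have "inverse_Fourier \<theta> (\<lambda>x. complex_of_real (b x)) \<xi> \<noteq> 0" if \<xi>: "\<xi> \<in> D" for \<xi>
  proof
    assume z: "inverse_Fourier \<theta> (\<lambda>x. complex_of_real (b x)) \<xi> = 0"
    have "(LINT x|\<theta>. b x) = norm ((LINT x|\<theta>. eval_char \<xi> x * complex_of_real (b x)) - (LINT x|\<theta>.
        complex_of_real (b x)))"
      using z pos by (simp add: inverse_Fourier_def)
    also have "\<dots> = norm (LINT x|\<theta>. (eval_char \<xi> x - 1) * complex_of_real (b x))"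
      unfolding left_diff_distrib
      by (simp add: Bochner_Integration.integral_diff Cc_integrable char_mult_Cc b(1) del:
          integral_complex_of_real)
    also have "\<dots> \<le> (LINT x|\<theta>. norm ((eval_char \<xi> x - 1) * complex_of_real (b x)))" by (rule
        integral_norm_bound)
    also have "\<dots> \<le> (LINT x|\<theta>. 1/2 * b x)"
    proof (rule integral_mono)
      show "integrable \<theta> (\<lambda>x. norm ((eval_char \<xi> x - 1) * complex_of_real (b x)))"
        by (intro integrable_norm Cc_integrable Cc_mult b(1) continuous_intros eval_char_continuous)
      show "integrable \<theta> (\<lambda>x. 1/2 * b x)"
        using Cc_integrable[OF b(1)] by (intro integrable_mult_right) (simp add:
            complex_of_real_integrable_eq)
      fix x show "norm ((eval_char \<xi> x - 1) * complex_of_real (b x)) \<le> 1/2 * b x"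
      proof (cases "x \<in> U")
        case True
        then show ?thesis unfolding norm_mult using U(3)[OF True \<xi>] b(3)[of x]
          by (intro mult_mono) (auto simp: dist_norm)
      next
        case False
        then have "complex_of_real (b x) = 0" using b(2) notin_supp by blast
        then show ?thesis by simp
      qed
    qed
    also have "\<dots> = (LINT x|\<theta>. b x) / 2" by simp
    finally show False using pos by simp
  qed
  with b(1) that show thesis by blast
qed

text \<open>The test function is a bump times the conjugate of the difference of the two characters;
  the transforms then differ by the integral of the squared modulus of that difference against the
  bump.\<close>

lemma inverse_Fourier_separates:
  assumes "\<xi> \<noteq> \<psi>"
  obtains f where "f \<in> Cc" "inverse_Fourier \<theta> f \<xi> \<noteq> inverse_Fourier \<theta> f \<psi>"
proof -
  obtain x where x: "eval_char \<xi> x \<noteq> eval_char \<psi> x"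
    using assms by (metis eval_char_inject ext)
  obtain b W where b: "(\<lambda>x. complex_of_real (b x)) \<in> Cc" "\<And>x. 0 \<le> b x" "x \<in> W" "\<And>x. x \<in> W \<Longrightarrow> b x = 1"
    using lc_point_bump[OF lc open_UNIV, of x] by (metis UNIV_I)
  let ?d = "\<lambda>t. eval_char \<xi> t - eval_char \<psi> t"
  let ?f = "\<lambda>t. cnj (?d t) * complex_of_real (b t)"
  have cd: "continuous_on UNIV ?d" by (intro continuous_intros eval_char_continuous)
  have f: "?f \<in> Cc" by (intro Cc_mult b(1) continuous_intros eval_char_continuous)
  have eq: "?d t * ?f t = complex_of_real ((norm (?d t))\<^sup>2 * b t)" for t
    by (simp only: of_real_mult complex_norm_square mult_ac)
  have "(\<lambda>t. ?d t * ?f t) \<in> Cc" using cd f by (rule Cc_mult)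
  then have "(\<lambda>t. complex_of_real ((norm (?d t))\<^sup>2 * b t)) \<in> Cc" by (simp only: eq)
  then have pos: "(LINT t|\<theta>. (norm (?d t))\<^sup>2 * b t) > 0"
    using b x by (intro integral_pos[of _ x]) auto
  have "inverse_Fourier \<theta> ?f \<xi> - inverse_Fourier \<theta> ?f \<psi> = (LINT t|\<theta>. ?d t * ?f t)"
    unfolding inverse_Fourier_def left_diff_distrib[of _ _ "?f _"]
    by (rule Bochner_Integration.integral_diff[symmetric]) (intro Cc_integrable char_mult_Cc f)+
  also have "\<dots> = of_real (LINT t|\<theta>. (norm (?d t))\<^sup>2 * b t)"
    unfolding eq by (rule integral_complex_of_real)
  finally have eqd: "inverse_Fourier \<theta> ?f \<xi> - inverse_Fourier \<theta> ?f \<psi> = of_real (LINT t|\<theta>. (norm (?d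
      t))\<^sup>2 * b t)" .
  have "inverse_Fourier \<theta> ?f \<xi> \<noteq> inverse_Fourier \<theta> ?f \<psi>"
  proof
    assume "inverse_Fourier \<theta> ?f \<xi> = inverse_Fourier \<theta> ?f \<psi>"
    then have "inverse_Fourier \<theta> ?f \<xi> - inverse_Fourier \<theta> ?f \<psi> = 0" by (simp only: diff_self)
    then have "complex_of_real (LINT t|\<theta>. (norm (?d t))\<^sup>2 * b t) = 0" by (simp only: eqd)
    then show False using pos by (simp only: of_real_eq_0_iff less_irrefl)
  qed
  with f that show thesis by blast
qed

text \<open>Where a transform exceeds half of its modulus at \<open>\<xi>\<close> is an open
  neighbourhood of \<open>\<xi>\<close>, and Riemann-Lebesgue places it in a compact set.\<close>

lemma dual_locally_compact: "locally compact (UNIV :: 'a pontryagin_dual set)"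
proof -
  have Haus: "Hausdorff_space (euclidean :: 'a pontryagin_dual topology)"
    unfolding Hausdorff_space_def disjnt_def using hausdorff by (metis open_openin)
  have "locally_compact_space (euclidean :: 'a pontryagin_dual topology)"
    unfolding locally_compact_space_def
  proof
    fix \<xi> :: "'a pontryagin_dual"
    obtain f where f: "f \<in> Cc" "inverse_Fourier \<theta> f \<xi> \<noteq> 0"
      using inverse_Fourier_nonzero_on_compact[of "{\<xi>}"] by auto
    define e where "e = norm (inverse_Fourier \<theta> f \<xi>) / 2"
    have e: "e > 0" "e < norm (inverse_Fourier \<theta> f \<xi>)" using f by (auto simp: e_def)
    have "open {\<xi>. e < norm (inverse_Fourier \<theta> f \<xi>)}"
      by (intro open_Collect_less continuous_intros continuous_inverse_Fourier f)
    then show "\<exists>U K. openin euclidean U \<and> compactin euclidean K \<and> \<xi> \<in> U \<and> U \<subseteq> K"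
      using compact_inverse_Fourier_ge[OF f(1) e(1)] e(2)
      by (intro exI[of _ "{\<xi>. e < norm (inverse_Fourier \<theta> f \<xi>)}"] exI[of _
          "{\<xi>. e \<le> norm (inverse_Fourier \<theta> f \<xi>)}"])
        auto
  qed
  then have "neighbourhood_base_of (compactin euclidean) (euclidean :: 'a pontryagin_dual topology)"
    using locally_compact_space_neighbourhood_base Haus by blast
  then show ?thesis
    unfolding neighbourhood_base_of locally_def by (simp add: neighbourhood_base_at_def)
qed

text \<open>Restricted to real values because Stone-Weierstrass is applied below to algebras of real
  functions. The constants are not adjoined here.\<close>

definition real_Fourier_algebra :: "('a pontryagin_dual \<Rightarrow> real) set" where
  "real_Fourier_algebra = {g. \<exists>f\<in>Cc. \<forall>\<xi>. inverse_Fourier \<theta> f \<xi> = of_real (g \<xi>)}"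

lemma real_Fourier_algebraI:
  "f \<in> Cc \<Longrightarrow> (\<And>\<xi>. inverse_Fourier \<theta> f \<xi> = of_real (g \<xi>)) \<Longrightarrow> g \<in> real_Fourier_algebra"
  unfolding real_Fourier_algebra_def by auto

lemma real_Fourier_algebraE:
  assumes "g \<in> real_Fourier_algebra"
  obtains f where "f \<in> Cc" "\<And>\<xi>. inverse_Fourier \<theta> f \<xi> = of_real (g \<xi>)"
  using assms unfolding real_Fourier_algebra_def by auto

lemma real_Fourier_algebra_add:
  assumes "g \<in> real_Fourier_algebra" "h \<in> real_Fourier_algebra"
  shows "(\<lambda>\<xi>. g \<xi> + h \<xi>) \<in> real_Fourier_algebra"
proof -
  obtain a b where a: "a \<in> Cc" "\<And>\<xi>. inverse_Fourier \<theta> a \<xi> = of_real (g \<xi>)"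
    and b: "b \<in> Cc" "\<And>\<xi>. inverse_Fourier \<theta> b \<xi> = of_real (h \<xi>)"
    using assms by (elim real_Fourier_algebraE) (rule that)
  show ?thesis
    by (rule real_Fourier_algebraI[OF Cc_add[OF a(1) b(1)]]) (simp add: inverse_Fourier_add a b)
qed

lemma real_Fourier_algebra_mult:
  assumes "g \<in> real_Fourier_algebra" "h \<in> real_Fourier_algebra"
  shows "(\<lambda>\<xi>. g \<xi> * h \<xi>) \<in> real_Fourier_algebra"
proof -
  obtain a b where a: "a \<in> Cc" "\<And>\<xi>. inverse_Fourier \<theta> a \<xi> = of_real (g \<xi>)"
    and b: "b \<in> Cc" "\<And>\<xi>. inverse_Fourier \<theta> b \<xi> = of_real (h \<xi>)"
    using assms by (elim real_Fourier_algebraE) (rule that)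
  show ?thesis
    by (rule real_Fourier_algebraI[OF convolve_functions_Cc[OF a(1) b(1)]])
      (simp add: inverse_Fourier_convolve a b)
qed

lemma real_Fourier_algebra_cmult:
  assumes "g \<in> real_Fourier_algebra"
  shows "(\<lambda>\<xi>. c * g \<xi>) \<in> real_Fourier_algebra"
proof -
  obtain a where a: "a \<in> Cc" "\<And>\<xi>. inverse_Fourier \<theta> a \<xi> = of_real (g \<xi>)"
    using assms by (elim real_Fourier_algebraE) (rule that)
  show ?thesis
    by (rule real_Fourier_algebraI[OF Cc_cmult[OF a(1), of "of_real c"]])
      (simp add: inverse_Fourier_cmult a)
qed

text \<open>\<open>tilde\<close> conjugates the transform, so the real and imaginary parts are the
  transforms of half the sum of \<open>f\<close> and \<open>tilde f\<close> and of their difference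
  divided by \<open>2 * \<i>\<close>.\<close>

lemma real_Fourier_algebra_Re_Im:
  assumes f: "f \<in> Cc"
  shows "(\<lambda>\<xi>. Re (inverse_Fourier \<theta> f \<xi>)) \<in> real_Fourier_algebra"
    and "(\<lambda>\<xi>. Im (inverse_Fourier \<theta> f \<xi>)) \<in> real_Fourier_algebra"
proof -
  have "inverse_Fourier \<theta> (\<lambda>x. 1/2 * (f x + tilde f x)) \<xi> = of_real (Re (inverse_Fourier \<theta> f \<xi>))"
      for \<xi>
    by (simp only: inverse_Fourier_cmult inverse_Fourier_add[OF f Cc_tilde[OF f]]
        inverse_Fourier_tilde[OF f]
        complex_add_cnj) simp
  moreover have "(\<lambda>x. 1/2 * (f x + tilde f x)) \<in> Cc" by (intro Cc_cmult Cc_add Cc_tilde f)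
  ultimately show "(\<lambda>\<xi>. Re (inverse_Fourier \<theta> f \<xi>)) \<in> real_Fourier_algebra"
    by (rule real_Fourier_algebraI[rotated])
  have "inverse_Fourier \<theta> (\<lambda>x. - \<i>/2 * (f x + - 1 * tilde f x)) \<xi> = of_real (Im (inverse_Fourier \<theta> f
      \<xi>))" for \<xi>
    by (simp only: inverse_Fourier_cmult inverse_Fourier_add[OF f Cc_cmult[OF Cc_tilde[OF f]]]
        inverse_Fourier_tilde[OF f])
      (simp add: complex_eq_iff)
  moreover have "(\<lambda>x. - \<i>/2 * (f x + - 1 * tilde f x)) \<in> Cc" by (intro Cc_cmult Cc_add Cc_tilde f)
  ultimately show "(\<lambda>\<xi>. Im (inverse_Fourier \<theta> f \<xi>)) \<in> real_Fourier_algebra"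
    by (rule real_Fourier_algebraI[rotated])
qed

lemma real_Fourier_algebra_continuous:
  assumes "g \<in> real_Fourier_algebra"
  shows "continuous_on A g"
proof -
  obtain f where f: "f \<in> Cc" "\<And>\<xi>. inverse_Fourier \<theta> f \<xi> = of_real (g \<xi>)"
    using assms by (elim real_Fourier_algebraE) (rule that)
  have "continuous_on A (\<lambda>\<xi>. Re (inverse_Fourier \<theta> f \<xi>))"
    by (intro continuous_intros continuous_inverse_Fourier f)
  then show ?thesis by (simp add: f(2))
qed

lemma inverse_Fourier_bounded:
  assumes f: "f \<in> Cc"
  obtains B where "B > 0" "\<And>\<xi>. norm (inverse_Fourier \<theta> f \<xi>) \<le> B"
proof -
  obtain M where M: "M > 0" "\<And>x. norm (f x) \<le> M" using Cc_bounded[OF f] by metis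
  have "norm (inverse_Fourier \<theta> f \<xi>) \<le> M * measure \<theta> (supp f)" for \<xi>
    unfolding inverse_Fourier_def
    by (intro norm_integral_le char_mult_Cc Cc_compact f) (auto simp: norm_mult M notin_supp)
  then show thesis by (intro that[of "max 1 (M * measure \<theta> (supp f))"]) (auto simp: le_max_iff_disj)
qed

lemma real_Fourier_algebra_bounded:
  assumes "g \<in> real_Fourier_algebra"
  obtains B where "B > 0" "\<And>\<xi>. \<bar>g \<xi>\<bar> \<le> B"
proof -
  obtain f where f: "f \<in> Cc" "\<And>\<xi>. inverse_Fourier \<theta> f \<xi> = of_real (g \<xi>)"
    using assms by (elim real_Fourier_algebraE) (rule that)
  obtain B where "B > 0" "\<And>\<xi>. norm (inverse_Fourier \<theta> f \<xi>) \<le> B"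
    using inverse_Fourier_bounded[OF f(1)] by metis
  then show thesis using that by (simp add: f(2))
qed

text \<open>
  Stone--Weierstrass on the non-compact dual group: approximate on the compact set \<open>{p \<ge> \<delta>}\<close>, where
  \<open>p\<close> is a positive member of the algebra, and multiply by a polynomial in \<open>p\<close> that is nearly \<open>0\<close>
  on \<open>{p \<le> \<delta>}\<close> and nearly \<open>1\<close> on \<open>{p \<ge> 2\<delta>}\<close>.
\<close>

lemma real_Fourier_algebra_dense:
  fixes u :: "'a pontryagin_dual \<Rightarrow> real"
  assumes u: "(\<lambda>\<xi>. complex_of_real (u \<xi>)) \<in> Cc" and e: "e > 0"
  obtains g where "g \<in> real_Fourier_algebra" "\<And>\<xi>. \<bar>u \<xi> - g \<xi>\<bar> < e"
proof -
  let ?A = real_Fourier_algebra and ?S = "supp (\<lambda>\<xi>. complex_of_real (u \<xi>))"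
  have cu: "continuous_on A u" for A
    using continuous_on_Re[OF Cc_continuous[OF u]] by simp
  have u0: "u \<xi> = 0" if "\<xi> \<notin> ?S" for \<xi> using notin_supp[OF that] by simp
  obtain f where f: "f \<in> Cc" "\<And>\<xi>. \<xi> \<in> ?S \<Longrightarrow> inverse_Fourier \<theta> f \<xi> \<noteq> 0"
    using inverse_Fourier_nonzero_on_compact[OF Cc_compact[OF u]] by metis
  obtain M where M: "M > 0" "\<And>\<xi>. norm (inverse_Fourier \<theta> f \<xi>) \<le> M"
    using inverse_Fourier_bounded[OF f(1)] by metis
  \<comment> \<open>Normalised by \<open>M\<close> to take values in the unit interval, on which the
    one-variable approximation below takes place.\<close>
  define p where "p \<xi> = (norm (inverse_Fourier \<theta> f \<xi>) / M)\<^sup>2" for \<xi>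
  have "(\<lambda>\<xi>. 1 / M\<^sup>2 * (Re (inverse_Fourier \<theta> f \<xi>) * Re (inverse_Fourier \<theta> f \<xi>)
      + Im (inverse_Fourier \<theta> f \<xi>) * Im (inverse_Fourier \<theta> f \<xi>))) \<in> ?A"
    by (intro real_Fourier_algebra_cmult real_Fourier_algebra_add real_Fourier_algebra_mult
        real_Fourier_algebra_Re_Im f(1))
  also have "(\<lambda>\<xi>. 1 / M\<^sup>2 * (Re (inverse_Fourier \<theta> f \<xi>) * Re (inverse_Fourier \<theta> f \<xi>)
      + Im (inverse_Fourier \<theta> f \<xi>) * Im (inverse_Fourier \<theta> f \<xi>))) = p"
    by (rule ext) (simp add: p_def power_divide cmod_power2 flip: power2_eq_square)
  finally have p: "p \<in> ?A" .
  have p01: "0 \<le> p \<xi>" "p \<xi> \<le> 1" for \<xi>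
    using M by (auto simp: p_def intro!: power_le_one)
  obtain \<delta> where \<delta>: "\<delta> > 0" "\<And>\<xi>. \<xi> \<in> ?S \<Longrightarrow> 2 * \<delta> \<le> p \<xi>"
  proof (cases "?S = {}")
    case True then show thesis using that[of 1] by auto
  next
    case False
    obtain m where m: "m \<in> ?S" "\<forall>\<xi>\<in>?S. p m \<le> p \<xi>"
      using continuous_attains_inf[OF Cc_compact[OF u] False real_Fourier_algebra_continuous[OF p]]
          by blast
    have "p m > 0" using f(2)[OF m(1)] M by (simp add: p_def)
    then show thesis using m that[of "p m / 2"] by auto
  qed
  define L where "L = {\<xi>. \<delta> \<le> p \<xi>}"
  have "L = {\<xi>. M * sqrt \<delta> \<le> norm (inverse_Fourier \<theta> f \<xi>)}"
  proof -
    have "\<delta> \<le> (x / M)\<^sup>2 \<longleftrightarrow> M * sqrt \<delta> \<le> x" if "x \<ge> 0" for x :: real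
      using M(1) \<delta>(1) that real_le_rsqrt[of "sqrt \<delta>"]
      by (metis abs_of_nonneg divide_nonneg_pos mult.commute pos_le_divide_eq real_sqrt_abs
          real_sqrt_le_iff)
    then show ?thesis by (simp add: L_def p_def)
  qed
  then have L: "compact L"
    using compact_inverse_Fourier_ge[OF f(1), of "M * sqrt \<delta>"] M \<delta> by simp
  \<comment> \<open>The algebra with constants adjoined, as Stone-Weierstrass on \<open>L\<close>
    requires. The constant \<open>c\<close> is removed again at the end: multiplication by
    \<open>q\<close> brings \<open>g + c\<close> back into the algebra.\<close>
  define R where "R = {r. \<exists>g\<in>?A. \<exists>c. r = (\<lambda>\<xi>. g \<xi> + c)}"
  have zero: "(\<lambda>\<xi>. 0) \<in> ?A" using real_Fourier_algebra_cmult[OF p, of 0] by simp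
  have R_mult: "(\<lambda>\<xi>. r \<xi> * s \<xi>) \<in> R" if rs: "r \<in> R" "s \<in> R" for r s
  proof -
    obtain g c where g: "g \<in> ?A" "r = (\<lambda>\<xi>. g \<xi> + c)" using rs(1) by (auto simp: R_def)
    obtain h d where h: "h \<in> ?A" "s = (\<lambda>\<xi>. h \<xi> + d)" using rs(2) by (auto simp: R_def)
    have "(\<lambda>\<xi>. g \<xi> * h \<xi> + (d * g \<xi> + c * h \<xi>)) \<in> ?A"
      using g h by (intro real_Fourier_algebra_add real_Fourier_algebra_mult
          real_Fourier_algebra_cmult)
    then show ?thesis unfolding R_def g(2) h(2)
      by (intro CollectI bexI[of _ "\<lambda>\<xi>. g \<xi> * h \<xi> + (d * g \<xi> + c * h \<xi>)"] exI[of _ "c * d"]) (auto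
          simp: algebra_simps)
  qed
  have R_add: "(\<lambda>\<xi>. r \<xi> + s \<xi>) \<in> R" if rs: "r \<in> R" "s \<in> R" for r s
  proof -
    obtain g c where g: "g \<in> ?A" "r = (\<lambda>\<xi>. g \<xi> + c)" using rs(1) by (auto simp: R_def)
    obtain h d where h: "h \<in> ?A" "s = (\<lambda>\<xi>. h \<xi> + d)" using rs(2) by (auto simp: R_def)
    show ?thesis unfolding R_def g(2) h(2)
      by (intro CollectI bexI[of _ "\<lambda>\<xi>. g \<xi> + h \<xi>"] exI[of _ "c + d"] real_Fourier_algebra_add g h)
          auto
  qed
  have R_const: "(\<lambda>\<xi>. c) \<in> R" for c
    unfolding R_def by (intro CollectI bexI[OF _ zero] exI[of _ c]) simp
  have A_R: "g \<in> R" if "g \<in> ?A" for g unfolding R_def using that by force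
  have "\<exists>r. r \<in> R \<and> (\<forall>\<xi>\<in>L. \<bar>u \<xi> - r \<xi>\<bar> < e/2)"
  proof (rule Stone_Weierstrass_HOL[where P="\<lambda>r. r \<in> R"])
    show "continuous_on L r" if "r \<in> R" for r
      using that unfolding R_def
      by (auto intro!: continuous_on_add continuous_on_const intro: real_Fourier_algebra_continuous)
    show "\<exists>r. r \<in> R \<and> r \<xi> \<noteq> r \<psi>" if \<xi>\<psi>: "\<xi> \<in> L \<and> \<psi> \<in> L \<and> \<xi> \<noteq> \<psi>" for \<xi> \<psi>
    proof -
      obtain h where h: "h \<in> Cc" "inverse_Fourier \<theta> h \<xi> \<noteq> inverse_Fourier \<theta> h \<psi>"
        using \<xi>\<psi> inverse_Fourier_separates[of \<xi> \<psi>] by metis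
      then show ?thesis
        using A_R[OF real_Fourier_algebra_Re_Im(1)[OF h(1)]] A_R[OF real_Fourier_algebra_Re_Im(2)[OF
            h(1)]]
        by (meson complex_eqI)
    qed
  qed (use L R_const R_add R_mult cu e in auto)
  then obtain r where r: "r \<in> R" "\<And>\<xi>. \<xi> \<in> L \<Longrightarrow> \<bar>u \<xi> - r \<xi>\<bar> < e/2" by blast
  then obtain g c where g: "g \<in> ?A" "r = (\<lambda>\<xi>. g \<xi> + c)" by (auto simp: R_def)
  obtain B0 where B0: "B0 > 0" "\<And>\<xi>. \<bar>g \<xi>\<bar> \<le> B0" using real_Fourier_algebra_bounded[OF g(1)] by metis
  define B where "B = B0 + \<bar>c\<bar>"
  have B: "B > 0" "\<And>\<xi>. \<bar>r \<xi>\<bar> \<le> B"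
    using B0 abs_triangle_ineq[of "g _" c] unfolding B_def g(2)
    by (auto intro: order_trans[OF abs_triangle_ineq] add_mono)
  \<comment> \<open>\<open>q\<close> will approximate the cut-off only up to
    \<open>2 * \<eta>\<close>, and this error is multiplied by \<open>r\<close>, bounded by
    \<open>B\<close>; the total is \<open>e / 2\<close>.\<close>
  define \<eta> where "\<eta> = e / (4 * B)"
  have \<eta>: "\<eta> > 0" using e B by (simp add: \<eta>_def)
  define k where "k x = min 1 (max 0 ((x - \<delta>) / \<delta>))" for x :: real
  have ck: "continuous_on A k" for A unfolding k_def using \<delta>(1) by (intro continuous_intros) auto
  \<comment> \<open>Composition with \<open>p\<close> is required to land in the algebra only after
    subtraction of \<open>h 0\<close>. The subtraction costs another \<open>\<eta>\<close>, because
    the target \<open>k\<close> vanishes at 0.\<close>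
  define P where "P h \<longleftrightarrow> continuous_on UNIV h \<and> (\<exists>g\<in>?A. \<forall>\<xi>. h (p \<xi>) = g \<xi> + h 0)" for h ::
      "real \<Rightarrow> real"
  have "\<exists>h. P h \<and> (\<forall>x\<in>{0..1}. \<bar>k x - h x\<bar> < \<eta>)"
  proof (rule Stone_Weierstrass_HOL[where P=P])
    show "P (\<lambda>x. c)" for c unfolding P_def using zero by auto
    show "continuous_on {0..1} h" if "P h" for h
      using that unfolding P_def by (meson continuous_on_subset subset_UNIV)
    show "P (\<lambda>x. h x + h' x)" if hh: "P h \<and> P h'" for h h'
    proof -
      obtain g g' where "g \<in> ?A" "g' \<in> ?A" "\<And>\<xi>. h (p \<xi>) = g \<xi> + h 0" "\<And>\<xi>. h' (p \<xi>) = g' \<xi> + h' 0"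
        using hh unfolding P_def by blast
      then show ?thesis using hh unfolding P_def
        by (auto intro!: continuous_intros bexI[of _ "\<lambda>\<xi>. g \<xi> + g' \<xi>"] real_Fourier_algebra_add)
    qed
    show "P (\<lambda>x. h x * h' x)" if hh: "P h \<and> P h'" for h h'
    proof -
      obtain g g' where g: "g \<in> ?A" "g' \<in> ?A" "\<And>\<xi>. h (p \<xi>) = g \<xi> + h 0" "\<And>\<xi>. h' (p \<xi>) = g' \<xi> + h' 0"
        using hh unfolding P_def by blast
      have "(\<lambda>\<xi>. g \<xi> * g' \<xi> + (h' 0 * g \<xi> + h 0 * g' \<xi>)) \<in> ?A"
        using g by (intro real_Fourier_algebra_add real_Fourier_algebra_mult
            real_Fourier_algebra_cmult)
      then show ?thesis using hh g(3,4) unfolding P_def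
        by (auto intro!: continuous_intros bexI[of _ "\<lambda>\<xi>. g \<xi> * g' \<xi> + (h' 0 * g \<xi> + h 0 * g' \<xi>)"]
            simp: algebra_simps)
    qed
    show "\<exists>h. P h \<and> h x \<noteq> h y" if "x \<in> {0..1} \<and> y \<in> {0..1} \<and> x \<noteq> y" for x y
      using that p unfolding P_def by (intro exI[of _ "\<lambda>x. x"]) auto
  qed (use ck \<eta> in auto)
  then obtain h where h: "P h" "\<And>x. x \<in> {0..1} \<Longrightarrow> \<bar>k x - h x\<bar> < \<eta>" by blast
  obtain q where q: "q \<in> ?A" "\<And>\<xi>. h (p \<xi>) = q \<xi> + h 0" using h(1) unfolding P_def by blast
  have k0: "k 0 = 0" using \<delta>(1) by (simp add: k_def)
  have qk: "\<bar>q \<xi> - k (p \<xi>)\<bar> < 2 * \<eta>" for \<xi>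
    using h(2)[of "p \<xi>"] h(2)[of 0] p01[of \<xi>] q(2)[of \<xi>] k0 by auto
  have "(\<lambda>\<xi>. q \<xi> * g \<xi> + c * q \<xi>) \<in> ?A"
    using q g by (intro real_Fourier_algebra_add real_Fourier_algebra_mult
        real_Fourier_algebra_cmult)
  moreover have "\<bar>u \<xi> - (q \<xi> * g \<xi> + c * q \<xi>)\<bar> < e" for \<xi>
  proof -
    have eq: "q \<xi> * g \<xi> + c * q \<xi> = k (p \<xi>) * r \<xi> + (q \<xi> - k (p \<xi>)) * r \<xi>"
      by (simp add: g(2) algebra_simps)
    have "\<bar>(q \<xi> - k (p \<xi>)) * r \<xi>\<bar> \<le> 2 * \<eta> * B"
      unfolding abs_mult using qk[of \<xi>] B by (intro mult_mono) auto
    also have "\<dots> = e / 2" using B by (simp add: \<eta>_def)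
    finally have 1: "\<bar>(q \<xi> - k (p \<xi>)) * r \<xi>\<bar> \<le> e / 2" .
    have 2: "\<bar>u \<xi> - k (p \<xi>) * r \<xi>\<bar> < e / 2"
    proof (cases "\<xi> \<in> L")
      case False
      then have "k (p \<xi>) = 0" using \<delta>(1) by (auto simp: k_def L_def divide_le_0_iff)
      moreover have "\<xi> \<notin> ?S" using \<delta>(1) \<delta>(2)[of \<xi>] False by (auto simp: L_def)
      ultimately show ?thesis using u0 e by simp
    next
      case L: True
      show ?thesis
      proof (cases "2 * \<delta> \<le> p \<xi>")
        case True
        then have "k (p \<xi>) = 1" using \<delta> by (simp add: k_def field_simps)
        then show ?thesis using r(2)[OF L] by simp
      next
        \<comment> \<open>In the transition zone \<open>u\<close> vanishes, so \<open>r\<close> is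
          already small on \<open>L\<close>, and a factor between 0 and 1 keeps it small.\<close>
        case False
        then have "u \<xi> = 0" using \<delta>(2) u0 by blast
        moreover have "\<bar>k (p \<xi>) * r \<xi>\<bar> \<le> 1 * \<bar>r \<xi>\<bar>"
          unfolding abs_mult by (intro mult_right_mono) (auto simp: k_def)
        ultimately show ?thesis using r(2)[OF L] by simp
      qed
    qed
    show ?thesis unfolding eq using 1 2 by linarith
  qed
  ultimately show thesis by (rule that)
qed

lemma inverse_Fourier_dense:
  fixes u :: "'a pontryagin_dual \<Rightarrow> complex"
  assumes u: "u \<in> Cc" and e: "e > 0"
  obtains h where "h \<in> Cc" "\<And>\<xi>. norm (u \<xi> - inverse_Fourier \<theta> h \<xi>) < e"
proof -
  have cu: "continuous_on UNIV u" by (rule Cc_continuous[OF u])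
  have "(\<lambda>\<xi>. complex_of_real (Re (u \<xi>))) \<in> Cc" "(\<lambda>\<xi>. complex_of_real (Im (u \<xi>))) \<in> Cc"
    by (rule CcI[OF _ Cc_compact[OF u]]; use cu notin_supp[of _ u] in \<open>auto intro!:
        continuous_intros\<close>)+
  then obtain g1 g2 where g: "g1 \<in> real_Fourier_algebra" "g2 \<in> real_Fourier_algebra"
    "\<And>\<xi>. \<bar>Re (u \<xi>) - g1 \<xi>\<bar> < e/2" "\<And>\<xi>. \<bar>Im (u \<xi>) - g2 \<xi>\<bar> < e/2"
    using real_Fourier_algebra_dense[of "\<lambda>\<xi>. Re (u \<xi>)" "e/2"]
      real_Fourier_algebra_dense[of "\<lambda>\<xi>. Im (u \<xi>)" "e/2"] e by (metis half_gt_zero)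
  obtain h1 h2 where h: "h1 \<in> Cc" "h2 \<in> Cc" "\<And>\<xi>. inverse_Fourier \<theta> h1 \<xi> = of_real (g1 \<xi>)"
    "\<And>\<xi>. inverse_Fourier \<theta> h2 \<xi> = of_real (g2 \<xi>)"
    using g(1,2) by (elim real_Fourier_algebraE) (rule that)
  show thesis
  proof (rule that[of "\<lambda>x. h1 x + \<i> * h2 x"])
    show "(\<lambda>x. h1 x + \<i> * h2 x) \<in> Cc" using h by (intro Cc_add Cc_cmult)
    fix \<xi>
    have "u \<xi> - inverse_Fourier \<theta> (\<lambda>x. h1 x + \<i> * h2 x) \<xi>
        = of_real (Re (u \<xi>) - g1 \<xi>) + \<i> * of_real (Im (u \<xi>) - g2 \<xi>)"
      by (simp add: inverse_Fourier_add inverse_Fourier_cmult h Cc_cmult complex_eq_iff)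
    also have "norm \<dots> \<le> \<bar>Re (u \<xi>) - g1 \<xi>\<bar> + \<bar>Im (u \<xi>) - g2 \<xi>\<bar>"
      by (rule order_trans[OF norm_triangle_ineq]) (simp add: norm_mult del: of_real_diff)
    also have "\<dots> < e" using g(3,4)[of \<xi>] by linarith
    finally show "norm (u \<xi> - inverse_Fourier \<theta> (\<lambda>x. h1 x + \<i> * h2 x) \<xi>) < e" .
  qed
qed

end

section \<open>Integration against a positive Radon measure\<close>

locale positive_radon =
  fixes \<nu> :: "'b::t2_space functional"
  assumes lcb: "locally compact (UNIV :: 'b set)" and positive: "positive_radon_measure \<nu>"
begin

lemma radon: "radon_measure \<nu>"
  using positive by (simp add: positive_radon_measure_def)

lemmas add = radon_add[OF radon] and cmult = radon_cmult[OF radon] and diff = radon_diff[OF radon]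
  and zero = radon_zero[OF radon] and sum = radon_sum[OF radon]

lemma nonneg:
  assumes "(\<lambda>x. complex_of_real (f x)) \<in> Cc" "\<And>x. 0 \<le> f x"
  shows "0 \<le> Re (\<nu> (\<lambda>x. of_real (f x)))" "Im (\<nu> (\<lambda>x. of_real (f x))) = 0"
proof -
  have "\<nu> (\<lambda>x. of_real (f x)) \<in> \<real>\<^sub>\<ge>\<^sub>0"
    using positive assms by (simp add: positive_radon_measure_def)
  then show "0 \<le> Re (\<nu> (\<lambda>x. of_real (f x)))" "Im (\<nu> (\<lambda>x. of_real (f x))) = 0"
    by (auto simp: complex_nonneg_Reals_iff)
qed

lemma mono:
  assumes f: "(\<lambda>x. complex_of_real (f x)) \<in> Cc" and g: "(\<lambda>x. complex_of_real (g x)) \<in> Cc"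
    and "\<And>x. f x \<le> g x"
  shows "Re (\<nu> (\<lambda>x. of_real (f x))) \<le> Re (\<nu> (\<lambda>x. of_real (g x)))"
proof -
  have "(\<lambda>x. complex_of_real (g x - f x)) \<in> Cc" using Cc_diff[OF g f] by simp
  then have "0 \<le> Re (\<nu> (\<lambda>x. of_real (g x - f x)))" using assms(3) by (intro nonneg) auto
  then show ?thesis using diff[OF g f] by simp
qed

lemma real_valued:
  assumes f: "(\<lambda>x. complex_of_real (f x)) \<in> Cc"
  shows "\<nu> (\<lambda>x. of_real (f x)) = of_real (Re (\<nu> (\<lambda>x. of_real (f x))))"
proof -
  have n: "(\<lambda>x. complex_of_real \<bar>f x\<bar>) \<in> Cc" using Cc_norm[OF f] by simp
  have d: "(\<lambda>x. complex_of_real (\<bar>f x\<bar> - f x)) \<in> Cc" using Cc_diff[OF n f] by simp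
  have "Im (\<nu> (\<lambda>x. of_real \<bar>f x\<bar>)) = 0" using n by (rule nonneg) simp
  moreover have "Im (\<nu> (\<lambda>x. of_real (\<bar>f x\<bar> - f x))) = 0" using d by (rule nonneg) simp
  ultimately have "Im (\<nu> (\<lambda>x. of_real (f x))) = 0" using diff[OF n f] by simp
  then show ?thesis by (simp add: complex_eq_iff)
qed

lemma cnj:
  assumes f: "f \<in> Cc"
  shows "\<nu> (\<lambda>x. cnj (f x)) = cnj (\<nu> f)"
proof -
  have cf: "continuous_on UNIV f" by (rule Cc_continuous[OF f])
  have r: "(\<lambda>x. complex_of_real (Re (f x))) \<in> Cc" and i: "(\<lambda>x. complex_of_real (Im (f x))) \<in> Cc"
    by (rule CcI[OF _ Cc_compact[OF f]]; use cf notin_supp[of _ f] in \<open>auto intro!: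
        continuous_intros\<close>)+
  have "(\<lambda>x. cnj (f x)) = (\<lambda>x. of_real (Re (f x)) + - \<i> * of_real (Im (f x)))"
    by (auto simp: complex_eq_iff)
  then have "\<nu> (\<lambda>x. cnj (f x)) = \<nu> (\<lambda>x. of_real (Re (f x))) + - \<i> * \<nu> (\<lambda>x. of_real (Im (f x)))"
    by (simp only: add[OF r Cc_cmult[OF i]] cmult[OF i])
  also have "\<dots> = cnj (\<nu> (\<lambda>x. of_real (Re (f x))) + \<i> * \<nu> (\<lambda>x. of_real (Im (f x))))"
    using arg_cong[OF real_valued[OF r], of Im] arg_cong[OF real_valued[OF i], of Im]
    by (simp add: complex_eq_iff)
  also have "\<nu> (\<lambda>x. of_real (Re (f x))) + \<i> * \<nu> (\<lambda>x. of_real (Im (f x)))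
      = \<nu> (\<lambda>x. of_real (Re (f x)) + \<i> * of_real (Im (f x)))"
    by (simp only: add[OF r Cc_cmult[OF i]] cmult[OF i])
  also have "(\<lambda>x. of_real (Re (f x)) + \<i> * of_real (Im (f x))) = f"
    by (auto simp: complex_eq_iff)
  finally show ?thesis .
qed

lemma norm_le:
  assumes f: "f \<in> Cc" and g: "(\<lambda>x. complex_of_real (g x)) \<in> Cc" and fg: "\<And>x. norm (f x) \<le> g x"
  shows "norm (\<nu> f) \<le> Re (\<nu> (\<lambda>x. of_real (g x)))"
proof (cases "\<nu> f = 0")
  case True
  then show ?thesis using nonneg(1)[OF g] fg norm_ge_zero order_trans by (metis norm_zero)
next
  case False
  \<comment> \<open>Rotation by this unimodular constant makes the value of \<open>\<nu>\<close>
    equal to its modulus, so that positivity can compare real parts.\<close>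
  define c where "c = cnj (sgn (\<nu> f))"
  have c: "norm c = 1" using False by (simp add: c_def norm_sgn)
  have "c * \<nu> f = of_real (norm (\<nu> f))"
    unfolding c_def sgn_eq using False
    by (simp add: complex_norm_square[symmetric] power2_eq_square mult.commute)
  then have "norm (\<nu> f) = Re (\<nu> (\<lambda>x. c * f x))" by (simp add: cmult[OF f])
  also have "\<dots> = (Re (\<nu> (\<lambda>x. c * f x)) + Re (cnj (\<nu> (\<lambda>x. c * f x)))) / 2" by simp
  also have "\<dots> = Re (\<nu> (\<lambda>x. c * f x + cnj (c * f x))) / 2"
    using Cc_cmult[OF f, of c] by (simp only: cnj[symmetric] add[OF _ Cc_cnj] plus_complex.sel)
  also have "(\<lambda>x. c * f x + cnj (c * f x)) = (\<lambda>x. complex_of_real (2 * Re (c * f x)))"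
    by (auto simp: complex_eq_iff)
  also have "Re (\<nu> (\<lambda>x. complex_of_real (2 * Re (c * f x)))) / 2 \<le> Re (\<nu> (\<lambda>x. complex_of_real (2 * g
      x))) / 2"
  proof (intro divide_right_mono mono)
    have "(\<lambda>x. c * f x + cnj (c * f x)) \<in> Cc" by (intro Cc_add Cc_cnj Cc_cmult f)
    also have "(\<lambda>x. c * f x + cnj (c * f x)) = (\<lambda>x. complex_of_real (2 * Re (c * f x)))"
      by (auto simp: complex_eq_iff)
    finally show "(\<lambda>x. complex_of_real (2 * Re (c * f x))) \<in> Cc" .
    show "(\<lambda>x. complex_of_real (2 * g x)) \<in> Cc" using Cc_cmult[OF g, of 2] by simp
    fix x
    have "Re (c * f x) \<le> norm (c * f x)" by (rule complex_Re_le_cmod)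
    then show "2 * Re (c * f x) \<le> 2 * g x" using fg[of x] c by (simp add: norm_mult)
  qed simp
  also have "\<dots> = Re (\<nu> (\<lambda>x. of_real (g x)))" using cmult[OF g, of 2] by simp
  finally show ?thesis .
qed

text \<open>
  For continuous \<open>r\<close> the infimum over lower semicontinuous majorants is attained by \<open>|r|\<close>
  itself, so that no measure theory on \<open>'b\<close> is needed for \<open>N r\<close>.
\<close>

definition N :: "('b \<Rightarrow> complex) \<Rightarrow> ennreal" where
  "N r = variation_integral \<nu> (\<lambda>x. ennreal (norm (r x)))"

lemma norm_le_N:
  assumes "k \<in> Cc" "\<And>x. norm (k x) \<le> norm (r x)"
  shows "ennreal (norm (\<nu> k)) \<le> N r"
  unfolding N_def variation_integral_def
proof (rule INF_greatest)
  fix h :: "'b \<Rightarrow> ennreal"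
  assume "h \<in> {h. (\<forall>a. open {x. a < h x}) \<and> (\<forall>x. ennreal (norm (r x)) \<le> h x)}"
  then have "ennreal (norm (k x)) \<le> h x" for x
    using assms(2)[of x] by (auto intro: order_trans[OF ennreal_leI])
  then show "ennreal (norm (\<nu> k)) \<le> (SUP g\<in>{g \<in> Cc. \<forall>x. ennreal (norm (g x)) \<le> h x}. ennreal (norm
      (\<nu> g)))"
    using assms(1) by (intro SUP_upper) auto
qed

lemma N_le:
  assumes r: "continuous_on UNIV r" and b: "\<And>k. k \<in> Cc \<Longrightarrow> (\<And>x. norm (k x) \<le> norm (r x)) \<Longrightarrow> ennreal
      (norm (\<nu> k)) \<le> B"
  shows "N r \<le> B"
proof -
  have "N r \<le> (SUP g\<in>{g\<in>Cc. \<forall>x. ennreal (norm (g x)) \<le> ennreal (norm (r x))}. ennreal (norm (\<nu> g)))"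
    unfolding N_def variation_integral_def
  proof (rule INF_lower, intro CollectI conjI allI)
    fix a :: ennreal
    show "open {x. a < ennreal (norm (r x))}"
      using r by (intro open_Collect_less continuous_intros continuous_on_ennreal)
  qed simp
  also have "\<dots> \<le> B" by (rule SUP_least) (auto intro!: b)
  finally show ?thesis .
qed

lemma N_mono: "(\<And>x. norm (r x) \<le> norm (s x)) \<Longrightarrow> N r \<le> N s"
  unfolding N_def variation_integral_def
  by (rule INF_superset_mono) (auto intro: order_trans[OF ennreal_leI])

lemma N_Cc_le:
  assumes "k \<in> Cc"
  shows "N k \<le> ennreal (Re (\<nu> (\<lambda>x. of_real (norm (k x)))))"
  by (rule N_le) (auto intro!: ennreal_leI norm_le Cc_norm Cc_continuous assms)

text \<open>A test function \<open>k\<close> below \<open>r + s\<close> is divided in proportion to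
  the moduli of \<open>r\<close> and \<open>s\<close>; the two shares are test functions for
  \<open>r\<close> and for \<open>s\<close>.\<close>

lemma N_add_le:
  assumes r: "continuous_on UNIV r" and s: "continuous_on UNIV s"
  shows "N (\<lambda>x. r x + s x) \<le> N r + N s"
proof (rule N_le)
  show "continuous_on UNIV (\<lambda>x. r x + s x)" using r s by (intro continuous_intros)
  fix k assume k: "k \<in> Cc" "\<And>x. norm (k x) \<le> norm (r x + s x)"
  let ?t = "\<lambda>x. norm (r x) + norm (s x)"
  have kt: "norm (k x) \<le> ?t x" for x using k(2)[of x] norm_triangle_ineq order_trans by blast
  have part: "(\<lambda>x. of_real (norm (q x) / ?t x) * k x) \<in> Cc"
    if q: "continuous_on UNIV q" "\<And>x. norm (q x) \<le> ?t x" for q :: "'b \<Rightarrow> complex"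
  proof (rule CcI[OF _ Cc_compact[OF k(1)]])
    have ck: "continuous_on UNIV k" by (rule Cc_continuous[OF k(1)])
    \<comment> \<open>Where \<open>?t\<close> vanishes the quotient is 0 by convention. Continuity
      at such a point comes from domination by \<open>k\<close>, which vanishes there too.\<close>
    have "isCont (\<lambda>x. of_real (norm (q x) / ?t x) * k x) x" for x
    proof (cases "?t x = 0")
      case False
      then show ?thesis using q r s ck
        by (intro continuous_intros) (auto simp: continuous_on_eq_continuous_at)
    next
      case True
      then have kx: "k x = 0" using kt[of x] by simp
      have "isCont k x" using ck by (simp add: continuous_on_eq_continuous_at)
      then have "(k \<longlongrightarrow> 0) (at x)" using kx by (simp add: isCont_def)
      moreover have "norm (of_real (norm (q y) / ?t y) * k y) \<le> norm (k y)" for y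
      proof -
        have "norm (q y) / ?t y \<le> 1" using q(2)[of y] by (simp add: divide_le_eq_1) (smt (verit)
            norm_ge_zero)
        then show ?thesis
          unfolding norm_mult norm_of_real by (intro mult_left_le_one_le) (auto simp:
              divide_nonneg_nonneg)
      qed
      ultimately have "((\<lambda>y. of_real (norm (q y) / ?t y) * k y) \<longlongrightarrow> 0) (at x)"
        by (rule Lim_null_comparison[OF eventuallyI tendsto_norm_zero, rotated])
      then show ?thesis using kx by (simp add: isCont_def)
    qed
    then show "continuous_on UNIV (\<lambda>x. of_real (norm (q x) / ?t x) * k x)"
      by (simp add: continuous_on_eq_continuous_at)
  qed (simp add: notin_supp)
  let ?k1 = "\<lambda>x. of_real (norm (r x) / ?t x) * k x" and ?k2 =
      "\<lambda>x. of_real (norm (s x) / ?t x) * k x"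
  have k1: "?k1 \<in> Cc" and k2: "?k2 \<in> Cc"
    using part[OF r] part[OF s] by simp_all
  have "k = (\<lambda>x. ?k1 x + ?k2 x)"
  proof
    fix x
    show "k x = ?k1 x + ?k2 x"
    proof (cases "?t x = 0")
      case True then show ?thesis using kt[of x] by simp
    next
      case False
      then have "complex_of_real (norm (r x) / ?t x) + of_real (norm (s x) / ?t x) = 1"
        unfolding of_real_add[symmetric] add_divide_distrib[symmetric] by simp
      then show ?thesis by (metis distrib_right mult_1)
    qed
  qed
  then have "\<nu> k = \<nu> ?k1 + \<nu> ?k2" using add[OF k1 k2] by simp
  then have "ennreal (norm (\<nu> k)) \<le> ennreal (norm (\<nu> ?k1)) + ennreal (norm (\<nu> ?k2))"
    by (simp add: norm_triangle_ineq ennreal_plus[symmetric] del: ennreal_plus)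
  also have "\<dots> \<le> N r + N s"
  proof (intro add_mono norm_le_N k1 k2)
    have *: "norm (of_real (a / ?t x) * k x) \<le> a" if "0 \<le> a" for a x
    proof (cases "?t x = 0")
      case True then show ?thesis using that by simp
    next
      case False
      then have t: "?t x > 0" by (smt (verit) norm_ge_zero)
      have "norm (of_real (a / ?t x) * k x) = a * (norm (k x) / ?t x)"
        unfolding norm_mult norm_of_real using that t by simp
      also have "\<dots> \<le> a * 1" using that t kt[of x] by (intro mult_left_mono) auto
      finally show ?thesis by simp
    qed
    show "norm (?k1 x) \<le> norm (r x)" "norm (?k2 x) \<le> norm (s x)" for x by (rule *, simp)+
  qed
  finally show "ennreal (norm (\<nu> k)) \<le> N r + N s" .
qed

lemma N_cmult_le:
  assumes r: "continuous_on UNIV r"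
  shows "N (\<lambda>x. c * r x) \<le> ennreal (norm c) * N r"
proof (rule N_le)
  show "continuous_on UNIV (\<lambda>x. c * r x)" using r by (intro continuous_intros)
  fix k assume k: "k \<in> Cc" "\<And>x. norm (k x) \<le> norm (c * r x)"
  show "ennreal (norm (\<nu> k)) \<le> ennreal (norm c) * N r"
  proof (cases "c = 0")
    case True
    then have "k = (\<lambda>x. 0)" using k(2) by auto
    then show ?thesis by (simp add: zero)
  next
    case False
    have "ennreal (norm (\<nu> (\<lambda>x. inverse c * k x))) \<le> N r"
      using k False by (intro norm_le_N Cc_cmult) (auto simp: norm_mult norm_inverse norm_divide
          field_simps)
    then have "ennreal (norm c) * ennreal (norm (\<nu> (\<lambda>x. inverse c * k x))) \<le> ennreal (norm c) * N r"
      by (intro mult_left_mono) auto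
    also have "ennreal (norm c) * ennreal (norm (\<nu> (\<lambda>x. inverse c * k x))) = ennreal (norm (\<nu> k))"
      using False by (simp add: cmult[OF k(1)] ennreal_mult[symmetric] norm_mult norm_inverse)
    finally show ?thesis .
  qed
qed

section \<open>The extension of the integral to continuous functions, and atoms\<close>

lemma has_integral_approx:
  assumes "has_radon_integral \<nu> F z" "e > 0"
  obtains g where "g \<in> Cc" "N (\<lambda>x. F x - g x) < ennreal e" "norm (\<nu> g - z) < e"
  using assms unfolding has_radon_integral_def N_def by meson

text \<open>On \<open>Cc\<close> the functional is a contraction for \<open>N\<close>, and the
  triangle inequality carries this over to \<open>z\<close> through an approximant of
  \<open>F\<close>. It yields uniqueness of the integral and all later error estimates.\<close>

lemma has_integral_diff_le:
  assumes F: "continuous_on UNIV F" "has_radon_integral \<nu> F z" and k: "k \<in> Cc"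
  shows "ennreal (norm (\<nu> k - z)) \<le> N (\<lambda>x. k x - F x)"
proof (rule ennreal_le_epsilon)
  fix e :: real assume e: "0 < e"
  then obtain g where g: "g \<in> Cc" "N (\<lambda>x. F x - g x) < ennreal (e/2)" "norm (\<nu> g - z) < e/2"
    using has_integral_approx[OF F(2), of "e/2"] by (metis half_gt_zero)
  note ck = Cc_continuous[OF k, of UNIV] and cg = Cc_continuous[OF g(1), of UNIV]
  have "norm (\<nu> k - z) \<le> norm (\<nu> (\<lambda>x. k x - g x)) + e/2"
    using norm_triangle_ineq[of "\<nu> k - \<nu> g" "\<nu> g - z"] g(3) diff[OF k g(1)] by simp
  then have "ennreal (norm (\<nu> k - z)) \<le> ennreal (norm (\<nu> (\<lambda>x. k x - g x))) + ennreal (e/2)"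
    using e by (simp add: ennreal_plus[symmetric] ennreal_leI del: ennreal_plus)
  also have "ennreal (norm (\<nu> (\<lambda>x. k x - g x))) \<le> N (\<lambda>x. k x - g x)"
    by (intro norm_le_N Cc_diff k g) simp
  also have "N (\<lambda>x. k x - g x) = N (\<lambda>x. (k x - F x) + (F x - g x))" by simp
  also have "\<dots> \<le> N (\<lambda>x. k x - F x) + N (\<lambda>x. F x - g x)"
    using F(1) ck cg by (intro N_add_le continuous_intros)
  also have "\<dots> + ennreal (e/2) \<le> N (\<lambda>x. k x - F x) + ennreal (e/2) + ennreal (e/2)"
    using g(2) by (intro add_mono) auto
  also have "\<dots> = N (\<lambda>x. k x - F x) + ennreal e"
    using e by (simp add: add.assoc ennreal_plus[symmetric] del: ennreal_plus)
  finally show "ennreal (norm (\<nu> k - z)) \<le> N (\<lambda>x. k x - F x) + ennreal e"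
    by (simp add: add_right_mono)
qed

lemma has_integral_norm_le:
  assumes F: "continuous_on UNIV F" "has_radon_integral \<nu> F z"
  shows "ennreal (norm z) \<le> N F"
proof -
  have "ennreal (norm z) \<le> N (\<lambda>x. 0 - F x)"
    using has_integral_diff_le[OF F Cc_zero] zero by simp
  also have "\<dots> \<le> N F" by (rule N_mono) simp
  finally show ?thesis .
qed

text \<open>Converse of \<open>has_integral_norm_le\<close> for nonnegative integrands. Replacing
  the approximant \<open>s\<close> by its modulus does not move it away from
  \<open>S \<ge> 0\<close>, and on nonnegative \<open>Cc\<close> functions the seminorm is bounded
  by the value of \<open>\<nu>\<close>.\<close>

lemma N_le_has_integral:
  assumes S: "continuous_on UNIV (\<lambda>x. complex_of_real (S x))" "\<And>x. 0 \<le> S x"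
    and z: "has_radon_integral \<nu> (\<lambda>x. of_real (S x)) z"
  shows "N (\<lambda>x. of_real (S x)) \<le> ennreal (norm z)"
proof (rule ennreal_le_epsilon)
  fix e :: real assume e: "0 < e"
  then obtain s where s: "s \<in> Cc" "N (\<lambda>x. of_real (S x) - s x) < ennreal (e/2)"
    using has_integral_approx[OF z, of "e/2"] by (metis half_gt_zero)
  note cs = Cc_continuous[OF s(1), of UNIV]
  let ?s = "\<lambda>x. complex_of_real (norm (s x))"
  have s': "?s \<in> Cc" by (rule Cc_norm[OF s(1)])
  have le: "N (\<lambda>x. ?s x - of_real (S x)) \<le> N (\<lambda>x. of_real (S x) - s x)"
  proof (rule N_mono)
    fix x
    have "norm (?s x - of_real (S x)) = \<bar>norm (s x) - norm (complex_of_real (S x))\<bar>"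
      unfolding of_real_diff[symmetric] norm_of_real using S(2)[of x] by simp
    also have "\<dots> \<le> norm (of_real (S x) - s x)"
      using norm_triangle_ineq3[of "s x" "complex_of_real (S x)"] by (simp add: norm_minus_commute)
    finally show "norm (?s x - of_real (S x)) \<le> norm (of_real (S x) - s x)" .
  qed
  have n: "ennreal (norm (\<nu> ?s - z)) \<le> N (\<lambda>x. ?s x - of_real (S x))"
    by (rule has_integral_diff_le[OF S(1) z s'])
  have "ennreal (norm (\<nu> ?s - z)) \<le> ennreal (e/2)"
    using n le s(2) by (meson order_trans less_imp_le)
  then have d: "norm (\<nu> ?s - z) \<le> e/2" using e by (simp add: ennreal_le_iff)
  have "N (\<lambda>x. of_real (S x)) = N (\<lambda>x. s x + (of_real (S x) - s x))" by simp
  also have "\<dots> \<le> N s + N (\<lambda>x. of_real (S x) - s x)"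
    using S(1) cs by (intro N_add_le continuous_on_diff)
  also have "\<dots> \<le> ennreal (Re (\<nu> ?s)) + ennreal (e/2)"
    using s by (intro add_mono N_Cc_le) auto
  also have "\<dots> \<le> ennreal (norm z + e/2) + ennreal (e/2)"
  proof (intro add_mono ennreal_leI order.refl)
    show "Re (\<nu> ?s) \<le> norm z + e / 2"
      using complex_Re_le_cmod[of "\<nu> ?s"] norm_triangle_ineq2[of "\<nu> ?s" z] d by linarith
  qed
  also have "\<dots> = ennreal (norm z) + ennreal e"
    using e by (simp add: ennreal_plus[symmetric] del: ennreal_plus)
  finally show "N (\<lambda>x. of_real (S x)) \<le> ennreal (norm z) + ennreal e" .
qed

lemma has_integral_add:
  assumes F: "continuous_on UNIV F" "has_radon_integral \<nu> F y" and G: "continuous_on UNIV G"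
      "has_radon_integral \<nu> G z"
  shows "has_radon_integral \<nu> (\<lambda>x. F x + G x) (y + z)"
  unfolding has_radon_integral_def
proof (intro allI impI)
  fix e :: real assume e: "e > 0"
  obtain f where f: "f \<in> Cc" "N (\<lambda>x. F x - f x) < ennreal (e/2)" "norm (\<nu> f - y) < e/2"
    using has_integral_approx[OF F(2), of "e/2"] e by (metis half_gt_zero)
  obtain g where g: "g \<in> Cc" "N (\<lambda>x. G x - g x) < ennreal (e/2)" "norm (\<nu> g - z) < e/2"
    using has_integral_approx[OF G(2), of "e/2"] e by (metis half_gt_zero)
  note cf = Cc_continuous[OF f(1), of UNIV] and cg = Cc_continuous[OF g(1), of UNIV]
  have "N (\<lambda>x. F x + G x - (f x + g x)) = N (\<lambda>x. (F x - f x) + (G x - g x))"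
    by (simp add: algebra_simps)
  also have "\<dots> \<le> N (\<lambda>x. F x - f x) + N (\<lambda>x. G x - g x)"
    using F(1) G(1) cf cg by (intro N_add_le continuous_intros)
  also have "\<dots> < ennreal (e/2) + ennreal (e/2)" using f(2) g(2) by (rule add_strict_mono)
  also have "\<dots> = ennreal e" using e by (simp add: ennreal_plus[symmetric] del: ennreal_plus)
  finally have "N (\<lambda>x. F x + G x - (f x + g x)) < ennreal e" .
  moreover have "norm (\<nu> (\<lambda>x. f x + g x) - (y + z)) < e"
    using f(3) g(3) norm_triangle_ineq[of "\<nu> f - y" "\<nu> g - z"] by (simp add: add[OF f(1) g(1)]
        algebra_simps)
  ultimately show "\<exists>g\<in>Cc. variation_integral \<nu> (\<lambda>x. ennreal (norm (F x + G x - g x))) < ennreal e \<and>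
      norm (\<nu> g - (y + z)) < e"
    using Cc_add[OF f(1) g(1)] unfolding N_def by (intro bexI[of _ "\<lambda>x. f x + g x"]) auto
qed

lemma has_integral_cmult:
  assumes F: "continuous_on UNIV F" "has_radon_integral \<nu> F z"
  shows "has_radon_integral \<nu> (\<lambda>x. c * F x) (c * z)"
  unfolding has_radon_integral_def
proof (intro allI impI)
  fix e :: real assume e: "e > 0"
  define d where "d = e / (norm c + 1)"
  have c1: "norm c + 1 > 0" by (simp add: add_nonneg_pos)
  have d: "d > 0" using e c1 by (simp add: d_def)
  have cd: "norm c * d < e"
  proof -
    have "d * (norm c + 1) = e" using c1 by (simp add: d_def)
    then show ?thesis using d by (simp add: algebra_simps)
  qed
  obtain f where f: "f \<in> Cc" "N (\<lambda>x. F x - f x) < ennreal d" "norm (\<nu> f - z) < d"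
    using has_integral_approx[OF F(2) d] by metis
  note cf = Cc_continuous[OF f(1), of UNIV]
  have "N (\<lambda>x. c * F x - c * f x) = N (\<lambda>x. c * (F x - f x))" by (simp add: algebra_simps)
  also have "\<dots> \<le> ennreal (norm c) * N (\<lambda>x. F x - f x)"
    using F(1) cf by (intro N_cmult_le continuous_intros)
  also have "\<dots> \<le> ennreal (norm c) * ennreal d" using f(2) by (intro mult_left_mono) auto
  also have "\<dots> < ennreal e" using cd d by (simp add: ennreal_mult[symmetric] ennreal_less_iff)
  finally have "N (\<lambda>x. c * F x - c * f x) < ennreal e" .
  moreover have "norm (\<nu> (\<lambda>x. c * f x) - c * z) < e"
  proof -
    have "norm (c * (\<nu> f - z)) \<le> norm c * d" unfolding norm_mult using f(3) by (intro
        mult_left_mono) auto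
    then show ?thesis using cd by (simp add: cmult[OF f(1)] algebra_simps)
  qed
  ultimately show "\<exists>g\<in>Cc. variation_integral \<nu> (\<lambda>x. ennreal (norm (c * F x - g x))) < ennreal e \<and>
      norm (\<nu> g - c * z) < e"
    using Cc_cmult[OF f(1), of c] unfolding N_def by (intro bexI[of _ "\<lambda>x. c * f x"]) auto
qed

text \<open>The outer value of \<open>\<nu>\<close> at the singleton, computed inside
  \<open>Cc\<close>. It replaces the definite description in \<open>mass\<close> until
  \<open>mass_eq\<close> identifies the two.\<close>

definition point_mass :: "'b \<Rightarrow> real" where
  "point_mass x = Inf {Re (\<nu> (\<lambda>y. of_real (b y))) | b. (\<lambda>y. complex_of_real (b y)) \<in> Cc \<and> (\<forall>y. 0 \<le> b
      y) \<and> b x = 1}"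

lemma point_mass_le_1:
  assumes "(\<lambda>y. complex_of_real (b y)) \<in> Cc" "\<And>y. 0 \<le> b y" "b x = 1"
  shows "point_mass x \<le> Re (\<nu> (\<lambda>y. of_real (b y)))"
  unfolding point_mass_def
  using assms by (intro cInf_lower bdd_belowI[of _ 0]) (auto intro: nonneg)

lemma point_mass_nonneg: "0 \<le> point_mass x"
proof -
  obtain b W where "(\<lambda>x. complex_of_real (b x)) \<in> Cc" "\<And>x. 0 \<le> b x" "x \<in> W" "\<And>x. x \<in> W \<Longrightarrow> b x = 1"
    using lc_point_bump[OF lcb open_UNIV, of x] by (metis UNIV_I)
  then show ?thesis unfolding point_mass_def by (intro cInf_greatest) (auto intro: nonneg)
qed

lemma point_mass_le:
  assumes b: "(\<lambda>y. complex_of_real (b y)) \<in> Cc" "\<And>y. 0 \<le> b y"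
  shows "point_mass x * b x \<le> Re (\<nu> (\<lambda>y. of_real (b y)))"
proof (cases "b x = 0")
  case True then show ?thesis using nonneg(1)[OF b] by simp
next
  case False
  then have bx: "b x > 0" using b(2)[of x] by simp
  have "(\<lambda>y. complex_of_real (b y / b x)) \<in> Cc" using Cc_cmult[OF b(1), of "1 / of_real (b x)"] by
      simp
  then have "point_mass x \<le> Re (\<nu> (\<lambda>y. of_real (b y / b x)))"
    using b(2) bx by (intro point_mass_le_1) auto
  also have "\<dots> = Re (\<nu> (\<lambda>y. of_real (b y))) / b x"
    using cmult[OF b(1), of "1 / of_real (b x)"] by (simp add: Re_divide_of_real)
  finally show ?thesis using bx by (simp add: field_simps)
qed

text \<open>A nearly optimal competitor \<open>c\<close> need not be supported in \<open>U\<close>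
  or have a plateau. By continuity a bump concentrated near \<open>x\<close> lies below a slight
  multiple of \<open>c\<close>, and monotonicity transfers near-optimality to it.\<close>

lemma point_mass_bump:
  assumes U: "open U" "x \<in> U" and e: "e > 0"
  obtains b W where "(\<lambda>y. complex_of_real (b y)) \<in> Cc" "supp (\<lambda>y. complex_of_real (b y)) \<subseteq> U"
      "\<And>y. 0 \<le> b y" "\<And>y. b y \<le> 1"
    "open W" "x \<in> W" "\<And>y. y \<in> W \<Longrightarrow> b y = 1" "continuous_on UNIV b"
    "Re (\<nu> (\<lambda>y. of_real (b y))) < point_mass x + e"
proof -
  have "\<exists>c. (\<lambda>y. complex_of_real (c y)) \<in> Cc \<and> (\<forall>y. 0 \<le> c y) \<and> c x = 1 \<and> Re (\<nu> (\<lambda>y. of_real (c y)))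
      < point_mass x + e/2"
  proof (rule ccontr)
    assume no: "\<not> ?thesis"
    obtain b W where b: "(\<lambda>x. complex_of_real (b x)) \<in> Cc" "\<And>x. 0 \<le> b x" "x \<in> W"
        "\<And>x. x \<in> W \<Longrightarrow> b x = 1"
      using lc_point_bump[OF lcb open_UNIV, of x] by (metis UNIV_I)
    define S where "S = {Re (\<nu> (\<lambda>y. of_real (b y))) | b. (\<lambda>y. complex_of_real (b y)) \<in> Cc \<and> (\<forall>y. 0 \<le>
        b y) \<and> b x = 1}"
    have "point_mass x + e/2 \<le> Inf S"
    proof (rule cInf_greatest)
      show "S \<noteq> {}" using b unfolding S_def by blast
      show "point_mass x + e/2 \<le> i" if "i \<in> S" for i
        using that no unfolding S_def by (auto simp: not_less)
    qed
    then show False using e by (simp add: S_def point_mass_def)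
  qed
  then obtain c where c: "(\<lambda>y. complex_of_real (c y)) \<in> Cc" "\<And>y. 0 \<le> c y" "c x = 1"
    "Re (\<nu> (\<lambda>y. of_real (c y))) < point_mass x + e/2" by blast
  define I where "I = Re (\<nu> (\<lambda>y. of_real (c y)))"
  have I: "I \<ge> 0" unfolding I_def by (rule nonneg[OF c(1,2)])
  define d where "d = e / (2 * (I + 1))"
  have d: "d > 0" using e I by (simp add: d_def)
  have cc: "continuous_on UNIV c" using continuous_on_Re[OF Cc_continuous[OF c(1)]] by simp
  \<comment> \<open>On \<open>V\<close> the function \<open>(1 + d) * c\<close> exceeds 1, hence
    dominates any bump supported there; \<open>d\<close> is small enough to cost less than
    \<open>e / 2\<close>.\<close>
  define V where "V = U \<inter> {y. 1 < (1 + d) * c y}"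
  have "open V" unfolding V_def using U cc by (intro open_Int open_Collect_less continuous_intros)
      auto
  moreover have "x \<in> V" using U c d by (simp add: V_def)
  ultimately obtain b W where b: "(\<lambda>y. complex_of_real (b y)) \<in> Cc"
      "supp (\<lambda>y. complex_of_real (b y)) \<subseteq> V" "\<And>y. 0 \<le> b y" "\<And>y. b y \<le> 1"
    "open W" "x \<in> W" "\<And>y. y \<in> W \<Longrightarrow> b y = 1" "continuous_on UNIV b"
    using lc_point_bump[OF lcb, of V x] by metis
  have "Re (\<nu> (\<lambda>y. of_real (b y))) \<le> Re (\<nu> (\<lambda>y. of_real ((1 + d) * c y)))"
  proof (rule mono[OF b(1)])
    show "(\<lambda>y. complex_of_real ((1 + d) * c y)) \<in> Cc" using Cc_cmult[OF c(1), of "of_real (1 + d)"]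
        by simp
    show "b y \<le> (1 + d) * c y" for y
    proof (cases "y \<in> V")
      case True then show ?thesis using b(4)[of y] by (simp add: V_def)
    next
      case False
      then have "complex_of_real (b y) = 0" using b(2) notin_supp by blast
      then show ?thesis using c(2)[of y] d by simp
    qed
  qed
  also have "\<dots> = (1 + d) * I" using cmult[OF c(1), of "of_real (1 + d)"] by (simp add: I_def)
  also have "\<dots> < point_mass x + e"
  proof -
    have "d * (I + 1) = e/2" using add_nonneg_pos[OF I zero_less_one] unfolding d_def by (simp add:
        divide_simps)
    then have "d * I < e/2" using d by (simp add: algebra_simps)
    then show ?thesis using c(4) by (simp add: I_def algebra_simps)
  qed
  finally have "Re (\<nu> (\<lambda>y. of_real (b y))) < point_mass x + e" .
  moreover have "supp (\<lambda>y. complex_of_real (b y)) \<subseteq> U" using b(2) by (auto simp: V_def)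
  ultimately show thesis using that b by metis
qed

text \<open>A function vanishing at \<open>x\<close> does not see the atom there. Near
  \<open>x\<close>, where \<open>k\<close> is smaller than \<open>d\<close>, there is room for a
  localised copy \<open>w * b\<close> of \<open>b\<close>: the modulus of \<open>k\<close> plus
  \<open>w * b\<close> is at most \<open>b + d * w0\<close>, and \<open>w * b\<close> alone has
  integral at least the point mass.\<close>

lemma norm_le_minus_point_mass:
  assumes b: "(\<lambda>y. complex_of_real (b y)) \<in> Cc" "\<And>y. 0 \<le> b y" "b x = 1"
    and k: "k \<in> Cc" "\<And>y. norm (k y) \<le> b y" "k x = 0"
  shows "norm (\<nu> k) \<le> Re (\<nu> (\<lambda>y. of_real (b y))) - point_mass x"
proof (rule field_le_epsilon)
  fix e :: real assume e: "e > 0"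
  obtain w0 W0 where w0: "(\<lambda>x. complex_of_real (w0 x)) \<in> Cc" "\<And>x. 0 \<le> w0 x" "\<And>x. w0 x \<le> 1" "open W0"
      "x \<in> W0" "\<And>x. x \<in> W0 \<Longrightarrow> w0 x = 1"
    using lc_point_bump[OF lcb open_UNIV, of x] by (metis UNIV_I)
  define I where "I = Re (\<nu> (\<lambda>y. of_real (w0 y)))"
  have I: "I \<ge> 0" unfolding I_def by (rule nonneg[OF w0(1,2)])
  define d where "d = e / (I + 1)"
  have d: "d > 0" using e I by (simp add: d_def)
  have ck: "continuous_on UNIV k" by (rule Cc_continuous[OF k(1)])
  have oV: "open (W0 \<inter> {y. norm (k y) < d})" using w0(4) ck by (intro open_Int open_Collect_less
      continuous_intros) auto
  have xV: "x \<in> W0 \<inter> {y. norm (k y) < d}" using w0(5) k(3) d by simp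
  obtain w W where w: "(\<lambda>x. complex_of_real (w x)) \<in> Cc"
      "supp (\<lambda>x. complex_of_real (w x)) \<subseteq> W0 \<inter> {y. norm (k y) < d}"
    "\<And>x. 0 \<le> w x" "\<And>x. w x \<le> 1" "x \<in> W" "\<And>x. x \<in> W \<Longrightarrow> w x = 1" "continuous_on UNIV w"
    by (rule lc_point_bump[OF lcb oV xV]) (rule that)
  have k': "(\<lambda>y. complex_of_real (norm (k y))) \<in> Cc" by (rule Cc_norm[OF k(1)])
  have bw: "(\<lambda>y. complex_of_real (w y * b y)) \<in> Cc"
    using Cc_mult[OF _ b(1), of "\<lambda>y. complex_of_real (w y)"] w(7) by (simp add:
        continuous_on_of_real)
  have dw: "(\<lambda>y. complex_of_real (d * w0 y)) \<in> Cc" using Cc_cmult[OF w0(1), of "of_real d"] by simp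
  have "norm (\<nu> k) + point_mass x * (w x * b x) \<le> Re (\<nu> (\<lambda>y. of_real (norm (k y)))) + Re (\<nu> (\<lambda>y.
      of_real (w y * b y)))"
    using w b by (intro add_mono norm_le k k' point_mass_le[OF bw]) auto
  also have "\<dots> = Re (\<nu> (\<lambda>y. of_real (norm (k y) + w y * b y)))" using add[OF k' bw] by simp
  also have "\<dots> \<le> Re (\<nu> (\<lambda>y. of_real (b y + d * w0 y)))"
  proof (rule mono)
    show "(\<lambda>y. complex_of_real (norm (k y) + w y * b y)) \<in> Cc" using Cc_add[OF k' bw] by simp
    show "(\<lambda>y. complex_of_real (b y + d * w0 y)) \<in> Cc" using Cc_add[OF b(1) dw] by simp
    show "norm (k y) + w y * b y \<le> b y + d * w0 y" for y
    proof (cases "y \<in> W0 \<inter> {y. norm (k y) < d}")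
      case True
      have "w y * b y \<le> b y" using w(3,4)[of y] b(2)[of y] by (intro mult_left_le_one_le) auto
      then show ?thesis using True w0(6)[of y] by auto
    next
      case False
      then have "complex_of_real (w y) = 0" using w(2) notin_supp by blast
      moreover have "0 \<le> d * w0 y" using w0(2)[of y] d by simp
      ultimately show ?thesis using k(2)[of y] by simp
    qed
  qed
  also have "\<dots> = Re (\<nu> (\<lambda>y. of_real (b y))) + d * I"
    using add[OF b(1) dw] cmult[OF w0(1), of "of_real d"] by (simp add: I_def)
  also have "d * I \<le> e"
  proof -
    have "d * (I + 1) = e" using I by (simp add: d_def)
    then show ?thesis using d by (simp add: algebra_simps)
  qed
  finally show "norm (\<nu> k) \<le> Re (\<nu> (\<lambda>y. of_real (b y))) - point_mass x + e"
    using w(5,6) b(3) by simp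
qed

text \<open>A bump of nearly minimal integral approximates the indicator: test functions below the
  error vanish at \<open>x\<close>, so \<open>norm_le_minus_point_mass\<close> applies to
  them.\<close>

lemma has_integral_point:
  "has_radon_integral \<nu> (indicator {x}) (of_real (point_mass x))"
  unfolding has_radon_integral_def
proof (intro allI impI)
  fix e :: real assume e: "e > 0"
  obtain b W where b: "(\<lambda>y. complex_of_real (b y)) \<in> Cc" "\<And>y. 0 \<le> b y" "x \<in> W" "\<And>y. y \<in> W \<Longrightarrow> b y = 1"
      "continuous_on UNIV b"
    "Re (\<nu> (\<lambda>y. of_real (b y))) < point_mass x + e/2"
    using point_mass_bump[OF open_UNIV UNIV_I, of "e/2" x] e by (metis half_gt_zero)
  have bx: "b x = 1" using b by simp
  \<comment> \<open>The error is lower semicontinuous although the indicator is not continuous: its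
    value is only lowered at a single point. It is thus its own majorant.\<close>
  let ?h = "\<lambda>y. ennreal (if y = x then 0 else b y)"
  have h: "?h = (\<lambda>y. ennreal (norm (indicator {x} y - complex_of_real (b y))))"
    using b(2) bx by (auto simp: indicator_def)
  have "variation_integral \<nu> ?h \<le> (SUP g\<in>{g \<in> Cc. \<forall>y. ennreal (norm (g y)) \<le> ?h y}. ennreal (norm (\<nu>
      g)))"
    unfolding variation_integral_def
  proof (rule INF_lower, intro CollectI conjI allI)
    fix a :: ennreal
    have "{y. a < ?h y} = {y. a < ennreal (b y)} \<inter> - {x}" by auto
    moreover have "open {y. a < ennreal (b y)}"
      using b(5) by (intro open_Collect_less continuous_intros continuous_on_ennreal)
    ultimately show "open {y. a < ?h y}" by (simp only:) (intro open_Int open_Compl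
        closed_singleton)
  qed simp
  also have "\<dots> \<le> ennreal (e/2)"
  proof (rule SUP_least)
    fix g assume "g \<in> {g \<in> Cc. \<forall>y. ennreal (norm (g y)) \<le> ?h y}"
    then have g: "g \<in> Cc" "\<And>y. ennreal (norm (g y)) \<le> ?h y" by auto
    have g': "norm (g y) \<le> (if y = x then 0 else b y)" for y
      using g(2)[of y] b(2)[of y] by (subst (asm) ennreal_le_iff) auto
    have gx: "g x = 0" using g'[of x] by simp
    have gb: "norm (g y) \<le> b y" for y using g'[of y] b(2)[of y] by (auto split: if_splits)
    show "ennreal (norm (\<nu> g)) \<le> ennreal (e/2)"
      using norm_le_minus_point_mass[OF b(1,2) bx g(1) gb gx] b(6) by (intro ennreal_leI) simp
  qed
  also have "\<dots> < ennreal e" using e by (simp add: ennreal_less_iff)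
  finally have "variation_integral \<nu> (\<lambda>y. ennreal (norm (indicator {x} y - complex_of_real (b y))))
      < ennreal e"
    by (simp only: h)
  moreover have "norm (\<nu> (\<lambda>y. of_real (b y)) - of_real (point_mass x)) < e"
  proof -
    have "norm (\<nu> (\<lambda>y. of_real (b y)) - of_real (point_mass x)) = \<bar>Re (\<nu> (\<lambda>y. of_real (b y))) -
        point_mass x\<bar>"
      by (subst real_valued[OF b(1)]) (simp only: of_real_diff[symmetric] norm_of_real)
    then show ?thesis using b(6) point_mass_le_1[OF b(1,2) bx] e by simp
  qed
  ultimately show "\<exists>g\<in>Cc. variation_integral \<nu> (\<lambda>y. ennreal (norm (indicator {x} y - g y))) < ennreal e \<and>
      norm (\<nu> g - of_real (point_mass x)) < e"
    using b(1) by (intro bexI[of _ "\<lambda>y. complex_of_real (b y)"]) auto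
qed

text \<open>The definite description in \<open>mass\<close> demands this, and the continuous theory
  above does not cover an indicator. An approximant \<open>g\<close> is cut by a bump
  \<open>w\<close> of nearly minimal integral: \<open>(1 - w) * g\<close> lies below the error
  majorant \<open>h\<close>, \<open>w * g\<close> is close to \<open>g x * w\<close>, and lower
  semicontinuity of \<open>h\<close> forces the integral of \<open>w\<close> times the distance of
  \<open>g x\<close> from 1 to be small.\<close>

lemma has_integral_point_unique:
  assumes z: "has_radon_integral \<nu> (indicator {x}) z"
  shows "z = of_real (point_mass x)"
proof -
  have "norm (z - of_real (point_mass x)) \<le> e" if e: "e > 0" for e
  proof -
    \<comment> \<open>The final decomposition has five terms, one of them bounded by
      \<open>2 * d\<close>.\<close>
    define d where "d = e / 6"
    have d: "d > 0" using e by (simp add: d_def)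
    obtain g where g: "g \<in> Cc" "variation_integral \<nu> (\<lambda>y. ennreal (norm (indicator {x} y - g y))) <
        ennreal d" "norm (\<nu> g - z) < d"
      using z d unfolding has_radon_integral_def by meson
    then obtain h where h: "\<And>a. open {y. a < h y}"
        "\<And>y. ennreal (norm (indicator {x} y - g y)) \<le> h y"
      "(SUP k\<in>{k \<in> Cc. \<forall>y. ennreal (norm (k y)) \<le> h y}. ennreal (norm (\<nu> k))) < ennreal d"
      unfolding variation_integral_def INF_less_iff by auto
    have hk: "norm (\<nu> k) < d" if "k \<in> Cc" "\<And>y. ennreal (norm (k y)) \<le> h y" for k
    proof -
      have "ennreal (norm (\<nu> k)) \<le> (SUP k\<in>{k \<in> Cc. \<forall>y. ennreal (norm (k y)) \<le> h y}. ennreal (norm (\<nu>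
          k)))"
        using that by (intro SUP_upper) auto
      then have "ennreal (norm (\<nu> k)) < ennreal d" using h(3) by (rule le_less_trans)
      then show ?thesis by (simp add: ennreal_less_iff)
    qed
    have cg: "continuous_on UNIV g" by (rule Cc_continuous[OF g(1)])
    define m where "m = point_mass x"
    have m: "m \<ge> 0" unfolding m_def by (rule point_mass_nonneg)
    define \<alpha> where "\<alpha> = norm (1 - g x)"
    have \<alpha>: "\<alpha> \<ge> 0" by (simp add: \<alpha>_def)
    define \<eta> where "\<eta> = d / (m + 2)"
    have \<eta>: "\<eta> > 0" using d m by (simp add: \<eta>_def)
    \<comment> \<open>Chosen so that \<open>\<kappa>\<close> times the integral of the bump, which
      is below \<open>m + \<kappa>\<close>, is at most \<open>d\<close>.\<close>
    define \<kappa> where "\<kappa> = min (min \<eta> 1) d"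
    have \<kappa>: "\<kappa> > 0" "\<kappa> * m \<le> d" "\<kappa> * (m + \<kappa>) \<le> d"
    proof -
      show "\<kappa> > 0" using \<eta> d by (simp add: \<kappa>_def)
      have "\<kappa> * m \<le> \<eta> * (m + 2)" using m \<eta> by (intro mult_mono) (auto simp: \<kappa>_def)
      then show "\<kappa> * m \<le> d" using m by (simp add: \<eta>_def)
      have "\<kappa> * (m + \<kappa>) \<le> \<eta> * (m + 2)" using m \<eta> d by (intro mult_mono) (auto simp: \<kappa>_def)
      then show "\<kappa> * (m + \<kappa>) \<le> d" using m by (simp add: \<eta>_def)
    qed
    \<comment> \<open>Here \<open>g\<close> is nearly constant and \<open>h\<close> stays above
      \<open>\<alpha> - \<kappa>\<close>. If \<open>\<alpha> \<le> \<kappa>\<close>, the second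
      condition is dropped: \<open>ennreal\<close> truncates the bound to 0, and the strict
      inequality could fail.\<close>
    define V where "V = {y. norm (g y - g x) < \<kappa>} \<inter> (if \<alpha> \<le> \<kappa> then UNIV else {y. ennreal (\<alpha> - \<kappa>) < h
        y})"
    have "open V" 
    proof -
      have "open {y. norm (g y - g x) < \<kappa>}" using cg by (intro open_Collect_less continuous_intros)
      then show ?thesis unfolding V_def using h(1) by (intro open_Int) auto
    qed
    moreover have "x \<in> V"
    proof -
      have "ennreal \<alpha> \<le> h x" using h(2)[of x] by (simp add: \<alpha>_def)
      then have "ennreal (\<alpha> - \<kappa>) < h x" if "\<kappa> < \<alpha>"
        using \<kappa>(1) that by (intro less_le_trans[OF _ \<open>ennreal \<alpha> \<le> h x\<close>]) (simp add:
            ennreal_less_iff)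
      then show ?thesis using \<kappa>(1) by (auto simp: V_def)
    qed
    ultimately obtain w W where w: "(\<lambda>y. complex_of_real (w y)) \<in> Cc"
        "supp (\<lambda>y. complex_of_real (w y)) \<subseteq> V" "\<And>y. 0 \<le> w y" "\<And>y. w y \<le> 1"
      "x \<in> W" "\<And>y. y \<in> W \<Longrightarrow> w y = 1" "continuous_on UNIV w" "Re (\<nu> (\<lambda>y. of_real (w y))) < m + \<kappa>"
      using point_mass_bump[OF _ _ \<kappa>(1), of V x] unfolding m_def by metis
    have wx: "w x = 1" using w by simp
    have wV: "w y = 0" if "y \<notin> V" for y using that w(2) notin_supp[of y "\<lambda>y. complex_of_real (w y)"]
        by auto
    have wm: "m \<le> Re (\<nu> (\<lambda>y. of_real (w y)))" unfolding m_def by (rule point_mass_le_1[OF w(1,3)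
        wx])
    have cw: "continuous_on UNIV (\<lambda>y. complex_of_real (w y))" using w(7) by (intro
        continuous_intros)
    have a: "norm (\<nu> (\<lambda>y. complex_of_real (1 - w y) * g y)) < d"
    proof (rule hk)
      show "(\<lambda>y. complex_of_real (1 - w y) * g y) \<in> Cc" using w(7) by (intro Cc_mult g(1)
          continuous_intros)
      fix y
      have "norm (complex_of_real (1 - w y) * g y) \<le> norm (indicator {x} y - g y)"
      proof (cases "y = x")
        case True then show ?thesis using wx by simp
      next
        case False
        then show ?thesis unfolding norm_mult norm_of_real using w(3,4)[of y] by (simp add:
            mult_left_le_one_le)
      qed
      then show "ennreal (norm (complex_of_real (1 - w y) * g y)) \<le> h y"
        using h(2)[of y] ennreal_leI order_trans by blast
    qed
    have wg: "(\<lambda>y. complex_of_real (w y) * g y) \<in> Cc" by (intro Cc_mult g(1) cw)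
    have b: "norm (\<nu> (\<lambda>y. complex_of_real (w y) * g y) - g x * \<nu> (\<lambda>y. of_real (w y))) \<le> d"
    proof -
      have kw: "(\<lambda>y. complex_of_real (\<kappa> * w y)) \<in> Cc" using Cc_cmult[OF w(1), of "of_real \<kappa>"] by
          simp
      have "norm (\<nu> (\<lambda>y. complex_of_real (w y) * g y - g x * complex_of_real (w y))) \<le> Re (\<nu> (\<lambda>y.
          of_real (\<kappa> * w y)))"
      proof (intro norm_le Cc_diff wg Cc_cmult w(1) kw)
        fix y
        show "norm (complex_of_real (w y) * g y - g x * complex_of_real (w y)) \<le> \<kappa> * w y"
        proof (cases "y \<in> V")
          case True
          have "complex_of_real (w y) * g y - g x * complex_of_real (w y) = (g y - g x) *
              complex_of_real (w y)"
            by (simp add: algebra_simps)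
          then have "norm (complex_of_real (w y) * g y - g x * complex_of_real (w y)) = norm (g y -
              g x) * w y"
            using w(3)[of y] by (simp add: norm_mult)
          also have "\<dots> \<le> \<kappa> * w y" using True w(3)[of y] by (intro mult_right_mono) (auto simp:
              V_def)
          finally show ?thesis .
        next
          case False then show ?thesis using wV by simp
        qed
      qed
      also have "\<dots> = \<kappa> * Re (\<nu> (\<lambda>y. of_real (w y)))" using cmult[OF w(1), of "of_real \<kappa>"] by simp
      also have "\<dots> \<le> \<kappa> * (m + \<kappa>)" using w(8) \<kappa>(1) by (intro mult_left_mono) auto
      finally show ?thesis using \<kappa>(3) by (simp add: diff[OF wg Cc_cmult[OF w(1)]] cmult[OF w(1)])
    qed
    have c: "\<alpha> * Re (\<nu> (\<lambda>y. of_real (w y))) \<le> 2 * d"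
    proof (cases "\<alpha> \<le> \<kappa>")
      case True
      then have "\<alpha> * Re (\<nu> (\<lambda>y. of_real (w y))) \<le> \<kappa> * (m + \<kappa>)"
        using \<alpha> m wm w(8) by (intro mult_mono) auto
      then show ?thesis using \<kappa>(3) d by simp
    next
      case False
      have "norm (\<nu> (\<lambda>y. of_real (\<alpha> - \<kappa>) * complex_of_real (w y))) < d"
      proof (rule hk)
        show "(\<lambda>y. of_real (\<alpha> - \<kappa>) * complex_of_real (w y)) \<in> Cc" by (intro Cc_cmult w(1))
        fix y
        show "ennreal (norm (of_real (\<alpha> - \<kappa>) * complex_of_real (w y))) \<le> h y"
        proof (cases "y \<in> V")
          case True
          then have "ennreal (\<alpha> - \<kappa>) \<le> h y" using False by (auto simp: V_def)
          moreover have "norm (of_real (\<alpha> - \<kappa>) * complex_of_real (w y)) \<le> \<alpha> - \<kappa>"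
            unfolding norm_mult norm_of_real using False w(3,4)[of y] by (simp add:
                mult_right_le_one_le)
          ultimately show ?thesis using ennreal_leI order_trans by blast
        next
          case False then show ?thesis using wV by simp
        qed
      qed
      then have "\<bar>\<alpha> - \<kappa>\<bar> * norm (\<nu> (\<lambda>y. complex_of_real (w y))) < d"
        unfolding cmult[OF w(1)] norm_mult norm_of_real .
      moreover have "Re (\<nu> (\<lambda>y. complex_of_real (w y))) \<le> norm (\<nu> (\<lambda>y. complex_of_real (w y)))"
        by (rule complex_Re_le_cmod)
      ultimately have "(\<alpha> - \<kappa>) * Re (\<nu> (\<lambda>y. complex_of_real (w y))) < d"
        using False by (smt (verit) mult_left_mono)
      moreover have "\<kappa> * Re (\<nu> (\<lambda>y. complex_of_real (w y))) \<le> d"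
        using w(8) \<kappa>(1) by (intro order_trans[OF _ \<kappa>(3)] mult_left_mono) auto
      ultimately show ?thesis by (simp add: algebra_simps)
    qed
    let ?Iw = "\<nu> (\<lambda>y. complex_of_real (w y))"
    have Iw: "?Iw = of_real (Re ?Iw)" by (rule real_valued[OF w(1)])
    have wg': "(\<lambda>y. complex_of_real (1 - w y) * g y) \<in> Cc"
      using w(7) by (intro Cc_mult g(1) continuous_intros)
    have "\<nu> g = \<nu> (\<lambda>y. complex_of_real (1 - w y) * g y + complex_of_real (w y) * g y)"
      by (simp add: algebra_simps)
    then have "\<nu> g = \<nu> (\<lambda>y. complex_of_real (1 - w y) * g y) + \<nu> (\<lambda>y. complex_of_real (w y) * g y)"
      by (simp only: add[OF wg' wg])
    moreover have "norm ((g x - 1) * ?Iw) \<le> 2 * d"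
    proof -
      have "norm ((g x - 1) * ?Iw) = \<alpha> * \<bar>Re ?Iw\<bar>"
        unfolding norm_mult \<alpha>_def by (subst Iw) (simp add: norm_minus_commute)
      then show ?thesis using c m wm by simp
    qed
    moreover have "norm (?Iw - of_real m) \<le> d"
    proof -
      have "norm (?Iw - of_real m) = \<bar>Re ?Iw - m\<bar>"
        by (subst Iw) (simp only: of_real_diff[symmetric] norm_of_real)
      moreover have "\<kappa> \<le> d" by (simp add: \<kappa>_def)
      ultimately show ?thesis using w(8) wm by simp
    qed
    moreover have "z - of_real m = (z - \<nu> g) + \<nu> (\<lambda>y. complex_of_real (1 - w y) * g y)
       + (\<nu> (\<lambda>y. complex_of_real (w y) * g y) - g x * ?Iw) + (g x - 1) * ?Iw + (?Iw - of_real m)"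
      using calculation(1) by (simp add: algebra_simps)
    ultimately have "norm (z - of_real m) \<le> d + d + d + 2 * d + d"
      using a b g(3) by (smt (verit) norm_triangle_ineq norm_minus_commute)
    then show ?thesis by (simp add: d_def m_def)
  qed
  then have "norm (z - of_real (point_mass x)) \<le> 0" by (rule field_le_epsilon[of _ 0, simplified])
  then show ?thesis by simp
qed

lemma mass_eq: "mass \<nu> {x} = of_real (point_mass x)"
  unfolding mass_def radon_integral_def
  using has_integral_point has_integral_point_unique by (intro the_equality) auto

end

section \<open>Discrete and continuous parts\<close>

context positive_radon
begin

text \<open>One atom is separated from the rest by a bump that is 1 near it and 0 at all other
  points of the finite set; additivity does the rest.\<close>

lemma finite_sum_point_mass_le:
  assumes "finite X" "(\<lambda>y. complex_of_real (f y)) \<in> Cc" "\<And>y. 0 \<le> f y"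
  shows "(\<Sum>x\<in>X. point_mass x * f x) \<le> Re (\<nu> (\<lambda>y. of_real (f y)))"
  using assms
proof (induction X arbitrary: f rule: finite_induct)
  case empty
  then show ?case using nonneg(1) by simp
next
  case (insert x X)
  have "open (- X)" using insert.hyps finite_imp_closed by blast
  then obtain w W where w: "(\<lambda>y. complex_of_real (w y)) \<in> Cc"
      "supp (\<lambda>y. complex_of_real (w y)) \<subseteq> - X"
    "\<And>y. 0 \<le> w y" "\<And>y. w y \<le> 1" "x \<in> W" "\<And>y. y \<in> W \<Longrightarrow> w y = 1" "continuous_on UNIV w"
    using lc_point_bump[OF lcb, of "- X" x] insert.hyps by (metis ComplI)
  have wX: "w y = 0" if "y \<in> X" for y
    using that w(2) notin_supp[of y "\<lambda>y. complex_of_real (w y)"] by auto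
  have c1: "(\<lambda>y. complex_of_real (w y * f y)) \<in> Cc"
    using Cc_mult[OF _ insert.prems(1), of "\<lambda>y. complex_of_real (w y)"] w(7) by (simp add:
        continuous_on_of_real)
  have c2: "(\<lambda>y. complex_of_real ((1 - w y) * f y)) \<in> Cc"
    using Cc_diff[OF insert.prems(1) c1] by (simp add: algebra_simps)
  have "(\<Sum>y\<in>X. point_mass y * f y) = (\<Sum>y\<in>X. point_mass y * ((1 - w y) * f y))"
    using wX by (intro sum.cong) auto
  also have "\<dots> \<le> Re (\<nu> (\<lambda>y. of_real ((1 - w y) * f y)))"
    using insert.prems w by (intro insert.IH c2) auto
  finally have 1: "(\<Sum>y\<in>X. point_mass y * f y) \<le> Re (\<nu> (\<lambda>y. of_real ((1 - w y) * f y)))" .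
  have "point_mass x * f x = point_mass x * (w x * f x)" using w by simp
  also have "\<dots> \<le> Re (\<nu> (\<lambda>y. of_real (w y * f y)))"
    using insert.prems w by (intro point_mass_le[OF c1]) auto
  finally have 2: "point_mass x * f x \<le> Re (\<nu> (\<lambda>y. of_real (w y * f y)))" .
  have "\<nu> (\<lambda>y. of_real (f y)) = \<nu> (\<lambda>y. of_real (w y * f y) + of_real ((1 - w y) * f y))"
    by (simp add: algebra_simps)
  also have "\<dots> = \<nu> (\<lambda>y. of_real (w y * f y)) + \<nu> (\<lambda>y. of_real ((1 - w y) * f y))"
    by (rule add[OF c1 c2])
  finally show ?case using 1 2 insert.hyps by simp
qed

lemma point_mass_summable:
  assumes f: "f \<in> Cc"
  shows "(\<lambda>x. point_mass x * norm (f x)) summable_on UNIV"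
proof (rule nonneg_bdd_above_summable_on)
  show "bdd_above (sum (\<lambda>x. point_mass x * norm (f x)) ` {F. F \<subseteq> UNIV \<and> finite F})"
    using finite_sum_point_mass_le[OF _ Cc_norm[OF f]] by (intro bdd_aboveI) auto
qed (simp add: point_mass_nonneg)

lemma discrete_part_summable:
  assumes f: "f \<in> Cc"
  shows "(\<lambda>x. complex_of_real (point_mass x) * f x) summable_on UNIV"
proof (rule abs_summable_summable)
  show "(\<lambda>x. norm (complex_of_real (point_mass x) * f x)) summable_on UNIV"
    unfolding norm_mult norm_of_real abs_of_nonneg[OF point_mass_nonneg] by (rule
        point_mass_summable[OF f])
qed

lemma discrete_part_eq: "discrete_part \<nu> f = (\<Sum>\<^sub>\<infinity>x. complex_of_real (point_mass x) * f x)"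
  by (simp add: discrete_part_def mass_eq)

lemma discrete_part_real:
  assumes f: "(\<lambda>y. complex_of_real (f y)) \<in> Cc" "\<And>y. 0 \<le> f y"
  shows "discrete_part \<nu> (\<lambda>y. of_real (f y)) = of_real (\<Sum>\<^sub>\<infinity>x. point_mass x * f x)"
    and "(\<lambda>x. point_mass x * f x) summable_on UNIV"
    and "(\<Sum>\<^sub>\<infinity>x. point_mass x * f x) \<le> Re (\<nu> (\<lambda>y. of_real (f y)))"
proof -
  show s: "(\<lambda>x. point_mass x * f x) summable_on UNIV" using point_mass_summable[OF f(1)] f(2) by
      simp
  have "discrete_part \<nu> (\<lambda>y. of_real (f y)) = (\<Sum>\<^sub>\<infinity>x. complex_of_real (point_mass x * f x))"
    by (simp add: discrete_part_eq)
  also have "\<dots> = of_real (\<Sum>\<^sub>\<infinity>x. point_mass x * f x)"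
    by (rule infsumI[OF has_sum_bounded_linear[OF bounded_linear_of_real has_sum_infsum[OF s]]])
  finally show "discrete_part \<nu> (\<lambda>y. of_real (f y)) = of_real (\<Sum>\<^sub>\<infinity>x. point_mass x * f x)" .
  show "(\<Sum>\<^sub>\<infinity>x. point_mass x * f x) \<le> Re (\<nu> (\<lambda>y. of_real (f y)))"
    using s finite_sum_point_mass_le[OF _ f] by (intro infsum_le_finite_sums) auto
qed

lemma discrete_part_nonneg:
  assumes f: "(\<lambda>y. complex_of_real (f y)) \<in> Cc" "\<And>y. 0 \<le> f y"
  shows "discrete_part \<nu> (\<lambda>y. of_real (f y)) \<in> \<real>\<^sub>\<ge>\<^sub>0"
    and "continuous_part \<nu> (\<lambda>y. of_real (f y)) \<in> \<real>\<^sub>\<ge>\<^sub>0"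
    and "point_mass x * f x \<le> Re (discrete_part \<nu> (\<lambda>y. of_real (f y)))"
proof -
  note d = discrete_part_real[OF f]
  have "0 \<le> (\<Sum>\<^sub>\<infinity>x. point_mass x * f x)" by (intro infsum_nonneg) (simp add: point_mass_nonneg f)
  then show "discrete_part \<nu> (\<lambda>y. of_real (f y)) \<in> \<real>\<^sub>\<ge>\<^sub>0" by (simp add: d(1)
      complex_nonneg_Reals_iff)
  show "continuous_part \<nu> (\<lambda>y. of_real (f y)) \<in> \<real>\<^sub>\<ge>\<^sub>0"
    using d(3) nonneg(2)[OF f] by (simp add: continuous_part_def d(1) complex_nonneg_Reals_iff)
  have "(\<Sum>x\<in>{x}. point_mass x * f x) \<le> (\<Sum>\<^sub>\<infinity>x. point_mass x * f x)"
    by (intro finite_sum_le_infsum d(2)) (auto simp: point_mass_nonneg f)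
  then show "point_mass x * f x \<le> Re (discrete_part \<nu> (\<lambda>y. of_real (f y)))" by (simp add: d(1))
qed

lemma discrete_part_norm_le:
  assumes f: "f \<in> Cc"
  shows "norm (discrete_part \<nu> f) \<le> Re (\<nu> (\<lambda>y. of_real (norm (f y))))"
proof -
  have "norm (discrete_part \<nu> f) \<le> (\<Sum>\<^sub>\<infinity>x. norm (complex_of_real (point_mass x) * f x))"
    unfolding discrete_part_eq using point_mass_summable[OF f]
    by (intro norm_infsum_bound) (simp add: norm_mult point_mass_nonneg)
  also have "\<dots> = (\<Sum>\<^sub>\<infinity>x. point_mass x * norm (f x))" by (simp add: norm_mult point_mass_nonneg)
  also have "\<dots> \<le> Re (\<nu> (\<lambda>y. of_real (norm (f y))))"
    by (rule discrete_part_real(3)[OF Cc_norm[OF f]]) simp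
  finally show ?thesis .
qed

lemma positive_discrete_part: "positive_radon_measure (discrete_part \<nu>)"
proof -
  have "\<exists>C. \<forall>f\<in>Cc. \<forall>B. supp f \<subseteq> K \<and> (\<forall>x. norm (f x) \<le> B) \<longrightarrow> norm (discrete_part \<nu> f) \<le> C * B"
    if K: "compact K" for K
  proof -
    obtain C where C: "C > 0" "\<And>f B. f \<in> Cc \<Longrightarrow> supp f \<subseteq> K \<Longrightarrow> (\<And>x. norm (f x) \<le> B) \<Longrightarrow> norm (\<nu> f) \<le> C *
        B"
      using radon_bound[OF radon K] by metis
    have "norm (discrete_part \<nu> f) \<le> C * B" if f: "f \<in> Cc" "supp f \<subseteq> K" "\<forall>x. norm (f x) \<le> B" for f B
    proof -
      have "norm (\<nu> (\<lambda>y. of_real (norm (f y)))) \<le> C * B"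
        using f by (intro C(2) Cc_norm) (auto simp: supp_def)
      then show ?thesis
        using discrete_part_norm_le[OF f(1)] complex_Re_le_cmod[of "\<nu> (\<lambda>y. of_real (norm (f y)))"]
            by linarith
    qed
    then show ?thesis by blast
  qed
  moreover have "discrete_part \<nu> (\<lambda>x. f x + g x) = discrete_part \<nu> f + discrete_part \<nu> g" if
      "f \<in> Cc" "g \<in> Cc" for f g
    unfolding discrete_part_eq distrib_left
    by (rule infsum_add[OF discrete_part_summable[OF that(1)] discrete_part_summable[OF that(2)]])
  moreover have "discrete_part \<nu> (\<lambda>x. c * f x) = c * discrete_part \<nu> f" if "f \<in> Cc" for c f
    using infsum_cmult_right[OF discrete_part_summable[OF that], of c]
    by (simp add: discrete_part_eq mult.left_commute)
  moreover have "discrete_part \<nu> f \<in> \<real>\<^sub>\<ge>\<^sub>0" if f: "f \<in> Cc" "\<forall>x. f x \<in> \<real>\<^sub>\<ge>\<^sub>0" for f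
  proof -
    have fr: "f = (\<lambda>x. of_real (Re (f x)))" using f(2) by (auto simp: complex_nonneg_Reals_iff
        complex_eq_iff)
    show ?thesis by (subst fr, rule discrete_part_nonneg(1)) (use f fr in \<open>auto simp:
        complex_nonneg_Reals_iff\<close>)
  qed
  ultimately show ?thesis unfolding positive_radon_measure_def radon_measure_def by simp
qed

lemma positive_continuous_part: "positive_radon_measure (continuous_part \<nu>)"
proof -
  interpret d: positive_radon "discrete_part \<nu>"
    by unfold_locales (rule lcb, rule positive_discrete_part)
  have "\<exists>C. \<forall>f\<in>Cc. \<forall>B. supp f \<subseteq> K \<and> (\<forall>x. norm (f x) \<le> B) \<longrightarrow> norm (continuous_part \<nu> f) \<le> C * B"
    if K: "compact K" for K
  proof -
    obtain C where C: "\<And>f B. f \<in> Cc \<Longrightarrow> supp f \<subseteq> K \<Longrightarrow> (\<And>x. norm (f x) \<le> B) \<Longrightarrow> norm (\<nu> f) \<le> C * B"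
      using radon_bound[OF radon K] by metis
    obtain D where D: "\<And>f B. f \<in> Cc \<Longrightarrow> supp f \<subseteq> K \<Longrightarrow> (\<And>x. norm (f x) \<le> B) \<Longrightarrow> norm (discrete_part \<nu> f) \<le>
        D * B"
      using radon_bound[OF d.radon K] by metis
    have "norm (continuous_part \<nu> f) \<le> (C + D) * B" if f: "f \<in> Cc" "supp f \<subseteq> K" "\<forall>x. norm (f x) \<le> B"
        for f B
      using norm_triangle_ineq4[of "\<nu> f" "discrete_part \<nu> f"] C[of f B] D[of f B] f
      by (simp add: continuous_part_def algebra_simps)
    then show ?thesis by blast
  qed
  moreover have "continuous_part \<nu> f \<in> \<real>\<^sub>\<ge>\<^sub>0" if f: "f \<in> Cc" "\<forall>x. f x \<in> \<real>\<^sub>\<ge>\<^sub>0" for f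
  proof -
    have fr: "f = (\<lambda>x. of_real (Re (f x)))" using f(2) by (auto simp: complex_nonneg_Reals_iff
        complex_eq_iff)
    show ?thesis by (subst fr, rule discrete_part_nonneg(2)) (use f fr in \<open>auto simp:
        complex_nonneg_Reals_iff\<close>)
  qed
  ultimately show ?thesis unfolding positive_radon_measure_def radon_measure_def
    by (simp add: continuous_part_def add cmult d.add d.cmult algebra_simps)
qed

text \<open>The absence of atoms in quantitative form: a nearly optimal bump has
  \<open>\<nu>\<close>-integral below the point mass plus \<open>e\<close>, and the discrete part
  already absorbs the point mass.\<close>

lemma continuous_part_small_bump:
  assumes e: "e > 0"
  obtains b W where "(\<lambda>y. complex_of_real (b y)) \<in> Cc" "\<And>y. 0 \<le> b y" "open W" "x \<in> W"
      "\<And>y. y \<in> W \<Longrightarrow> b y = 1"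
    "Re (continuous_part \<nu> (\<lambda>y. of_real (b y))) < e"
proof -
  obtain b W where b: "(\<lambda>y. complex_of_real (b y)) \<in> Cc" "\<And>y. 0 \<le> b y" "open W" "x \<in> W"
      "\<And>y. y \<in> W \<Longrightarrow> b y = 1"
    "Re (\<nu> (\<lambda>y. of_real (b y))) < point_mass x + e"
    using point_mass_bump[OF open_UNIV UNIV_I e, of x] by metis
  have "point_mass x * b x \<le> Re (discrete_part \<nu> (\<lambda>y. of_real (b y)))" by (rule
      discrete_part_nonneg(3)[OF b(1,2)])
  then have "Re (continuous_part \<nu> (\<lambda>y. of_real (b y))) < e" using b by (simp add:
      continuous_part_def)
  with b(1-5) that show thesis by metis
qed

end

section \<open>Measures supported on a set of finite local complexity\<close>

text \<open>Subtracting a fixed point of \<open>L\<close> embeds the intersection into finitely many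
  differences.\<close>

lemma flc_finite_Int_compact:
  fixes L :: "'a::topological_ab_group_add set"
  assumes L: "finite_local_complexity L" and K: "compact K"
  shows "finite (L \<inter> K)"
proof (cases "L = {}")
  case False
  then obtain x0 where x0: "x0 \<in> L" by blast
  have "finite ({x - y | x y. x \<in> L \<and> y \<in> L} \<inter> (\<lambda>x. x + - x0) ` K)"
    using L compact_translation_image[OF K] unfolding finite_local_complexity_def by blast
  moreover have "(\<lambda>x. x - x0) ` (L \<inter> K) \<subseteq> {x - y | x y. x \<in> L \<and> y \<in> L} \<inter> (\<lambda>x. x + - x0) ` K"
    using x0 by auto
  ultimately have "finite ((\<lambda>x. x - x0) ` (L \<inter> K))" by (rule finite_subset[rotated])
  then show ?thesis by (rule finite_imageD) (auto simp: inj_on_def)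
qed simp

lemma flc_subset_closed:
  fixes L :: "'a::{topological_ab_group_add, t2_space} set"
  assumes lc: "locally compact (UNIV :: 'a set)" and L: "finite_local_complexity L" and S: "S \<subseteq> L"
  shows "closed S"
  unfolding closed_def
proof (subst open_subopen, intro ballI)
  fix x assume x: "x \<in> - S"
  obtain V K where V: "open V" "compact K" "x \<in> V" "V \<subseteq> K"
    using lc_point_nbhd[OF lc open_UNIV UNIV_I] by metis
  have "finite (S \<inter> K)" 
    by (rule finite_subset[OF _ flc_finite_Int_compact[OF L V(2)]]) (use S in auto)
  then have "open (V - (S \<inter> K))" using V(1) by (intro open_Diff finite_imp_closed)
  then show "\<exists>T. open T \<and> x \<in> T \<and> T \<subseteq> - S"
    using V x by (intro exI[of _ "V - (S \<inter> K)"]) auto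
qed

locale flc_measure = haar \<theta> for \<theta> :: "'a::{topological_ab_group_add, t2_space} measure" +
  fixes \<gamma> :: "'a functional" and \<nu> :: "'a pontryagin_dual functional" and \<Lambda> :: "'a set"
  assumes radon_\<gamma>: "radon_measure \<gamma>" and Fourier: "is_Fourier_transform \<theta> \<gamma> \<nu>"
    and flc: "finite_local_complexity \<Lambda>" and supp_\<gamma>: "measure_support \<gamma> \<subseteq> \<Lambda>"
begin

text \<open>The support hypothesis directly handles functions vanishing near
  \<open>\<Lambda>\<close>; here vanishing on \<open>\<Lambda>\<close> suffices. Only finitely many
  points of \<open>\<Lambda>\<close> meet \<open>supp h\<close>. Near them \<open>h\<close> is
  small, and this part is negligible by the bound on a fixed compact set; the rest is supported away
  from the support of \<open>\<gamma>\<close>.\<close>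

lemma \<gamma>_eq_0:
  assumes h: "h \<in> Cc" "\<And>x. x \<in> \<Lambda> \<Longrightarrow> h x = 0"
  shows "\<gamma> h = 0"
proof -
  obtain C where C: "C > 0" "\<And>f B. f \<in> Cc \<Longrightarrow> supp f \<subseteq> supp h \<Longrightarrow> (\<And>x. norm (f x) \<le> B) \<Longrightarrow> norm (\<gamma> f) \<le> C
      * B"
    using radon_bound[OF radon_\<gamma> Cc_compact[OF h(1)]] by metis
  have "norm (\<gamma> h) \<le> e" if e: "e > 0" for e
  proof -
    define d where "d = e / C"
    have d: "d > 0" using e C by (simp add: d_def)
    have ch: "continuous_on UNIV h" by (rule Cc_continuous[OF h(1)])
    have fin: "finite (\<Lambda> \<inter> supp h)" by (rule flc_finite_Int_compact[OF flc Cc_compact[OF h(1)]])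
    have "open {x. norm (h x) < d}" using ch by (intro open_Collect_less continuous_intros)
    moreover have "\<Lambda> \<inter> supp h \<subseteq> {x. norm (h x) < d}" using h(2) d by auto
    ultimately obtain b W where b: "(\<lambda>x. complex_of_real (b x)) \<in> Cc"
        "supp (\<lambda>x. complex_of_real (b x)) \<subseteq> {x. norm (h x) < d}"
      "\<And>x. 0 \<le> b x" "\<And>x. b x \<le> 1" "open W" "\<Lambda> \<inter> supp h \<subseteq> W" "\<And>x. x \<in> W \<Longrightarrow> b x = 1"
          "continuous_on UNIV b"
      using lc_bump[OF lc finite_imp_compact[OF fin]] by metis
    have h1: "(\<lambda>x. complex_of_real (b x) * h x) \<in> Cc" and h2:
        "(\<lambda>x. complex_of_real (1 - b x) * h x) \<in> Cc"
      using b(8) by (auto intro!: Cc_mult h(1) continuous_intros simp del: of_real_diff)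
    have "supp (\<lambda>x. complex_of_real (1 - b x) * h x) \<subseteq> supp h - W"
    proof (rule supp_subset)
      show "closed (supp h - W)" using b(5) by (auto simp: supp_def)
    qed (use b(7) notin_supp[of _ h] in auto)
    then have "supp (\<lambda>x. complex_of_real (1 - b x) * h x) \<inter> measure_support \<gamma> = {}" using b(6)
        supp_\<gamma> by blast
    then have 1: "\<gamma> (\<lambda>x. complex_of_real (1 - b x) * h x) = 0"
      by (rule measure_support_disjoint_imp_zero[OF lc radon_\<gamma> h2])
    have 2: "norm (\<gamma> (\<lambda>x. complex_of_real (b x) * h x)) \<le> C * d"
    proof (rule C(2)[OF h1])
      show "supp (\<lambda>x. complex_of_real (b x) * h x) \<subseteq> supp h"
        by (rule supp_mult_subset)
      fix x show "norm (complex_of_real (b x) * h x) \<le> d"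
      proof (cases "norm (h x) < d")
        case True
        then have "norm (complex_of_real (b x) * h x) \<le> norm (h x)"
          unfolding norm_mult norm_of_real using b(3,4)[of x] by (intro mult_left_le_one_le) auto
        then show ?thesis using True by simp
      next
        case False
        then have "complex_of_real (b x) = 0" using b(2) by (intro notin_supp[of x
            "\<lambda>x. complex_of_real (b x)"]) auto
        then show ?thesis using d by simp
      qed
    qed
    have "\<gamma> h = \<gamma> (\<lambda>x. complex_of_real (b x) * h x + complex_of_real (1 - b x) * h x)" by (simp add:
        algebra_simps)
    also have "\<dots> = \<gamma> (\<lambda>x. complex_of_real (b x) * h x)" using radon_add[OF radon_\<gamma> h1 h2] 1 by simp
    finally show ?thesis using 2 C(1) by (simp add: d_def)
  qed
  then have "norm (\<gamma> h) \<le> 0" by (rule field_le_epsilon[of _ 0, simplified])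
  then show ?thesis by simp
qed

text \<open>For \<open>x\<close> in \<open>\<Lambda>\<close> the value of \<open>\<gamma>\<close> on
  this function plays the role of the atom of \<open>\<gamma>\<close> at \<open>x\<close>; by
  \<open>\<gamma>_eq_0\<close> it does not depend on the choice.\<close>

definition atom_bump :: "'a \<Rightarrow> 'a \<Rightarrow> complex" where
  "atom_bump x = (SOME b. b \<in> Cc \<and> b x = 1 \<and> (\<forall>y\<in>\<Lambda> - {x}. b y = 0))"

lemma atom_bump: "atom_bump x \<in> Cc" "atom_bump x x = 1" "y \<in> \<Lambda> \<Longrightarrow> y \<noteq> x \<Longrightarrow> atom_bump x y = 0"
proof -
  have "closed (\<Lambda> - {x})" by (rule flc_subset_closed[OF lc flc]) auto
  then have "open (- (\<Lambda> - {x}))" by (rule open_Compl)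
  then obtain b W where b: "(\<lambda>y. complex_of_real (b y)) \<in> Cc"
      "supp (\<lambda>y. complex_of_real (b y)) \<subseteq> - (\<Lambda> - {x})"
    "x \<in> W" "\<And>y. y \<in> W \<Longrightarrow> b y = 1"
    using lc_point_bump[OF lc, of "- (\<Lambda> - {x})" x] by (metis ComplI DiffD2 singletonI)
  have "complex_of_real (b y) = 0" if "y \<in> \<Lambda> - {x}" for y
    using that b(2) by (intro notin_supp[of y "\<lambda>y. complex_of_real (b y)"]) auto
  then have "\<exists>b. b \<in> Cc \<and> b x = 1 \<and> (\<forall>y\<in>\<Lambda> - {x}. b y = 0)"
    using b by (intro exI[of _ "\<lambda>y. complex_of_real (b y)"]) auto
  from someI_ex[OF this] show "atom_bump x \<in> Cc" "atom_bump x x = 1"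
      "y \<in> \<Lambda> \<Longrightarrow> y \<noteq> x \<Longrightarrow> atom_bump x y = 0"
    unfolding atom_bump_def by auto
qed

text \<open>\<open>h\<close> and its interpolation by \<open>atom_bump\<close> functions agree on
  \<open>\<Lambda>\<close>, so \<open>\<gamma>_eq_0\<close> applies to the difference.\<close>

lemma \<gamma>_eq_sum:
  assumes h: "h \<in> Cc" and F: "finite F" "F \<subseteq> \<Lambda>" "\<And>x. x \<in> \<Lambda> - F \<Longrightarrow> h x = 0"
  shows "\<gamma> h = (\<Sum>x\<in>F. h x * \<gamma> (atom_bump x))"
proof -
  have c: "(\<lambda>y. \<Sum>x\<in>F. h x * atom_bump x y) \<in> Cc" by (intro Cc_sum Cc_cmult atom_bump)
  have "\<gamma> (\<lambda>y. h y - (\<Sum>x\<in>F. h x * atom_bump x y)) = 0"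
  proof (rule \<gamma>_eq_0)
    show "(\<lambda>y. h y - (\<Sum>x\<in>F. h x * atom_bump x y)) \<in> Cc" by (intro Cc_diff h c)
    fix y assume y: "y \<in> \<Lambda>"
    have "(\<Sum>x\<in>F. h x * atom_bump x y) = (\<Sum>x\<in>F. if x = y then h y else 0)"
      using atom_bump(2) atom_bump(3)[OF y] by (intro sum.cong) auto
    also have "\<dots> = h y" using F y by (cases "y \<in> F") auto
    finally show "h y - (\<Sum>x\<in>F. h x * atom_bump x y) = 0" by simp
  qed
  then have "\<gamma> h = \<gamma> (\<lambda>y. \<Sum>x\<in>F. h x * atom_bump x y)" by (simp add: radon_diff[OF radon_\<gamma> h c])
  also have "\<dots> = (\<Sum>x\<in>F. \<gamma> (\<lambda>y. h x * atom_bump x y))" by (intro radon_sum radon_\<gamma> Cc_cmult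
      atom_bump)
  finally show ?thesis by (simp add: radon_cmult[OF radon_\<gamma> atom_bump(1)])
qed

section \<open>Cross-correlations, their transforms and uniform bounds\<close>

sublocale nu: positive_radon \<nu>
  by unfold_locales (rule dual_locally_compact, use Fourier in \<open>simp add: is_Fourier_transform_def\<close>)

definition cross :: "('a \<Rightarrow> complex) \<Rightarrow> ('a \<Rightarrow> complex) \<Rightarrow> 'a \<Rightarrow> complex" where
  "cross f g = convolve_functions \<theta> f (tilde g)"

lemma cross_Cc: "f \<in> Cc \<Longrightarrow> g \<in> Cc \<Longrightarrow> cross f g \<in> Cc"
  unfolding cross_def by (intro convolve_functions_Cc Cc_tilde)

lemma cross_integrable: "f \<in> Cc \<Longrightarrow> g \<in> Cc \<Longrightarrow> integrable \<theta> (\<lambda>t. f t * cnj (g (t - x)))"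
  using Cc_integrable[OF convolve_functions_integrand[OF _ Cc_tilde, of f g x]] by (simp add:
      tilde_def)

lemma cross_eq: "cross f g x = (LINT t|\<theta>. f t * cnj (g (t - x)))"
  by (simp add: cross_def convolve_functions_def tilde_def)

lemma \<gamma>_cross_add:
  assumes f: "f \<in> Cc" and g: "g \<in> Cc"
  shows "\<gamma> (cross (\<lambda>x. f x + c * g x) (\<lambda>x. f x + c * g x))
    = \<gamma> (cross f f) + cnj c * \<gamma> (cross f g) + c * \<gamma> (cross g f) + c * cnj c * \<gamma> (cross g g)"
proof -
  have "cross (\<lambda>x. f x + c * g x) (\<lambda>x. f x + c * g x)
    = (\<lambda>x. cross f f x + (cnj c * cross f g x + (c * cross g f x + (c * cnj c) * cross g g x)))"
  proof
    fix x
    have "cross (\<lambda>x. f x + c * g x) (\<lambda>x. f x + c * g x) x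
      = (LINT t|\<theta>. f t * cnj (f (t - x)) + (cnj c * (f t * cnj (g (t - x)))
        + (c * (g t * cnj (f (t - x))) + (c * cnj c) * (g t * cnj (g (t - x))))))"
      unfolding cross_eq by (simp add: algebra_simps)
    also have "\<dots> = cross f f x + (cnj c * cross f g x + (c * cross g f x + (c * cnj c) * cross g g
        x))"
      unfolding cross_eq
      by (subst Bochner_Integration.integral_add, (intro Bochner_Integration.integrable_add
          integrable_mult_right cross_integrable f g)+)+
        (simp only: integral_mult_right_zero)
    finally show "cross (\<lambda>x. f x + c * g x) (\<lambda>x. f x + c * g x) x
      = cross f f x + (cnj c * cross f g x + (c * cross g f x + (c * cnj c) * cross g g x))" .
  qed
  then show ?thesis
    using f g by (simp only: radon_add[OF radon_\<gamma>] radon_cmult[OF radon_\<gamma>] cross_Cc Cc_add Cc_cmult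
        add.assoc)
qed

text \<open>Polarisation: the defining relation of the Fourier transform covers only squares, and
  the four combinations \<open>f + c * g\<close> with \<open>c\<close> a fourth root of unity
  recover the sesquilinear form.\<close>

lemma has_integral_cross:
  assumes f: "f \<in> Cc" and g: "g \<in> Cc"
  shows "has_radon_integral \<nu> (\<lambda>\<xi>. inverse_Fourier \<theta> f \<xi> * cnj (inverse_Fourier \<theta> g \<xi>)) (\<gamma> (cross f
      g))"
proof -
  define P where "P c \<xi> = complex_of_real ((norm (inverse_Fourier \<theta> f \<xi> + c * inverse_Fourier \<theta> g
      \<xi>))\<^sup>2)" for c \<xi>
  define q where "q c = \<gamma> (cross (\<lambda>x. f x + c * g x) (\<lambda>x. f x + c * g x))" for c
  have cP: "continuous_on UNIV (P c)" for c
    unfolding P_def by (intro continuous_intros continuous_inverse_Fourier f g)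
  have hP: "has_radon_integral \<nu> (P c) (q c)" for c
  proof -
    have c: "(\<lambda>x. f x + c * g x) \<in> Cc" by (intro Cc_add Cc_cmult f g)
    have "P c = (\<lambda>\<xi>. of_real ((norm (inverse_Fourier \<theta> (\<lambda>x. f x + c * g x) \<xi>))\<^sup>2))"
      unfolding P_def by (simp add: inverse_Fourier_add inverse_Fourier_cmult f g Cc_cmult)
    then show ?thesis using Fourier c by (simp add: is_Fourier_transform_def q_def cross_def)
  qed
  have comb: "has_radon_integral \<nu> (\<lambda>\<xi>. 1/4 * P 1 \<xi> + (- 1/4 * P (- 1) \<xi> + (\<i>/4 * P \<i> \<xi> + - \<i>/4 * P (- \<i>) \<xi>)))
      (1/4 * q 1 + (- 1/4 * q (- 1) + (\<i>/4 * q \<i> + - \<i>/4 * q (- \<i>))))"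
    by (intro nu.has_integral_add nu.has_integral_cmult continuous_on_add continuous_on_mult
        continuous_on_const cP hP)
  have "(\<lambda>\<xi>. 1/4 * P 1 \<xi> + (- 1/4 * P (- 1) \<xi> + (\<i>/4 * P \<i> \<xi> + - \<i>/4 * P (- \<i>) \<xi>)))
      = (\<lambda>\<xi>. inverse_Fourier \<theta> f \<xi> * cnj (inverse_Fourier \<theta> g \<xi>))"
    unfolding P_def complex_norm_square by (rule ext) (simp add: algebra_simps)
  moreover have "1/4 * q 1 + (- 1/4 * q (- 1) + (\<i>/4 * q \<i> + - \<i>/4 * q (- \<i>))) = \<gamma> (cross f g)"
    unfolding q_def \<gamma>_cross_add[OF f g] by (simp add: algebra_simps)
  ultimately show ?thesis using comb by simp
qed

text \<open>Under the transform, modulating both factors shifts the argument to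
  \<open>\<xi> - \<psi>\<close>, and translating one of them contributes \<open>\<xi>(t)\<close>. On
  the group side both operations merely translate and modulate the cross-correlation, which is what
  makes the resulting integrals computable.\<close>

lemma cross_translate_modulate:
  assumes f: "f \<in> Cc" and g: "g \<in> Cc"
  shows "cross (\<lambda>s. cnj (eval_char \<psi> (s - t)) * f (s - t)) (\<lambda>s. cnj (eval_char \<psi> s) * g s)
    = (\<lambda>x. cnj (eval_char \<psi> (x - t)) * cross f g (x - t))"
proof
  fix x
  have "cross (\<lambda>s. cnj (eval_char \<psi> (s - t)) * f (s - t)) (\<lambda>s. cnj (eval_char \<psi> s) * g s) x
      = (LINT s|\<theta>. cnj (eval_char \<psi> (x - t)) * (f (s - t) * cnj (g ((s - t) - (x - t)))))"
    unfolding cross_eq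
  proof (rule Bochner_Integration.integral_cong[OF refl])
    fix s
    have "cnj (eval_char \<psi> (s - t)) * eval_char \<psi> (s - x) = eval_char \<psi> (- (s - t) + (s - x))"
      unfolding eval_char_add eval_char_uminus ..
    also have "- (s - t) + (s - x) = - (x - t)" by simp
    finally have "cnj (eval_char \<psi> (s - t)) * eval_char \<psi> (s - x) = cnj (eval_char \<psi> (x - t))"
      by (simp only: eval_char_uminus)
    then show "cnj (eval_char \<psi> (s - t)) * f (s - t) * cnj (cnj (eval_char \<psi> (s - x)) * g (s - x))
        = cnj (eval_char \<psi> (x - t)) * (f (s - t) * cnj (g ((s - t) - (x - t))))"
      by (simp add: mult_ac)
  qed
  also have "\<dots> = cnj (eval_char \<psi> (x - t)) * (LINT s|\<theta>. f (s - t) * cnj (g ((s - t) - (x - t))))"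
    by (rule integral_mult_right_zero)
  also have "(LINT s|\<theta>. f (s - t) * cnj (g ((s - t) - (x - t)))) = (LINT s|\<theta>. f s * cnj (g (s - (x -
      t))))"
  proof (rule integral_translate(2))
    show "(\<lambda>s. f s * cnj (g (s - (x - t)))) \<in> Cc"
      using convolve_functions_integrand[OF f Cc_tilde[OF g], of "x - t"] by (simp add: tilde_def)
  qed
  finally show "cross (\<lambda>s. cnj (eval_char \<psi> (s - t)) * f (s - t)) (\<lambda>s. cnj (eval_char \<psi> s) * g s) x
      = cnj (eval_char \<psi> (x - t)) * cross f g (x - t)" by (simp add: cross_eq)
qed

lemma has_integral_cross_translate:
  assumes f: "f \<in> Cc" and g: "g \<in> Cc"
  shows "has_radon_integral \<nu>
    (\<lambda>\<xi>. eval_char \<xi> t * (inverse_Fourier \<theta> f (\<xi> - \<psi>) * cnj (inverse_Fourier \<theta> g (\<xi> - \<psi>))))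
    (\<gamma> (\<lambda>x. cnj (eval_char \<psi> (x - t)) * cross f g (x - t)))"
proof -
  have m: "(\<lambda>s. cnj (eval_char \<psi> s) * h s) \<in> Cc" if "h \<in> Cc" for h
    using that by (intro Cc_mult continuous_intros eval_char_continuous)
  have "has_radon_integral \<nu>
    (\<lambda>\<xi>. inverse_Fourier \<theta> (\<lambda>s. cnj (eval_char \<psi> (s - t)) * f (s - t)) \<xi>
      * cnj (inverse_Fourier \<theta> (\<lambda>s. cnj (eval_char \<psi> s) * g s) \<xi>))
    (\<gamma> (cross (\<lambda>s. cnj (eval_char \<psi> (s - t)) * f (s - t)) (\<lambda>s. cnj (eval_char \<psi> s) * g s)))"
    using Cc_translate(1)[OF m[OF f], of t] m[OF g] by (intro has_integral_cross)
  then show ?thesis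
    unfolding cross_translate_modulate[OF f g]
    by (simp add: inverse_Fourier_translate[OF m[OF f]] inverse_Fourier_modulate mult.assoc)
qed

text \<open>Uniform in \<open>\<psi>\<close> because the integral is \<open>\<gamma>\<close> at a
  modulation of \<open>cross f f\<close>, and modulation enlarges neither support nor sup
  norm.\<close>

lemma N_square_le:
  assumes f: "f \<in> Cc"
  obtains B where "B > 0" "\<And>\<psi>. nu.N (\<lambda>\<xi>. of_real ((norm (inverse_Fourier \<theta> f (\<xi> - \<psi>)))\<^sup>2)) \<le> ennreal
      B"
proof -
  have H: "cross f f \<in> Cc" by (rule cross_Cc[OF f f])
  obtain C where C: "C > 0" "\<And>h B. h \<in> Cc \<Longrightarrow> supp h \<subseteq> supp (cross f f) \<Longrightarrow> (\<And>x. norm (h x) \<le> B) \<Longrightarrow> norm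
      (\<gamma> h) \<le> C * B"
    using radon_bound[OF radon_\<gamma> Cc_compact[OF H]] by metis
  obtain M where M: "M > 0" "\<And>x. norm (cross f f x) \<le> M" using Cc_bounded[OF H] by metis
  have "nu.N (\<lambda>\<xi>. of_real ((norm (inverse_Fourier \<theta> f (\<xi> - \<psi>)))\<^sup>2)) \<le> ennreal (C * M)" for \<psi>
  proof -
    let ?h = "\<lambda>x. cnj (eval_char \<psi> x) * cross f f x"
    have "has_radon_integral \<nu> (\<lambda>\<xi>. of_real ((norm (inverse_Fourier \<theta> f (\<xi> - \<psi>)))\<^sup>2)) (\<gamma> ?h)"
      unfolding complex_norm_square using has_integral_cross_translate[OF f f, of 0 \<psi>] by simp
    then have "nu.N (\<lambda>\<xi>. of_real ((norm (inverse_Fourier \<theta> f (\<xi> - \<psi>)))\<^sup>2)) \<le> ennreal (norm (\<gamma> ?h))"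
      by (intro nu.N_le_has_integral)
        (auto intro!: continuous_intros continuous_on_compose2[OF continuous_inverse_Fourier[OF f,
            of UNIV]] continuous_on_shifts)
    also have "\<dots> \<le> ennreal (C * M)"
    proof (intro ennreal_leI C(2))
      show "?h \<in> Cc" by (intro Cc_mult H continuous_intros eval_char_continuous)
      show "supp ?h \<subseteq> supp (cross f f)"
        by (rule supp_mult_subset)
      show "norm (?h x) \<le> M" for x using M(2) by (simp add: norm_mult)
    qed
    finally show ?thesis .
  qed
  then show thesis using C M that[of "C * M"] by simp
qed

text \<open>
  Testing \<open>\<gamma>\<close> with a translate of \<open>f * tilde f\<close>, \<open>f\<close> supported so close to \<open>0\<close> that only one point
  of \<open>\<Lambda>\<close> is seen, bounds the atoms of \<open>\<gamma>\<close>: on the Fourier side a translation is multiplication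
  by a function of modulus \<open>1\<close>.
\<close>

lemma atoms_bounded:
  obtains A where "A > 0" "\<And>x. x \<in> \<Lambda> \<Longrightarrow> norm (\<gamma> (atom_bump x)) \<le> A"
proof -
  obtain V L where V: "open V" "compact L" "(0::'a) \<in> V" "V \<subseteq> L"
    using lc_point_nbhd[OF lc open_UNIV UNIV_I] by metis
  have "finite ({x - y | x y. x \<in> \<Lambda> \<and> y \<in> \<Lambda>} \<inter> L)" using flc V(2) by (simp add:
      finite_local_complexity_def)
  \<comment> \<open>With the finitely many nonzero differences removed, this neighbourhood of 0
    meets the difference set of \<open>\<Lambda>\<close> at most in 0, and differences of elements
    of \<open>U\<close> stay inside it.\<close>
  then have o1: "open (V - ({x - y | x y. x \<in> \<Lambda> \<and> y \<in> \<Lambda>} \<inter> L - {0}))"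
    using V(1) by (intro open_Diff finite_imp_closed) auto
  have o2: "0 \<in> V - ({x - y | x y. x \<in> \<Lambda> \<and> y \<in> \<Lambda>} \<inter> L - {0})" using V by auto
  obtain U where U: "open U" "0 \<in> U" "\<And>x y. x \<in> U \<Longrightarrow> y \<in> U \<Longrightarrow> x - y \<in> V - ({x - y | x y. x \<in> \<Lambda> \<and> y \<in>
      \<Lambda>} \<inter> L - {0})"
    by (rule group_nbhd_half[OF o1 o2]) (rule that)
  obtain b W where b: "(\<lambda>x. complex_of_real (b x)) \<in> Cc" "supp (\<lambda>x. complex_of_real (b x)) \<subseteq> U"
    "\<And>x. 0 \<le> b x" "(0::'a) \<in> W" "\<And>x. x \<in> W \<Longrightarrow> b x = 1"
    using lc_point_bump[OF lc U(1,2)] by metis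
  define f where "f x = complex_of_real (b x)" for x
  have f: "f \<in> Cc" unfolding f_def[abs_def] by (rule b(1))
  have fU: "x \<in> U" if "f x \<noteq> 0" for x
    using that b(2) notin_supp[of x "\<lambda>x. complex_of_real (b x)"] by (auto simp: f_def)
  define H where "H = cross f f"
  have H: "H \<in> Cc" unfolding H_def by (rule cross_Cc[OF f f])
  have H0: "H 0 \<noteq> 0"
  proof -
    have "(\<lambda>x. complex_of_real (b x * b x)) \<in> Cc"
      using Cc_mult2[OF Cc_continuous[OF b(1)] b(1)] by simp
    then have "0 < (LINT x|\<theta>. b x * b x)" using b by (intro integral_pos[of _ 0]) auto
    moreover have "H 0 = of_real (LINT x|\<theta>. b x * b x)"
      unfolding H_def cross_eq f_def by (simp flip: of_real_mult)
    ultimately show ?thesis by simp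
  qed
  have Hz: "H (y - x) = 0" if xy: "x \<in> \<Lambda>" "y \<in> \<Lambda>" "y \<noteq> x" for x y
  proof -
    have "f t * cnj (f (t - (y - x))) = 0" for t
    proof (rule ccontr)
      assume "\<not> ?thesis"
      then have "t \<in> U" "t - (y - x) \<in> U" using fU by auto
      then have "y - x \<in> V - ({x - y | x y. x \<in> \<Lambda> \<and> y \<in> \<Lambda>} \<inter> L - {0})" using U(3)[of t
          "t - (y - x)"] by simp
      then show False using xy V(4) by auto
    qed
    then have "(\<lambda>t. f t * cnj (f (t - (y - x)))) = (\<lambda>t. 0)" by blast
    then show ?thesis unfolding H_def cross_eq by (simp only:) simp
  qed
  have "norm (\<gamma> (atom_bump x)) \<le> norm (\<gamma> H) / norm (H 0)" if x: "x \<in> \<Lambda>" for x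
  proof -
    let ?S = "\<lambda>\<xi>. (norm (inverse_Fourier \<theta> f \<xi>))\<^sup>2"
    have cS: "continuous_on UNIV (\<lambda>\<xi>. complex_of_real (?S \<xi>))" by (intro continuous_intros
        continuous_inverse_Fourier f)
    have i0: "has_radon_integral \<nu> (\<lambda>\<xi>. of_real (?S \<xi>)) (\<gamma> H)"
      unfolding complex_norm_square H_def using has_integral_cross[OF f f] by simp
    have ix: "has_radon_integral \<nu> (\<lambda>\<xi>. eval_char \<xi> x * of_real (?S \<xi>)) (\<gamma> (\<lambda>y. H (y - x)))"
      unfolding complex_norm_square H_def using has_integral_cross_translate[OF f f, of x 0] by simp
    have "ennreal (norm (\<gamma> (\<lambda>y. H (y - x)))) \<le> nu.N (\<lambda>\<xi>. eval_char \<xi> x * of_real (?S \<xi>))"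
      by (rule nu.has_integral_norm_le[OF _ ix]) (intro continuous_on_mult continuous_on_eval_dual
          cS)
    also have "\<dots> \<le> nu.N (\<lambda>\<xi>. of_real (?S \<xi>))" by (rule nu.N_mono) (simp add: norm_mult)
    also have "\<dots> \<le> ennreal (norm (\<gamma> H))" by (rule nu.N_le_has_integral[OF cS _ i0]) simp
    finally have "norm (\<gamma> (\<lambda>y. H (y - x))) \<le> norm (\<gamma> H)" by simp
    moreover have "\<gamma> (\<lambda>y. H (y - x)) = (\<Sum>y\<in>{x}. H (y - x) * \<gamma> (atom_bump y))"
      using x Hz by (intro \<gamma>_eq_sum Cc_translate H) auto
    ultimately show ?thesis using H0 by (simp add: norm_mult field_simps)
  qed
  then show thesis using that[of "norm (\<gamma> H) / norm (H 0) + 1"] by (smt (verit) divide_nonneg_nonneg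
      norm_ge_zero)
qed

end

section \<open>A Wiener-type lemma\<close>

text \<open>The unit disc is cut into squares of side \<open>1 / n\<close>, and \<open>k s\<close>
  records the square of each \<open>\<phi> x s\<close>. The default \<open>(0, 0)\<close> off
  \<open>X\<close> keeps the range finite.\<close>

lemma finite_cells:
  fixes \<phi> :: "'i \<Rightarrow> 's \<Rightarrow> complex"
  assumes X: "finite X" and \<phi>: "\<And>x s. x \<in> X \<Longrightarrow> norm (\<phi> x s) \<le> 1" and e: "e > 0"
  obtains k :: "'s \<Rightarrow> 'i \<Rightarrow> int \<times> int" where "finite (range k)"
    "\<And>s s' x. k s = k s' \<Longrightarrow> x \<in> X \<Longrightarrow> dist (\<phi> x s) (\<phi> x s') < e"
proof -
  obtain n :: nat where n: "2 / e < real n" using reals_Archimedean2 by blast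
  have n0: "real n > 0" using n e by (smt (verit) divide_nonneg_nonneg)
  define k where "k s x = (if x \<in> X then (\<lfloor>real n * Re (\<phi> x s)\<rfloor>, \<lfloor>real n * Im (\<phi> x s)\<rfloor>) else (0,
      0))" for s x
  let ?B = "{- int n - 1..int n} \<times> {- int n - 1..int n}"
  have fl: "\<lfloor>real n * r\<rfloor> \<in> {- int n - 1..int n}" if "\<bar>r\<bar> \<le> 1" for r
  proof -
    have "\<bar>real n * r\<bar> \<le> real n * 1" unfolding abs_mult using that by (intro mult_mono) auto
    then have "real n * r \<le> real n" "- real n \<le> real n * r" by auto
    then show ?thesis by (simp add: le_floor_iff floor_le_iff)
  qed
  have "k s x \<in> ?B" if "x \<in> X" for s x
    using that fl[of "Re (\<phi> x s)"] fl[of "Im (\<phi> x s)"] \<phi>[OF that, of s]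
      abs_Re_le_cmod[of "\<phi> x s"] abs_Im_le_cmod[of "\<phi> x s"] by (simp add: k_def)
  then have "range k \<subseteq> {f. \<forall>x. (x \<in> X \<longrightarrow> f x \<in> ?B) \<and> (x \<notin> X \<longrightarrow> f x = (0, 0))}"
    by (auto simp: k_def)
  moreover have "finite {f. \<forall>x. (x \<in> X \<longrightarrow> f x \<in> ?B) \<and> (x \<notin> X \<longrightarrow> f x = (0, 0))}"
    using X by (intro finite_set_of_finite_funs) auto
  ultimately have "finite (range k)" by (rule finite_subset)
  moreover have "dist (\<phi> x s) (\<phi> x s') < e" if kk: "k s = k s'" and x: "x \<in> X" for s s' x
  proof -
    have "k s x = k s' x" using kk by simp
    then have f: "\<lfloor>real n * Re (\<phi> x s)\<rfloor> = \<lfloor>real n * Re (\<phi> x s')\<rfloor>"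
        "\<lfloor>real n * Im (\<phi> x s)\<rfloor> = \<lfloor>real n * Im (\<phi> x s')\<rfloor>"
      using x by (auto simp: k_def)
    have ab: "real n * \<bar>a - b\<bar> < 1" if "\<lfloor>real n * a\<rfloor> = \<lfloor>real n * b\<rfloor>" for a b
    proof -
      have "\<bar>real n * a - real n * b\<bar> < 1" using that by linarith
      then show ?thesis by (simp add: right_diff_distrib[symmetric] abs_mult)
    qed
    have "real n * norm (\<phi> x s - \<phi> x s') \<le> real n * (\<bar>Re (\<phi> x s - \<phi> x s')\<bar> + \<bar>Im (\<phi> x s - \<phi> x s')\<bar>)"
      by (intro mult_left_mono cmod_le) auto
    also have "\<dots> < 2" using ab[OF f(1)] ab[OF f(2)] by (simp add: distrib_left)
    also have "2 < real n * e" using n e by (simp add: field_simps)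
    finally show ?thesis using n0 by (simp add: dist_norm)
  qed
  ultimately show thesis by (rule that)
qed

text \<open>The transform of the uniform probability on a list of points. Lists rather than sets,
  since sums of points may repeat and must then be counted with multiplicity.\<close>

definition char_avg :: "'a::topological_ab_group_add list \<Rightarrow> 'a pontryagin_dual \<Rightarrow> complex" where
  "char_avg ts \<eta> = (\<Sum>t\<leftarrow>ts. eval_char \<eta> t) / of_nat (length ts)"

text \<open>Convolution of finitely supported probabilities becomes multiplication.\<close>

lemma char_avg_mult:
  "char_avg (concat (map (\<lambda>t. map (\<lambda>s. t + s) ss) ts)) \<eta> = char_avg ts \<eta> * char_avg ss \<eta>"
proof -
  have "(\<Sum>u\<leftarrow>concat (map (\<lambda>t. map (\<lambda>s. t + s) ss) ts). eval_char \<eta> u)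
      = (\<Sum>t\<leftarrow>ts. eval_char \<eta> t) * (\<Sum>s\<leftarrow>ss. eval_char \<eta> s)"
    by (induction ts) (simp_all add: o_def eval_char_add sum_list_const_mult distrib_right)
  moreover have "length (concat (map (\<lambda>t. map (\<lambda>s. t + s) ss) ts)) = length ts * length ss"
    by (induction ts) simp_all
  ultimately show ?thesis by (simp add: char_avg_def)
qed

lemma norm_char_avg_le: "norm (char_avg ts \<eta>) \<le> 1"
proof -
  have "norm (\<Sum>t\<leftarrow>ts. eval_char \<eta> t) \<le> real (length ts)"
    by (induction ts) (auto intro: order_trans[OF norm_triangle_ineq])
  then show ?thesis by (cases "ts = []") (simp_all add: char_avg_def norm_divide divide_le_eq_1)
qed

text \<open>The \<open>n\<close>-fold convolution power of the probability with mass 1/2 at each of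
  0 and \<open>t\<close>.\<close>

lemma char_avg_power: "\<exists>ts. ts \<noteq> [] \<and> (\<forall>\<eta>. char_avg ts \<eta> = ((1 + eval_char \<eta> t) / 2) ^ n)"
proof (induction n)
  case 0
  show ?case by (intro exI[of _ "[0]"]) (simp add: char_avg_def)
next
  case (Suc n)
  then obtain ts where ts: "ts \<noteq> []" "\<And>\<eta>. char_avg ts \<eta> = ((1 + eval_char \<eta> t) / 2) ^ n" by blast
  have "char_avg [0, t] \<eta> = (1 + eval_char \<eta> t) / 2" for \<eta> by (simp add: char_avg_def)
  then show ?case using ts char_avg_mult[of ts "[0, t]"]
    by (intro exI[of _ "concat (map (\<lambda>a. map (\<lambda>s. a + s) ts) [0, t])"])
      (simp add: char_avg_mult[of ts "[0, t]", simplified] char_avg_mult del: concat.simps list.map)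
qed

lemma norm_half_add_lt_1:
  fixes z :: complex
  assumes "norm z = 1" "z \<noteq> 1"
  shows "norm ((1 + z) / 2) < 1"
proof -
  have "(norm (1 + z))\<^sup>2 + (norm (1 - z))\<^sup>2 = 2 + 2 * (norm z)\<^sup>2"
    unfolding cmod_power2 by (simp add: power2_eq_square algebra_simps)
  moreover have "(norm (1 - z))\<^sup>2 > 0" using assms(2) by simp
  ultimately have "(norm (1 + z))\<^sup>2 < 4"
    using assms(1) by (simp only: power_one mult_1_right)
  then have "(norm (1 + z))\<^sup>2 < 2\<^sup>2" by simp
  then have "norm (1 + z) < 2" by (rule power2_less_imp_less) simp
  then show ?thesis by (simp add: norm_divide)
qed

context flc_measure
begin

text \<open>A nonzero character has a value other than 1, and high powers of the corresponding
  average are small near it. The averages of a finite subcover are multiplied; every factor has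
  modulus at most 1, so the smallness of one factor survives in the product.\<close>

lemma char_avg_small:
  assumes D: "compact D" "0 \<notin> (D :: 'a pontryagin_dual set)" and d: "d > 0"
  obtains ts where "ts \<noteq> []" "\<And>\<eta>. \<eta> \<in> D \<Longrightarrow> norm (char_avg ts \<eta>) \<le> d"
proof -
  have "\<exists>U ts. open U \<and> \<eta> \<in> U \<and> ts \<noteq> [] \<and> (\<forall>\<zeta>\<in>U. norm (char_avg ts \<zeta>) \<le> d)" if \<eta>: "\<eta> \<in> D" for \<eta>
  proof -
    have "\<eta> \<noteq> 0" using \<eta> D(2) by blast
    then obtain t where t: "eval_char \<eta> t \<noteq> 1"
      by (metis eval_char_inject ext eval_dual_zero)
    have "norm ((1 + eval_char \<eta> t) / 2) < 1" using t by (intro norm_half_add_lt_1) auto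
    then obtain r where r: "norm ((1 + eval_char \<eta> t) / 2) < r" "r < 1" using dense by blast
    have r0: "0 \<le> r" using r(1) norm_ge_zero order_trans less_imp_le by blast
    obtain n where n: "r ^ n < d" using real_arch_pow_inv[OF d r(2)] by blast
    obtain ts where ts: "ts \<noteq> []" "\<And>\<eta>. char_avg ts \<eta> = ((1 + eval_char \<eta> t) / 2) ^ n"
      using char_avg_power by blast
    have "open {\<zeta>. norm ((1 + eval_char \<zeta> t) / 2) < r}"
      by (intro open_Collect_less continuous_intros continuous_on_eval_dual) auto
    moreover have "norm (char_avg ts \<zeta>) \<le> d" if "norm ((1 + eval_char \<zeta> t) / 2) < r" for \<zeta>
    proof -
      have "norm (char_avg ts \<zeta>) \<le> r ^ n"
        unfolding ts(2) norm_power using that by (intro power_mono) auto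
      then show ?thesis using n by simp
    qed
    ultimately show ?thesis using r(1) ts(1)
      by (intro exI[of _ "{\<zeta>. norm ((1 + eval_char \<zeta> t) / 2) < r}"] exI[of _ ts]) auto
  qed
  then obtain U T where UT: "\<And>\<eta>. \<eta> \<in> D \<Longrightarrow> open (U \<eta>) \<and> \<eta> \<in> U \<eta> \<and> T \<eta> \<noteq> [] \<and> (\<forall>\<zeta>\<in>U \<eta>. norm (char_avg
      (T \<eta>) \<zeta>) \<le> d)"
    by metis
  obtain F where F: "F \<subseteq> D" "finite F" "D \<subseteq> (\<Union>\<eta>\<in>F. U \<eta>)"
    by (rule compactE_image[OF D(1), of D U]) (use UT in auto)
  have "\<exists>ts. ts \<noteq> [] \<and> (\<forall>\<zeta>\<in>(\<Union>\<eta>\<in>F. U \<eta>). norm (char_avg ts \<zeta>) \<le> d)"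
    using F(2,1)
  proof (induction F rule: finite_induct)
    case empty
    show ?case by (intro exI[of _ "[0]"]) simp
  next
    case (insert \<eta> F)
    then obtain ts where ts: "ts \<noteq> []" "\<forall>\<zeta>\<in>(\<Union>\<eta>\<in>F. U \<eta>). norm (char_avg ts \<zeta>) \<le> d" by auto
    have T: "T \<eta> \<noteq> []" "\<forall>\<zeta>\<in>U \<eta>. norm (char_avg (T \<eta>) \<zeta>) \<le> d" using UT insert.prems by auto
    let ?us = "concat (map (\<lambda>t. map (\<lambda>s. t + s) (T \<eta>)) ts)"
    have "norm (char_avg ?us \<zeta>) \<le> d" if "\<zeta> \<in> U \<eta> \<or> \<zeta> \<in> (\<Union>\<eta>\<in>F. U \<eta>)" for \<zeta>
      unfolding char_avg_mult norm_mult
      using that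
    proof
      assume "\<zeta> \<in> U \<eta>"
      then show "norm (char_avg ts \<zeta>) * norm (char_avg (T \<eta>) \<zeta>) \<le> d"
        using T(2) d mult_mono[OF norm_char_avg_le, of "norm (char_avg (T \<eta>) \<zeta>)" d ts \<zeta>] by simp
    next
      assume "\<zeta> \<in> (\<Union>\<eta>\<in>F. U \<eta>)"
      then have "norm (char_avg ts \<zeta>) \<le> d" using ts(2) by blast
      then show "norm (char_avg ts \<zeta>) * norm (char_avg (T \<eta>) \<zeta>) \<le> d"
        using d mult_mono[of "norm (char_avg ts \<zeta>)" d "norm (char_avg (T \<eta>) \<zeta>)" 1]
            norm_char_avg_le[of "T \<eta>" \<zeta>] by simp
    qed
    moreover have "?us \<noteq> []" using ts(1) T(1) by (cases ts) auto
    ultimately show ?case by (intro exI[of _ ?us]) auto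
  qed
  then obtain ts where "ts \<noteq> []" "\<forall>\<zeta>\<in>(\<Union>\<eta>\<in>F. U \<eta>). norm (char_avg ts \<zeta>) \<le> d" by blast
  then show thesis using F(3) by (intro that[of ts]) auto
qed

sublocale nuc: positive_radon "continuous_part \<nu>"
  by unfold_locales (rule nu.lcb, rule nu.positive_continuous_part)

sublocale nud: positive_radon "discrete_part \<nu>"
  by unfold_locales (rule nu.lcb, rule nu.positive_discrete_part)

text \<open>A Lebesgue-number argument: one \<open>U\<close> works for all \<open>\<xi>\<close> in
  \<open>K\<close>, which confines the diagonal in the Wiener argument to a region of small
  mass.\<close>

lemma continuous_part_uniformly_small:
  assumes K: "compact K" and d: "d > 0"
  obtains U where "open U" "0 \<in> U"
    "\<And>\<xi>. \<xi> \<in> K \<Longrightarrow> \<exists>b. (\<lambda>\<eta>. complex_of_real (b \<eta>)) \<in> Cc \<and> (\<forall>\<eta>. 0 \<le> b \<eta>) \<and>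
      Re (continuous_part \<nu> (\<lambda>\<eta>. of_real (b \<eta>))) < d \<and> (\<forall>\<eta>. \<eta> - \<xi> \<in> U \<longrightarrow> b \<eta> = 1)"
proof -
  have "\<exists>b W. (\<lambda>y. complex_of_real (b y)) \<in> Cc \<and> (\<forall>y. 0 \<le> b y) \<and> open W \<and> \<xi> \<in> W \<and> (\<forall>y\<in>W. b y = 1) \<and>
      Re (continuous_part \<nu> (\<lambda>y. of_real (b y))) < d" for \<xi>
    by (rule nu.continuous_part_small_bump[OF d, of \<xi>]) blast
  then obtain b W where b: "\<And>\<xi>. (\<lambda>y. complex_of_real (b \<xi> y)) \<in> Cc" "\<And>\<xi> y. 0 \<le> b \<xi> y"
      "\<And>\<xi>. open (W \<xi>)"
    "\<And>\<xi>. \<xi> \<in> W \<xi>" "\<And>\<xi> y. y \<in> W \<xi> \<Longrightarrow> b \<xi> y = 1" "\<And>\<xi>. Re (continuous_part \<nu> (\<lambda>y. of_real (b \<xi> y))) < d"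
    by metis
  have "\<exists>V. open V \<and> 0 \<in> V \<and> (\<forall>x\<in>V. \<forall>y\<in>V. x + y + \<xi> \<in> W \<xi>)" for \<xi>
  proof -
    have "open {x. x + \<xi> \<in> W \<xi>}" "0 \<in> {x. x + \<xi> \<in> W \<xi>}" using b by (auto intro: open_translation)
    then show ?thesis by (rule group_nbhd_half) blast
  qed
  then obtain V where V: "\<And>\<xi>. open (V \<xi>)" "\<And>\<xi>. 0 \<in> V \<xi>"
      "\<And>\<xi> x y. x \<in> V \<xi> \<Longrightarrow> y \<in> V \<xi> \<Longrightarrow> x + y + \<xi> \<in> W \<xi>"
    by metis
  obtain F where F: "F \<subseteq> K" "finite F" "K \<subseteq> (\<Union>\<xi>\<in>F. {x. x - \<xi> \<in> V \<xi>})"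
    by (rule compactE_image[OF K, of K "\<lambda>\<xi>. {x. x - \<xi> \<in> V \<xi>}"]) (use V in \<open>auto intro:
        open_translation\<close>)
  show thesis
  proof (rule that[of "\<Inter>\<xi>\<in>F. V \<xi>"])
    show "open (\<Inter>\<xi>\<in>F. V \<xi>)" "0 \<in> (\<Inter>\<xi>\<in>F. V \<xi>)" using F V by auto
    fix \<xi> assume "\<xi> \<in> K"
    then obtain \<zeta> where \<zeta>: "\<zeta> \<in> F" "\<xi> - \<zeta> \<in> V \<zeta>" using F(3) by auto
    have "b \<zeta> \<eta> = 1" if "\<eta> - \<xi> \<in> (\<Inter>\<xi>\<in>F. V \<xi>)" for \<eta>
      using V(3)[OF \<zeta>(2), of "\<eta> - \<xi>"] that \<zeta>(1) by (intro b(5)) (simp add: algebra_simps)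
    then show "\<exists>b. (\<lambda>\<eta>. complex_of_real (b \<eta>)) \<in> Cc \<and> (\<forall>\<eta>. 0 \<le> b \<eta>) \<and>
      Re (continuous_part \<nu> (\<lambda>\<eta>. of_real (b \<eta>))) < d \<and> (\<forall>\<eta>. \<eta> - \<xi> \<in> (\<Inter>\<xi>\<in>F. V \<xi>) \<longrightarrow> b \<eta> = 1)"
      using b by blast
  qed
qed

abbreviation twist :: "'a \<Rightarrow> ('a pontryagin_dual \<Rightarrow> complex) \<Rightarrow> 'a pontryagin_dual \<Rightarrow> complex" where
  "twist t c \<equiv> (\<lambda>\<xi>. eval_char \<xi> t * c \<xi>)"

lemma twist_Cc: "c \<in> Cc \<Longrightarrow> twist t c \<in> Cc"
  by (intro Cc_mult continuous_on_eval_dual)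

text \<open>
  The average of \<open>|\<nu>\<^sub>c(twist t c)|\<^sup>2\<close> over \<open>t\<close> is a double integral of \<open>char_avg ts (\<eta> - \<xi>)\<close>, which
      is
  small off the diagonal by the choice of \<open>ts\<close>; the diagonal is negligible for \<open>\<nu>\<^sub>c\<close>.
\<close>

lemma average_square_le:
  assumes c: "c \<in> Cc" and M: "\<And>\<xi>. norm (c \<xi>) \<le> M" and d: "d > 0" and ts: "ts \<noteq> []"
    and U: "\<And>\<xi>. \<xi> \<in> supp c \<Longrightarrow> \<exists>b. (\<lambda>\<eta>. complex_of_real (b \<eta>)) \<in> Cc \<and> (\<forall>\<eta>. 0 \<le> b \<eta>) \<and>
      Re (continuous_part \<nu> (\<lambda>\<eta>. of_real (b \<eta>))) < d \<and> (\<forall>\<eta>. \<eta> - \<xi> \<in> U \<longrightarrow> b \<eta> = 1)"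
    and off: "\<And>\<xi> \<eta>. \<xi> \<in> supp c \<Longrightarrow> \<eta> \<in> supp c \<Longrightarrow> \<eta> - \<xi> \<notin> U \<Longrightarrow> norm (char_avg ts (\<eta> - \<xi>)) \<le> d"
  defines "I \<equiv> Re (continuous_part \<nu> (\<lambda>\<xi>. of_real (norm (c \<xi>))))"
  shows "(\<Sum>t\<leftarrow>ts. (norm (continuous_part \<nu> (twist t c)))\<^sup>2) / length ts \<le> d * (I + M) * I"
proof -
  let ?\<rho> = "continuous_part \<nu>" and ?n = "length ts"
  have n: "?n > 0" using ts by simp
  have M0: "M \<ge> 0" using M[of 0] norm_ge_zero order_trans by blast
  have Cn: "(\<lambda>\<xi>. complex_of_real (norm (c \<xi>))) \<in> Cc" by (rule Cc_norm[OF c])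
  have I: "I \<ge> 0" unfolding I_def by (rule nuc.nonneg[OF Cn]) simp
  have lsum: "(\<Sum>t\<leftarrow>ts. f t) = (\<Sum>i<?n. f (ts ! i))" for f :: "'a \<Rightarrow> 'z::comm_monoid_add"
    by (simp add: sum_list_sum_nth atLeast0LessThan)
  \<comment> \<open>One factor of each squared modulus is kept as a coefficient, the other is an
    integral over \<open>\<xi>\<close>; the average of squares is thus the integral of
    \<open>G * c\<close>. As only finite sums are exchanged with integrals, no product measure
    appears.\<close>
  define G where "G \<xi> = (\<Sum>i<?n. (1 / of_nat ?n * cnj (?\<rho> (twist (ts ! i) c))) * eval_char \<xi> (ts !
      i))" for \<xi>
  have cG: "continuous_on UNIV G" unfolding G_def by (intro continuous_intros
      continuous_on_eval_dual)
  have G_le: "norm (G \<xi>) \<le> d * (I + M)" if \<xi>: "\<xi> \<in> supp c" for \<xi>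
  proof -
    have "G \<xi> = cnj (\<Sum>i<?n. (1 / of_nat ?n * cnj (eval_char \<xi> (ts ! i))) * ?\<rho> (twist (ts ! i) c))"
      by (simp add: G_def mult_ac)
    also have "(\<Sum>i<?n. (1 / of_nat ?n * cnj (eval_char \<xi> (ts ! i))) * ?\<rho> (twist (ts ! i) c))
        = ?\<rho> (\<lambda>\<eta>. \<Sum>i<?n. (1 / of_nat ?n * cnj (eval_char \<xi> (ts ! i))) * twist (ts ! i) c \<eta>)"
      using c by (simp only: nuc.sum nuc.cmult Cc_cmult twist_Cc)
    also have "(\<lambda>\<eta>. \<Sum>i<?n. (1 / of_nat ?n * cnj (eval_char \<xi> (ts ! i))) * twist (ts ! i) c \<eta>)
        = (\<lambda>\<eta>. char_avg ts (\<eta> - \<xi>) * c \<eta>)"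
      unfolding char_avg_def lsum by (rule ext) (simp add: eval_dual_diff sum_distrib_left
          sum_distrib_right sum_divide_distrib mult_ac)
    finally have eq: "norm (G \<xi>) = norm (?\<rho> (\<lambda>\<eta>. char_avg ts (\<eta> - \<xi>) * c \<eta>))" by simp
    obtain b where b: "(\<lambda>\<eta>. complex_of_real (b \<eta>)) \<in> Cc" "\<And>\<eta>. 0 \<le> b \<eta>"
        "Re (?\<rho> (\<lambda>\<eta>. of_real (b \<eta>))) < d"
      "\<And>\<eta>. \<eta> - \<xi> \<in> U \<Longrightarrow> b \<eta> = 1" using U[OF \<xi>] by blast
    have c1: "(\<lambda>\<eta>. complex_of_real (d * norm (c \<eta>))) \<in> Cc" using Cc_cmult[OF Cn, of "of_real d"] by
        simp
    have c2: "(\<lambda>\<eta>. complex_of_real (M * b \<eta>)) \<in> Cc" using Cc_cmult[OF b(1), of "of_real M"] by simp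
    have "norm (G \<xi>) \<le> Re (?\<rho> (\<lambda>\<eta>. of_real (d * norm (c \<eta>) + M * b \<eta>)))"
      unfolding eq
    proof (rule nuc.norm_le)
      have "continuous_on UNIV (\<lambda>\<eta>. char_avg ts (\<eta> - \<xi>))"
        unfolding char_avg_def lsum
        by (intro continuous_on_divide continuous_on_sum continuous_on_const
            continuous_on_compose2[OF continuous_on_eval_dual] continuous_on_shifts) (use n in auto)
      then show "(\<lambda>\<eta>. char_avg ts (\<eta> - \<xi>) * c \<eta>) \<in> Cc" by (intro Cc_mult c)
      show "(\<lambda>\<eta>. complex_of_real (d * norm (c \<eta>) + M * b \<eta>)) \<in> Cc" using Cc_add[OF c1 c2] by simp
      fix \<eta>
      show "norm (char_avg ts (\<eta> - \<xi>) * c \<eta>) \<le> d * norm (c \<eta>) + M * b \<eta>"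
      proof (cases "\<eta> \<in> supp c")
        case False
        then show ?thesis using M0 b(2)[of \<eta>] by (simp add: notin_supp)
      next
        case True
        show ?thesis
        proof (cases "\<eta> - \<xi> \<in> U")
          case u: True
          have "norm (char_avg ts (\<eta> - \<xi>) * c \<eta>) \<le> 1 * M"
            unfolding norm_mult using norm_char_avg_le M by (intro mult_mono) auto
          moreover have "0 \<le> d * norm (c \<eta>)" using d by simp
          ultimately show ?thesis using b(4)[OF u] by simp
        next
          case u: False
          have "norm (char_avg ts (\<eta> - \<xi>) * c \<eta>) \<le> d * norm (c \<eta>)"
            unfolding norm_mult using off[OF \<xi> True u] by (intro mult_right_mono) auto
          moreover have "0 \<le> M * b \<eta>" using M0 b(2)[of \<eta>] by simp
          ultimately show ?thesis by simp
        qed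
      qed
    qed
    also have "\<dots> = d * I + M * Re (?\<rho> (\<lambda>\<eta>. of_real (b \<eta>)))"
      using nuc.add[OF c1 c2] nuc.cmult[OF Cn, of "of_real d"] nuc.cmult[OF b(1), of "of_real M"] by
          (simp add: I_def)
    also have "\<dots> \<le> d * I + M * d" using b(3) M0 by (intro add_left_mono mult_left_mono) auto
    finally show ?thesis by (simp add: algebra_simps)
  qed
  have "complex_of_real ((\<Sum>t\<leftarrow>ts. (norm (?\<rho> (twist t c)))\<^sup>2) / ?n)
      = (\<Sum>i<?n. (1 / of_nat ?n * cnj (?\<rho> (twist (ts ! i) c))) * ?\<rho> (twist (ts ! i) c))"
    unfolding lsum by (simp add: complex_norm_square sum_divide_distrib mult_ac del: of_real_power)
  also have "\<dots> = ?\<rho> (\<lambda>\<xi>. \<Sum>i<?n. (1 / of_nat ?n * cnj (?\<rho> (twist (ts ! i) c))) * twist (ts ! i) c \<xi>)"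
    using c by (simp only: nuc.sum nuc.cmult Cc_cmult twist_Cc)
  also have "\<dots> = ?\<rho> (\<lambda>\<xi>. G \<xi> * c \<xi>)"
    unfolding G_def sum_distrib_right by (simp only: mult.assoc)
  finally have eq: "complex_of_real ((\<Sum>t\<leftarrow>ts. (norm (?\<rho> (twist t c)))\<^sup>2) / ?n) = ?\<rho> (\<lambda>\<xi>. G \<xi> * c \<xi>)"
      .
  have cc: "(\<lambda>\<xi>. complex_of_real (d * (I + M) * norm (c \<xi>))) \<in> Cc"
    using Cc_cmult[OF Cn, of "of_real (d * (I + M))"] by simp
  have "(\<Sum>t\<leftarrow>ts. (norm (?\<rho> (twist t c)))\<^sup>2) / ?n \<le> norm (?\<rho> (\<lambda>\<xi>. G \<xi> * c \<xi>))"
    unfolding eq[symmetric] norm_of_real by (rule abs_ge_self)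
  also have "\<dots> \<le> Re (?\<rho> (\<lambda>\<xi>. of_real (d * (I + M) * norm (c \<xi>))))"
  proof (intro nuc.norm_le cc Cc_mult cG c)
    show "norm (G \<xi> * c \<xi>) \<le> d * (I + M) * norm (c \<xi>)" for \<xi>
      by (cases "\<xi> \<in> supp c") (auto simp: norm_mult notin_supp intro!: mult_right_mono G_le)
  qed
  also have "\<dots> = d * (I + M) * I"
    using nuc.cmult[OF Cn, of "of_real (d * (I + M))"] by (simp add: I_def)
  finally show ?thesis .
qed

text \<open>If every \<open>t\<close> failed for some member, the squares summed over the family
  would be at least \<open>e\<^sup>2\<close> for each \<open>t\<close>, contradicting the averaged
  bound. Summing over the family yields a single \<open>t\<close> for all its members.\<close>

lemma Wiener:
  assumes \<C>: "finite \<C>" "\<C> \<subseteq> Cc" and e: "e > 0"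
  obtains t where "\<And>c. c \<in> \<C> \<Longrightarrow> norm (continuous_part \<nu> (twist t c)) < e"
proof (rule ccontr)
  assume "\<not> thesis"
  then have no: "\<exists>c\<in>\<C>. e \<le> norm (continuous_part \<nu> (twist t c))" for t
    using that by (meson not_le)
  define I where "I c = Re (continuous_part \<nu> (\<lambda>\<xi>. of_real (norm (c \<xi>))))" for c ::
      "'a pontryagin_dual \<Rightarrow> complex"
  have "\<forall>c\<in>\<C>. \<exists>M>0. \<forall>\<xi>. norm (c \<xi>) \<le> M" using Cc_bounded \<C>(2) by (metis subsetD)
  then obtain M where M: "\<And>c. c \<in> \<C> \<Longrightarrow> M c > 0" "\<And>c \<xi>. c \<in> \<C> \<Longrightarrow> norm (c \<xi>) \<le> M c" by metis
  have I: "I c \<ge> 0" if "c \<in> \<C>" for c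
    unfolding I_def using that \<C>(2) by (intro nuc.nonneg Cc_norm) auto
  define B where "B = (\<Sum>c\<in>\<C>. (I c + M c) * I c)"
  have B: "B \<ge> 0" unfolding B_def using I M by (intro sum_nonneg mult_nonneg_nonneg
      add_nonneg_nonneg) (auto intro: less_imp_le)
  \<comment> \<open>The averaged bound is \<open>d * B\<close>, strictly below
    \<open>e\<^sup>2\<close> even when \<open>B\<close> is 0.\<close>
  define d where "d = e\<^sup>2 / (B + 1)"
  have d: "d > 0" using e B by (simp add: d_def)
  define K where "K = (\<Union>c\<in>\<C>. supp c)"
  have K: "compact K" unfolding K_def using \<C> by (intro compact_UN Cc_compact) auto
  obtain U where U: "open U" "0 \<in> U"
    "\<And>\<xi>. \<xi> \<in> K \<Longrightarrow> \<exists>b. (\<lambda>\<eta>. complex_of_real (b \<eta>)) \<in> Cc \<and> (\<forall>\<eta>. 0 \<le> b \<eta>) \<and>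
      Re (continuous_part \<nu> (\<lambda>\<eta>. of_real (b \<eta>))) < d \<and> (\<forall>\<eta>. \<eta> - \<xi> \<in> U \<longrightarrow> b \<eta> = 1)"
    by (rule continuous_part_uniformly_small[OF K d]) (rule that)
  \<comment> \<open>All differences of points of the supports that lie outside the diagonal
    neighbourhood: compact and without 0.\<close>
  define D where "D = (\<lambda>(x, y). x - y) ` (K \<times> K) - U"
  have "compact D" unfolding D_def by (intro compact_diff compact_minus_set K U)
  moreover have "0 \<notin> D" using U by (simp add: D_def)
  ultimately obtain ts where ts: "ts \<noteq> []" "\<And>\<eta>. \<eta> \<in> D \<Longrightarrow> norm (char_avg ts \<eta>) \<le> d"
    using char_avg_small[OF _ _ d] by metis
  have n: "real (length ts) > 0" using ts(1) by simp
  have avg: "(\<Sum>t\<leftarrow>ts. (norm (continuous_part \<nu> (twist t c)))\<^sup>2) / length ts \<le> d * (I c + M c) * I c"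
    if c: "c \<in> \<C>" for c
    unfolding I_def
  proof (rule average_square_le[where U=U])
    show "c \<in> Cc" using c \<C>(2) by blast
    show "norm (c \<xi>) \<le> M c" for \<xi> using M(2)[OF c] .
    show "\<exists>b. (\<lambda>\<eta>. complex_of_real (b \<eta>)) \<in> Cc \<and> (\<forall>\<eta>. 0 \<le> b \<eta>) \<and>
      Re (continuous_part \<nu> (\<lambda>\<eta>. of_real (b \<eta>))) < d \<and> (\<forall>\<eta>. \<eta> - \<xi> \<in> U \<longrightarrow> b \<eta> = 1)" if "\<xi> \<in> supp c" for \<xi>
      using U(3) that c by (auto simp: K_def)
    show "norm (char_avg ts (\<eta> - \<xi>)) \<le> d" if "\<xi> \<in> supp c" "\<eta> \<in> supp c" "\<eta> - \<xi> \<notin> U" for \<xi> \<eta>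
    proof (rule ts(2))
      have "(\<lambda>(x, y). x - y) (\<eta>, \<xi>) \<in> (\<lambda>(x, y). x - y) ` (K \<times> K)"
        using that(1,2) c by (intro imageI) (auto simp: K_def)
      then show "\<eta> - \<xi> \<in> D" using that(3) by (simp add: D_def)
    qed
  qed (use d ts in auto)
  have "e\<^sup>2 \<le> (\<Sum>c\<in>\<C>. (norm (continuous_part \<nu> (twist t c)))\<^sup>2)" for t
  proof -
    obtain c where c: "c \<in> \<C>" "e \<le> norm (continuous_part \<nu> (twist t c))" using no by blast
    have "e\<^sup>2 \<le> (norm (continuous_part \<nu> (twist t c)))\<^sup>2" using c(2) e by (intro power_mono) auto
    also have "\<dots> \<le> (\<Sum>c\<in>\<C>. (norm (continuous_part \<nu> (twist t c)))\<^sup>2)"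
      using c(1) \<C>(1) by (intro member_le_sum) auto
    finally show ?thesis .
  qed
  then have "(\<Sum>t\<leftarrow>ts. e\<^sup>2) \<le> (\<Sum>t\<leftarrow>ts. \<Sum>c\<in>\<C>. (norm (continuous_part \<nu> (twist t c)))\<^sup>2)"
    by (intro sum_list_mono)
  then have "real (length ts) * e\<^sup>2 \<le> (\<Sum>c\<in>\<C>. \<Sum>t\<leftarrow>ts. (norm (continuous_part \<nu> (twist t c)))\<^sup>2)"
    by (simp add: sum_list_triv sum_list_sum_nth sum.swap[of _ \<C>])
  then have "e\<^sup>2 \<le> (\<Sum>c\<in>\<C>. \<Sum>t\<leftarrow>ts. (norm (continuous_part \<nu> (twist t c)))\<^sup>2) / length ts"
    using n by (simp add: field_simps)
  also have "\<dots> = (\<Sum>c\<in>\<C>. (\<Sum>t\<leftarrow>ts. (norm (continuous_part \<nu> (twist t c)))\<^sup>2) / length ts)"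
    by (rule sum_divide_distrib)
  also have "\<dots> \<le> (\<Sum>c\<in>\<C>. d * (I c + M c) * I c)" by (intro sum_mono avg)
  also have "\<dots> = d * B" by (simp add: B_def sum_distrib_left mult.assoc)
  also have "\<dots> < d * (B + 1)" using d by simp
  also have "\<dots> = e\<^sup>2" using B by (simp add: d_def)
  finally show False by simp
qed

text \<open>Points are chosen greedily: the next \<open>s\<close> comes from \<open>Wiener\<close>
  for the enlarged family of functions twisted by \<open>- t i\<close>, since twisting such a
  function by \<open>s\<close> amounts to twisting by \<open>s - t i\<close>.\<close>

lemma Wiener_differences:
  assumes \<C>: "finite \<C>" "\<C> \<subseteq> Cc" and e: "e > 0"
  shows "\<exists>t :: nat \<Rightarrow> 'a. \<forall>j<n. \<forall>i<j. \<forall>c\<in>\<C>. norm (continuous_part \<nu> (twist (t j - t i) c)) < e"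
proof (induction n)
  case (Suc n)
  then obtain t where t: "\<And>i j c. j < n \<Longrightarrow> i < j \<Longrightarrow> c \<in> \<C> \<Longrightarrow> norm (continuous_part \<nu> (twist (t j - t i)
      c)) < e" by blast
  let ?D = "(\<lambda>(i, c). twist (- t i) c) ` ({..<n} \<times> \<C>)"
  obtain s where s: "\<And>c. c \<in> ?D \<Longrightarrow> norm (continuous_part \<nu> (twist s c)) < e"
    by (rule Wiener[of ?D e]) (use \<C> e in \<open>auto intro!: twist_Cc\<close>)
  have "norm (continuous_part \<nu> (twist (s - t i) c)) < e" if "i < n" "c \<in> \<C>" for i c
  proof -
    have "(\<lambda>(i, c). twist (- t i) c) (i, c) \<in> ?D" using that by (intro imageI) auto
    then have "norm (continuous_part \<nu> (twist s (twist (- t i) c))) < e" by (intro s) simp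
    moreover have "twist s (twist (- t i) c) = twist (s - t i) c"
      by (simp add: eval_char_diff eval_char_uminus mult.assoc)
    ultimately show ?thesis by simp
  qed
  then show ?case using t by (intro exI[of _ "t(n := s)"]) (auto simp: less_Suc_eq)
qed simp

text \<open>On the heavy atoms \<open>X\<close> the factor of the integrand is at most
  \<open>d\<close>; elsewhere the trivial bound 2 is paid on the remaining weight.\<close>

lemma discrete_part_twist_close:
  assumes c: "c \<in> Cc" and g: "(\<lambda>\<xi>. complex_of_real (g \<xi>)) \<in> Cc" "\<And>\<xi>. norm (c \<xi>) \<le> g \<xi>"
    and X: "finite X" "\<And>\<xi>. \<xi> \<in> X \<Longrightarrow> norm (eval_char \<xi> t - 1) \<le> d" and d: "d \<ge> 0"
  defines "S \<equiv> (\<Sum>\<^sub>\<infinity>\<xi>. nu.point_mass \<xi> * g \<xi>)"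
  shows "norm (discrete_part \<nu> (twist t c) - discrete_part \<nu> c) \<le> d * S + 2 * (S - (\<Sum>\<xi>\<in>X.
      nu.point_mass \<xi> * g \<xi>))"
proof -
  let ?m = nu.point_mass
  have g0: "0 \<le> g \<xi>" for \<xi> using g(2)[of \<xi>] norm_ge_zero order_trans by blast
  note gs = nu.discrete_part_real(2)[OF g(1) g0]
  have fin: "(\<Sum>\<xi>\<in>F. ?m \<xi> * g \<xi>) \<le> S" if "finite F" for F
    unfolding S_def using that gs by (intro finite_sum_le_infsum) (auto simp: nu.point_mass_nonneg
        g0)
  let ?h = "\<lambda>\<xi>. (eval_char \<xi> t - 1) * c \<xi>"
  have h: "?h \<in> Cc" by (intro Cc_mult c continuous_intros continuous_on_eval_dual)
  have "discrete_part \<nu> (twist t c) - discrete_part \<nu> c = discrete_part \<nu> ?h"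
    using nud.diff[OF twist_Cc[OF c] c] by (simp add: left_diff_distrib)
  also have "norm \<dots> \<le> (\<Sum>\<^sub>\<infinity>\<xi>. norm (complex_of_real (?m \<xi>) * ?h \<xi>))"
    unfolding nu.discrete_part_eq using nu.point_mass_summable[OF h]
    by (intro norm_infsum_bound) (simp add: norm_mult nu.point_mass_nonneg)
  also have "\<dots> \<le> d * S + 2 * (S - (\<Sum>\<xi>\<in>X. ?m \<xi> * g \<xi>))"
  proof (rule infsum_le_finite_sums)
    show "(\<lambda>\<xi>. norm (complex_of_real (?m \<xi>) * ?h \<xi>)) summable_on UNIV"
      using nu.point_mass_summable[OF h] by (simp add: norm_mult nu.point_mass_nonneg)
    fix F :: "'a pontryagin_dual set" assume F: "finite F"
    have le: "norm (complex_of_real (?m \<xi>) * ?h \<xi>) \<le> a * (?m \<xi> * g \<xi>)" if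
        "norm (eval_char \<xi> t - 1) \<le> a" for a \<xi>
    proof -
      have "norm (eval_char \<xi> t - 1) * norm (c \<xi>) \<le> a * g \<xi>"
        using that g(2)[of \<xi>] order_trans[OF norm_ge_zero that] by (intro mult_mono) auto
      then have "?m \<xi> * (norm (eval_char \<xi> t - 1) * norm (c \<xi>)) \<le> ?m \<xi> * (a * g \<xi>)"
        by (intro mult_left_mono nu.point_mass_nonneg)
      then show ?thesis by (simp add: norm_mult nu.point_mass_nonneg mult_ac)
    qed
    have le2: "norm (eval_char \<xi> t - 1) \<le> 2" for \<xi> using norm_triangle_ineq4[of "eval_char \<xi> t" 1]
        by simp
    have "(\<Sum>\<xi>\<in>F. norm (complex_of_real (?m \<xi>) * ?h \<xi>))
        = (\<Sum>\<xi>\<in>F \<inter> X. norm (complex_of_real (?m \<xi>) * ?h \<xi>)) + (\<Sum>\<xi>\<in>F - X. norm (complex_of_real (?m \<xi>) * ?h \<xi>))"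
      by (rule sum.Int_Diff[OF F])
    also have "\<dots> \<le> (\<Sum>\<xi>\<in>F \<inter> X. d * (?m \<xi> * g \<xi>)) + (\<Sum>\<xi>\<in>F - X. 2 * (?m \<xi> * g \<xi>))"
      using X(2) le2 by (intro add_mono sum_mono le) auto
    also have "\<dots> = d * (\<Sum>\<xi>\<in>F \<inter> X. ?m \<xi> * g \<xi>) + 2 * (\<Sum>\<xi>\<in>F - X. ?m \<xi> * g \<xi>)"
      by (simp add: sum_distrib_left)
    also have "(\<Sum>\<xi>\<in>F - X. ?m \<xi> * g \<xi>) = (\<Sum>\<xi>\<in>F \<union> X. ?m \<xi> * g \<xi>) - (\<Sum>\<xi>\<in>X. ?m \<xi> * g \<xi>)"
      using sum.subset_diff[of X "F \<union> X" "\<lambda>\<xi>. ?m \<xi> * g \<xi>"] F X(1) by (simp add: Un_Diff)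
    also have "d * (\<Sum>\<xi>\<in>F \<inter> X. ?m \<xi> * g \<xi>) + 2 * ((\<Sum>\<xi>\<in>F \<union> X. ?m \<xi> * g \<xi>) - (\<Sum>\<xi>\<in>X. ?m \<xi> * g \<xi>))
        \<le> d * S + 2 * (S - (\<Sum>\<xi>\<in>X. ?m \<xi> * g \<xi>))"
      using F X(1) d by (intro add_mono mult_left_mono diff_right_mono fin) auto
    finally show "(\<Sum>\<xi>\<in>F. norm (complex_of_real (?m \<xi>) * ?h \<xi>)) \<le> d * S + 2 * (S - (\<Sum>\<xi>\<in>X. ?m \<xi> * g
        \<xi>))" .
  qed
  finally show ?thesis .
qed

text \<open>
  By the pigeonhole principle two of many points whose differences are good for \<open>Wiener\<close> have
  nearly the same values at the heavy atoms; their difference is good for the discrete part, too.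
\<close>

lemma twist_approximates_discrete_part:
  assumes \<C>: "finite \<C>" "\<C> \<subseteq> Cc" and e: "e > 0"
  obtains t where "\<And>c. c \<in> \<C> \<Longrightarrow> norm (\<nu> (twist t c) - discrete_part \<nu> c) < e"
proof -
  let ?m = nu.point_mass
  define g where "g \<xi> = (\<Sum>c\<in>\<C>. norm (c \<xi>))" for \<xi>
  have "(\<lambda>\<xi>. \<Sum>c\<in>\<C>. complex_of_real (norm (c \<xi>))) \<in> Cc" using \<C>(2) by (intro Cc_sum Cc_norm) auto
  then have g: "(\<lambda>\<xi>. complex_of_real (g \<xi>)) \<in> Cc" by (simp add: g_def)
  have g0: "0 \<le> g \<xi>" for \<xi> unfolding g_def by (intro sum_nonneg) auto
  have cg: "norm (c \<xi>) \<le> g \<xi>" if "c \<in> \<C>" for c \<xi>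
    unfolding g_def using that \<C>(1) by (intro member_le_sum[of c \<C> "\<lambda>c. norm (c \<xi>)"]) auto
  define S where "S = (\<Sum>\<^sub>\<infinity>\<xi>. ?m \<xi> * g \<xi>)"
  have S0: "S \<ge> 0" unfolding S_def by (intro infsum_nonneg) (simp add: nu.point_mass_nonneg g0)
  have "((\<lambda>\<xi>. ?m \<xi> * g \<xi>) has_sum S) UNIV"
    unfolding S_def using nu.discrete_part_real(2)[OF g g0] by (rule has_sum_infsum)
  \<comment> \<open>The weight outside \<open>X\<close> enters with factor 2, hence costs at most
    \<open>e / 8\<close>; with \<open>d * S\<close> below \<open>e / 4\<close> this stays under
    \<open>e / 2\<close>.\<close>
  then obtain X where X: "finite X" "dist (\<Sum>\<xi>\<in>X. ?m \<xi> * g \<xi>) S \<le> e / 16"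
    using has_sum_finite_approximation[of "\<lambda>\<xi>. ?m \<xi> * g \<xi>" UNIV S "e/16"] e by auto
  define d where "d = e / (4 * (S + 1))"
  have d: "d > 0" using e S0 by (simp add: d_def)
  have "d * (S + 1) = e / 4" using S0 unfolding d_def by (simp add: divide_simps)
  then have dS: "d * S < e / 4" using d by (simp add: algebra_simps)
  obtain k :: "'a \<Rightarrow> 'a pontryagin_dual \<Rightarrow> int \<times> int" where k: "finite (range k)"
    "\<And>s s' \<xi>. k s = k s' \<Longrightarrow> \<xi> \<in> X \<Longrightarrow> dist (eval_char \<xi> s) (eval_char \<xi> s') < d"
    by (rule finite_cells[OF X(1), of eval_char d]) (use d in auto)
  \<comment> \<open>One point more than there are cells.\<close>
  define n where "n = Suc (card (range k))"
  have "e / 2 > 0" using e by simp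
  from Wiener_differences[OF \<C> this, of n] obtain t where
    t: "\<And>i j c. j < n \<Longrightarrow> i < j \<Longrightarrow> c \<in> \<C> \<Longrightarrow> norm (continuous_part \<nu> (twist (t j - t i) c)) < e / 2" by
        blast
  have "card ((\<lambda>i. k (t i)) ` {..<n}) \<le> card (range k)" using k(1) by (intro card_mono) auto
  then have "\<not> inj_on (\<lambda>i. k (t i)) {..<n}" by (intro pigeonhole) (simp add: n_def)
  then obtain i j where ij: "i < j" "j < n" "k (t j) = k (t i)"
    unfolding inj_on_def by (metis lessThan_iff linorder_neqE_nat)
  show thesis
  proof (rule that[of "t j - t i"])
    fix c assume c: "c \<in> \<C>"
    have cC: "c \<in> Cc" using c \<C>(2) by blast
    let ?t = "t j - t i"
    have "norm (eval_char \<xi> ?t - 1) \<le> d" if "\<xi> \<in> X" for \<xi>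
    proof -
      have "eval_char \<xi> ?t - 1 = (eval_char \<xi> (t j) - eval_char \<xi> (t i)) * cnj (eval_char \<xi> (t i))"
        by (simp add: eval_char_diff left_diff_distrib eval_char_mult_cnj)
      then have "norm (eval_char \<xi> ?t - 1) = dist (eval_char \<xi> (t j)) (eval_char \<xi> (t i))"
        by (simp add: norm_mult dist_norm)
      then show ?thesis using k(2)[OF ij(3) that] by simp
    qed
    then have "norm (discrete_part \<nu> (twist ?t c) - discrete_part \<nu> c) \<le> d * S + 2 * (S - (\<Sum>\<xi>\<in>X. ?m
        \<xi> * g \<xi>))"
      unfolding S_def using X d by (intro discrete_part_twist_close cC g cg c) auto
    also have "\<dots> < e / 2"
    proof -
      have "p + 2 * (S - y) < e / 2" if "p < e / 4" "\<bar>y - S\<bar> \<le> e / 16" for p y :: real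
      proof -
        have a: "S - y \<le> e / 16" using that(2) abs_le_D2 by fastforce
        have b: "2 * (S - y) \<le> e / 8" using a by simp
        have c: "e / 4 + e / 8 < e / 2" using e by simp
        show ?thesis using that(1) b c by linarith
      qed
      then show ?thesis using X(2) dS unfolding dist_real_def by blast
    qed
    finally have 1: "norm (discrete_part \<nu> (twist ?t c) - discrete_part \<nu> c) < e / 2" .
    have 2: "norm (continuous_part \<nu> (twist ?t c)) < e / 2" using t ij c by blast
    have "norm (\<nu> (twist ?t c) - discrete_part \<nu> c)
        = norm (continuous_part \<nu> (twist ?t c) + (discrete_part \<nu> (twist ?t c) - discrete_part \<nu> c))"
      by (simp add: continuous_part_def)
    also have "\<dots> \<le> norm (continuous_part \<nu> (twist ?t c)) + norm (discrete_part \<nu> (twist ?t c) -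
        discrete_part \<nu> c)"
      by (rule norm_triangle_ineq)
    also have "\<dots> < e / 2 + e / 2" using 2 1 by (rule add_strict_mono)
    finally show "norm (\<nu> (twist ?t c) - discrete_part \<nu> c) < e" by simp
  qed
qed

end

section \<open>Almost periodicity\<close>

text \<open>Total boundedness of the set of translates, stated without the space of bounded
  continuous functions; \<open>almost_periodic_imp_bohr\<close> makes the connection.\<close>

definition translates_totally_bounded :: "('a::ab_group_add \<Rightarrow> complex) \<Rightarrow> bool" where
  "translates_totally_bounded f \<longleftrightarrow>
     (\<forall>e>0. \<exists>T. finite T \<and> (\<forall>\<tau>. \<exists>\<tau>'\<in>T. \<forall>x. dist (f (x - \<tau>)) (f (x - \<tau>')) < e))"

definition almost_periodic :: "('a::topological_ab_group_add \<Rightarrow> complex) \<Rightarrow> bool" where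
  "almost_periodic f \<longleftrightarrow> bounded_uniformly_continuous f \<and> translates_totally_bounded f"

lemma buc_continuous:
  assumes "bounded_uniformly_continuous f"
  shows "continuous_on UNIV f"
  unfolding continuous_on_topological
proof (intro ballI allI impI)
  fix x B assume B: "open B" "f x \<in> B"
  then obtain e where e: "e > 0" "ball (f x) e \<subseteq> B" using open_contains_ball by blast
  obtain U where U: "open U" "0 \<in> U" "\<And>x y. x - y \<in> U \<Longrightarrow> dist (f x) (f y) < e"
    using assms e(1) unfolding bounded_uniformly_continuous_def by metis
  have "f y \<in> B" if "x - y \<in> U" for y using U(3)[OF that] e(2) by auto
  then show "\<exists>A. open A \<and> x \<in> A \<and> (\<forall>y\<in>UNIV. y \<in> A \<longrightarrow> f y \<in> B)"
    using U by (intro exI[of _ "{y. x - y \<in> U}"]) (auto intro: open_translation)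
qed

text \<open>The library's completeness instance for \<open>bcontfun\<close> covers only metric domains.\<close>

lemma bcontfun_closed_imp_complete:
  fixes S :: "('a::topological_space \<Rightarrow>\<^sub>C 'b::complete_space) set"
  assumes "closed S"
  shows "complete S"
  unfolding complete_def
proof (intro allI impI)
  fix F assume F: "(\<forall>n. F n \<in> S) \<and> Cauchy F"
  have "uniformly_Cauchy_on UNIV (\<lambda>n. apply_bcontfun (F n))"
    unfolding uniformly_Cauchy_on_def
  proof (intro allI impI)
    fix e :: real assume "e > 0"
    then obtain M where "\<And>m n. M \<le> m \<Longrightarrow> M \<le> n \<Longrightarrow> dist (F m) (F n) < e"
      using F unfolding Cauchy_def by blast
    then show "\<exists>M. \<forall>x\<in>UNIV. \<forall>m\<ge>M. \<forall>n\<ge>M. dist (apply_bcontfun (F m) x) (apply_bcontfun (F n) x) < e"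
      by (intro exI[of _ M]) (auto intro: dist_fun_lt_imp_dist_val_lt)
  qed
  then obtain g where "uniform_limit UNIV (\<lambda>n. apply_bcontfun (F n)) g sequentially"
    using Cauchy_uniformly_convergent unfolding uniformly_convergent_on_def by blast
  then obtain G where G: "F \<longlonglongrightarrow> G"
    using uniform_limit_bcontfunE[OF _ sequentially_bot] by metis
  then have "G \<in> S" using F closed_sequentially[OF assms] by blast
  then show "\<exists>l\<in>S. F \<longlonglongrightarrow> l" using G by blast
qed

lemma almost_periodic_imp_bohr:
  assumes "almost_periodic f"
  shows "bohr_almost_periodic f"
proof -
  have buc: "bounded_uniformly_continuous f" and tb: "translates_totally_bounded f"
    using assms by (auto simp: almost_periodic_def)
  define F where "F t = Bcontfun (\<lambda>x. f (x - t))" for t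
  have "(\<lambda>x. f (x - t)) \<in> bcontfun" for t
  proof -
    have "range (\<lambda>x. f (x - t)) \<subseteq> range f" by auto
    then have "bounded (range (\<lambda>x. f (x - t)))"
      using buc bounded_subset unfolding bounded_uniformly_continuous_def by blast
    then show ?thesis unfolding bcontfun_def
      using continuous_on_compose2[OF buc_continuous[OF buc] continuous_on_shifts(1), of t UNIV] by
          simp
  qed
  then have apply_F: "apply_bcontfun (F t) x = f (x - t)" for t x by (simp add: F_def
      Bcontfun_inverse)
  have "compact (closure (range F))"
    unfolding compact_eq_totally_bounded
  proof (intro conjI allI impI)
    show "complete (closure (range F))" by (intro bcontfun_closed_imp_complete closed_closure)
    fix e :: real assume e: "e > 0"
    then obtain T where T: "finite T" "\<And>\<tau>. \<exists>\<tau>'\<in>T. \<forall>x. dist (f (x - \<tau>)) (f (x - \<tau>')) < e/2"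
      using tb unfolding translates_totally_bounded_def by (metis half_gt_zero)
    \<comment> \<open>Closed balls of half the radius, so that the inclusion passes to the closure
      before opening up to radius \<open>e\<close>.\<close>
    have "range F \<subseteq> (\<Union>t\<in>T. cball (F t) (e/2))"
    proof
      fix g assume "g \<in> range F"
      then obtain \<tau> where g: "g = F \<tau>" by blast
      obtain \<tau>' where \<tau>': "\<tau>' \<in> T" "\<And>x. dist (f (x - \<tau>)) (f (x - \<tau>')) < e/2" using T(2) by blast
      have "dist (F \<tau>) (F \<tau>') \<le> e/2" by (rule dist_bound) (use \<tau>' in \<open>auto simp: apply_F intro:
          less_imp_le\<close>)
      then show "g \<in> (\<Union>t\<in>T. cball (F t) (e/2))" using \<tau>'(1) g by (auto simp: dist_commute)
    qed
    moreover have "closed (\<Union>t\<in>T. cball (F t) (e/2))" using T(1) by (intro closed_UN) auto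
    ultimately have "closure (range F) \<subseteq> (\<Union>t\<in>T. cball (F t) (e/2))" by (rule closure_minimal)
    also have "\<dots> \<subseteq> (\<Union>x\<in>F ` T. ball x e)" using e by force
    finally show "\<exists>k. finite k \<and> closure (range F) \<subseteq> (\<Union>x\<in>k. ball x e)" using T(1) by blast
  qed
  then show ?thesis using buc by (simp add: bohr_almost_periodic_def F_def)
qed

lemma almost_periodic_uniform_limit:
  assumes "\<And>e. e > 0 \<Longrightarrow> \<exists>p. almost_periodic p \<and> (\<forall>x. norm (f x - p x) \<le> e)"
  shows "almost_periodic f"
proof -
  have tri: "dist (f x) (f y) < e" if "norm (f x - p x) \<le> e/3" "norm (f y - p y) \<le> e/3"
      "dist (p x) (p y) < e/3"
    for p e x y
  proof -
    have "dist (f x) (f y) \<le> dist (f x) (p x) + (dist (p x) (p y) + dist (p y) (f y))"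
      using dist_triangle[of "f x" "f y" "p x"] dist_triangle[of "p x" "f y" "p y"] by linarith
    moreover have "dist (f x) (p x) \<le> e/3" "dist (p y) (f y) \<le> e/3"
      using that by (simp_all add: dist_norm norm_minus_commute)
    ultimately show ?thesis using that(3) by linarith
  qed
  have "bounded (range f)"
  proof -
    obtain p where p: "almost_periodic p" "\<And>x. norm (f x - p x) \<le> 1" using assms[of 1] by auto
    then obtain B where B: "\<And>x. norm (p x) \<le> B"
      unfolding almost_periodic_def bounded_uniformly_continuous_def bounded_iff by auto
    have "norm (f x) \<le> B + 1" for x
      using norm_triangle_ineq[of "f x - p x" "p x"] p(2)[of x] B[of x] by simp
    then show ?thesis unfolding bounded_iff by blast
  qed
  moreover have "\<exists>U. open U \<and> 0 \<in> U \<and> (\<forall>x y. x - y \<in> U \<longrightarrow> dist (f x) (f y) < e)" if e: "e > 0" for e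
  proof -
    obtain p where p: "almost_periodic p" "\<And>x. norm (f x - p x) \<le> e/3" using assms[of "e/3"] e by
        auto
    moreover have "e/3 > 0" using e by simp
    ultimately obtain U where "open U" "0 \<in> U" "\<And>x y. x - y \<in> U \<Longrightarrow> dist (p x) (p y) < e/3"
      unfolding almost_periodic_def bounded_uniformly_continuous_def by meson
    then show ?thesis by (intro exI[of _ U]) (auto intro!: tri[OF p(2) p(2)])
  qed
  moreover have "\<exists>T. finite T \<and> (\<forall>\<tau>. \<exists>\<tau>'\<in>T. \<forall>x. dist (f (x - \<tau>)) (f (x - \<tau>')) < e)" if e: "e > 0"
      for e
  proof -
    obtain p where p: "almost_periodic p" "\<And>x. norm (f x - p x) \<le> e/3" using assms[of "e/3"] e by
        auto
    moreover have "e/3 > 0" using e by simp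
    ultimately obtain T where T: "finite T" "\<And>\<tau>. \<exists>\<tau>'\<in>T. \<forall>x. dist (p (x - \<tau>)) (p (x - \<tau>')) < e/3"
      unfolding almost_periodic_def translates_totally_bounded_def by meson
    have "\<exists>\<tau>'\<in>T. \<forall>x. dist (f (x - \<tau>)) (f (x - \<tau>')) < e" for \<tau>
    proof -
      obtain \<tau>' where "\<tau>' \<in> T" "\<And>x. dist (p (x - \<tau>)) (p (x - \<tau>')) < e/3" using T(2) by blast
      then show ?thesis by (intro bexI[of _ \<tau>']) (auto intro!: tri[OF p(2) p(2)])
    qed
    then show ?thesis using T(1) by blast
  qed
  ultimately show ?thesis
    unfolding almost_periodic_def bounded_uniformly_continuous_def translates_totally_bounded_def by
        blast
qed

lemma almost_periodic_trig_sum: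
  fixes y :: "'i \<Rightarrow> 'a::topological_ab_group_add"
  assumes I: "finite I"
  shows "almost_periodic (\<lambda>\<psi>. \<Sum>i\<in>I. a i * eval_char \<psi> (y i))"
proof -
  let ?f = "\<lambda>\<psi>. \<Sum>i\<in>I. a i * eval_char \<psi> (y i)"
  define A where "A = (\<Sum>i\<in>I. norm (a i))"
  have A: "A \<ge> 0" unfolding A_def by (intro sum_nonneg) auto
  have est: "dist (?f \<psi>) (?f \<phi>) < e"
    if e: "e > 0" and d: "\<And>i. i \<in> I \<Longrightarrow> norm (eval_char \<psi> (y i) - eval_char \<phi> (y i)) \<le> e / (A + 1)"
        for \<psi> \<phi> e
  proof -
    have "dist (?f \<psi>) (?f \<phi>) = norm (\<Sum>i\<in>I. a i * (eval_char \<psi> (y i) - eval_char \<phi> (y i)))"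
      by (simp add: dist_norm sum_subtractf right_diff_distrib)
    also have "\<dots> \<le> (\<Sum>i\<in>I. norm (a i) * (e / (A + 1)))"
      using d by (intro sum_norm_le) (simp only: norm_mult, intro mult_left_mono, auto)
    also have "\<dots> = A * (e / (A + 1))" by (simp add: A_def sum_distrib_right sum_divide_distrib)
    also have "\<dots> < (A + 1) * (e / (A + 1))" using e A by (intro mult_strict_right_mono) auto
    also have "\<dots> = e" using A by simp
    finally show ?thesis .
  qed
  have "norm (?f \<psi>) \<le> A" for \<psi>
    unfolding A_def by (rule sum_norm_le) (simp add: norm_mult)
  then have "bounded (range ?f)" unfolding bounded_iff by blast
  moreover have "\<exists>U. open U \<and> 0 \<in> U \<and> (\<forall>\<psi> \<phi>. \<psi> - \<phi> \<in> U \<longrightarrow> dist (?f \<psi>) (?f \<phi>) < e)" if e: "e > 0" for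
      e
  proof -
    let ?U = "char_nbhd 0 (y ` I) (e / (A + 1))"
    have "dist (?f \<psi>) (?f \<phi>) < e" if U: "\<psi> - \<phi> \<in> ?U" for \<psi> \<phi>
    proof (rule est[OF e])
      fix i assume i: "i \<in> I"
      have "eval_char \<psi> (y i) - eval_char \<phi> (y i) = (eval_char (\<psi> - \<phi>) (y i) - 1) * eval_char \<phi> (y
          i)"
        using eval_dual_add[of "\<psi> - \<phi>" \<phi> "y i"] by (simp add: left_diff_distrib)
      then have "norm (eval_char \<psi> (y i) - eval_char \<phi> (y i)) = dist (eval_char (\<psi> - \<phi>) (y i)) 1"
        by (simp add: norm_mult dist_norm)
      then show "norm (eval_char \<psi> (y i) - eval_char \<phi> (y i)) \<le> e / (A + 1)"
        using U i by (auto simp: char_nbhd_def intro: less_imp_le)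
    qed
    moreover have "open ?U" "0 \<in> ?U"
      using I e A by (auto intro!: open_char_nbhd char_nbhd_self finite_imp_compact divide_pos_pos)
    ultimately show ?thesis by blast
  qed
  moreover have "\<exists>T. finite T \<and> (\<forall>\<tau>. \<exists>\<tau>'\<in>T. \<forall>\<psi>. dist (?f (\<psi> - \<tau>)) (?f (\<psi> - \<tau>')) < e)" if e: "e > 0"
      for e
  proof -
    have "e / (A + 1) > 0" using e A by (intro divide_pos_pos) auto
    then obtain k :: "'a pontryagin_dual \<Rightarrow> 'i \<Rightarrow> int \<times> int" where k: "finite (range k)"
      "\<And>s s' i. k s = k s' \<Longrightarrow> i \<in> I \<Longrightarrow> dist (eval_char s (y i)) (eval_char s' (y i)) < e / (A + 1)"
      using finite_cells[OF I, of "\<lambda>i \<tau>. eval_char \<tau> (y i)" "e / (A + 1)"] by (metis norm_eval_char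
          order_refl)
    \<comment> \<open>\<open>inv k\<close> selects one representative per cell. The estimate is
      uniform in \<open>\<psi>\<close> because shifting by \<open>\<tau>\<close> only multiplies
      each term by the conjugate of \<open>\<tau>\<close> at its frequency.\<close>
    have "dist (?f (\<psi> - \<tau>)) (?f (\<psi> - inv k (k \<tau>))) < e" for \<psi> \<tau>
    proof (rule est[OF e])
      fix i assume i: "i \<in> I"
      have "k \<tau> = k (inv k (k \<tau>))" by (simp add: f_inv_into_f)
      then have "dist (eval_char \<tau> (y i)) (eval_char (inv k (k \<tau>)) (y i)) < e / (A + 1)" using i by
          (rule k(2))
      moreover have "norm (eval_char (\<psi> - \<tau>) (y i) - eval_char (\<psi> - inv k (k \<tau>)) (y i))
          = dist (eval_char \<tau> (y i)) (eval_char (inv k (k \<tau>)) (y i))"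
        by (simp add: eval_dual_diff right_diff_distrib[symmetric] norm_mult dist_norm flip:
            complex_cnj_diff)
      ultimately show "norm (eval_char (\<psi> - \<tau>) (y i) - eval_char (\<psi> - inv k (k \<tau>)) (y i)) \<le> e / (A +
          1)" by simp
    qed
    then show ?thesis using k(1) by (intro exI[of _ "inv k ` range k"]) auto
  qed
  ultimately show ?thesis
    unfolding almost_periodic_def bounded_uniformly_continuous_def translates_totally_bounded_def by
        blast
qed

text \<open>The number of terms is exactly \<open>n\<close>; shorter sums are padded with zero
  coefficients. Fixing it makes the parameters range over a product of compact sets.\<close>

definition trig_polys :: "nat \<Rightarrow> 'a::topological_ab_group_add set \<Rightarrow> real \<Rightarrow> ('a pontryagin_dual \<Rightarrow>
    complex) set" where
  "trig_polys n K C = {\<lambda>\<psi>. \<Sum>j<n. a j * eval_char \<psi> (y j) | a y. \<forall>j<n. norm (a j) \<le> C \<and> y j \<in> K}"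

lemma almost_periodic_diff_trig_polys:
  assumes "p \<in> trig_polys n K C" "q \<in> trig_polys n' K' C'"
  shows "almost_periodic (\<lambda>\<psi>. p \<psi> - q \<psi>)"
proof -
  obtain a y where p: "p = (\<lambda>\<psi>. \<Sum>j<n. a j * eval_char \<psi> (y j))" using assms(1) by (auto simp:
      trig_polys_def)
  obtain b z where q: "q = (\<lambda>\<psi>. \<Sum>j<n'. b j * eval_char \<psi> (z j))" using assms(2) by (auto simp:
      trig_polys_def)
  have "(\<lambda>\<psi>. p \<psi> - q \<psi>) = (\<lambda>\<psi>. \<Sum>i\<in>{..<n} <+> {..<n'}. case_sum a (\<lambda>j. - b j) i * eval_char \<psi>
      (case_sum y z i))"
    by (simp add: p q sum.Plus sum_negf)
  then show ?thesis by (simp only:) (intro almost_periodic_trig_sum finite_Plus finite_lessThan)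
qed

lemma almost_periodic_trig_polys: "p \<in> trig_polys n K C \<Longrightarrow> almost_periodic p"
  unfolding trig_polys_def by (auto intro: almost_periodic_trig_sum)

text \<open>
  Trigonometric polynomials with a bounded number of terms, bounded coefficients and frequencies in
  a compact set form a compact set for pointwise convergence, so approximation on finite sets
  suffices.
\<close>

lemma trig_polys_finite_approximation:
  fixes K :: "'a::{topological_ab_group_add, t2_space} set"
  assumes K: "compact K" "K \<noteq> {}" and C: "C \<ge> 0"
    and fin: "\<And>\<Psi>. finite \<Psi> \<Longrightarrow> \<exists>p\<in>trig_polys n K C. \<forall>\<psi>\<in>\<Psi>. norm (\<phi> \<psi> - p \<psi>) \<le> e"
  shows "\<exists>p\<in>trig_polys n K C. \<forall>\<psi>. norm (\<phi> \<psi> - p \<psi>) \<le> e"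
proof -
  obtain y0 where y0: "y0 \<in> K" using K(2) by blast
  \<comment> \<open>Parameters are sequences over all naturals so that Tychonoff applies directly;
    entries from \<open>n\<close> on do not enter the polynomial and are filled with
    \<open>(0, y0)\<close>.\<close>
  define B where "B = {r :: nat \<Rightarrow> complex \<times> 'a. \<forall>j. r j \<in> cball 0 C \<times> K}"
  have B: "compact B" unfolding B_def by (intro compact_function_box compact_Times compact_cball K)
  let ?p = "\<lambda>r \<psi>. \<Sum>j<n. fst (r j) * eval_char \<psi> (snd (r j))"
  let ?S = "\<lambda>\<psi>. {r :: nat \<Rightarrow> complex \<times> 'a. norm (\<phi> \<psi> - ?p r \<psi>) \<le> e}"
  have "B \<inter> (\<Inter>\<psi>\<in>UNIV. ?S \<psi>) \<noteq> {}"
  proof (rule compact_imp_fip_image[OF B])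
    show "closed (?S \<psi>)" for \<psi>
      by (intro closed_Collect_le continuous_intros continuous_on_compose2[OF
          eval_char_continuous[of \<psi>]]
          continuous_on_product_coordinates) auto
    fix \<Psi> :: "'a pontryagin_dual set" assume "finite \<Psi>"
    then obtain a y where ay: "\<And>j. j < n \<Longrightarrow> norm (a j) \<le> C" "\<And>j. j < n \<Longrightarrow> y j \<in> K"
      "\<And>\<psi>. \<psi> \<in> \<Psi> \<Longrightarrow> norm (\<phi> \<psi> - (\<Sum>j<n. a j * eval_char \<psi> (y j))) \<le> e"
      using fin[of \<Psi>] unfolding trig_polys_def by auto
    define r where "r j = (if j < n then (a j, y j) else (0, y0))" for j
    have "r \<in> B" using ay y0 C by (auto simp: B_def r_def)
    moreover have "?p r \<psi> = (\<Sum>j<n. a j * eval_char \<psi> (y j))" for \<psi> by (intro sum.cong) (auto simp: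
        r_def)
    ultimately show "B \<inter> (\<Inter>\<psi>\<in>\<Psi>. ?S \<psi>) \<noteq> {}" using ay(3) by (auto simp: disjoint_iff)
  qed
  then obtain r where r: "r \<in> B" "\<And>\<psi>. norm (\<phi> \<psi> - ?p r \<psi>) \<le> e" by blast
  have "?p r \<in> trig_polys n K C"
    unfolding trig_polys_def
    by (intro CollectI exI[of _ "\<lambda>j. fst (r j)"] exI[of _ "\<lambda>j. snd (r j)"])
      (use r(1) in \<open>auto simp: B_def mem_Times_iff\<close>)
  then show ?thesis using r(2) by (intro bexI[of _ "?p r"]) auto
qed

text \<open>For any \<open>x\<close> some \<open>\<tau>\<close> in the finite set \<open>T\<close>
  makes the translates by \<open>x\<close> and \<open>\<tau>\<close> so close that the nonzero value
  at \<open>x0\<close> persists at \<open>x0 + x - \<tau>\<close>. A point of \<open>S\<close> lies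
  near that place, and finiteness of \<open>T\<close> keeps the total displacement in a compact
  set.\<close>

lemma relatively_dense_of_almost_periodic:
  fixes f :: "'a::topological_ab_group_add \<Rightarrow> complex"
  assumes f: "translates_totally_bounded f" "f x0 \<noteq> 0" and D: "compact D"
    and S: "\<And>x. f x \<noteq> 0 \<Longrightarrow> \<exists>s\<in>S. x - s \<in> D"
  shows "relatively_dense S"
proof -
  have "norm (f x0) > 0" using f(2) by simp
  then obtain T where T: "finite T" "\<And>\<tau>. \<exists>\<tau>'\<in>T. \<forall>x. dist (f (x - \<tau>)) (f (x - \<tau>')) < norm (f x0)"
    using f(1) unfolding translates_totally_bounded_def by meson
  define C where "C = (\<Union>\<tau>\<in>T. (\<lambda>x. x + (\<tau> - x0)) ` D)"
  have "compact C" unfolding C_def using T(1) D by (intro compact_UN compact_translation_image) auto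
  have ex: "\<exists>s\<in>S. \<exists>c\<in>C. x = s + c" for x
  proof -
    obtain \<tau> where \<tau>: "\<tau> \<in> T" "\<And>y. dist (f (y - x)) (f (y - \<tau>)) < norm (f x0)" using T(2) by blast
    have "f (x0 + x - \<tau>) \<noteq> 0" using \<tau>(2)[of "x0 + x"] by auto
    then obtain s where s: "s \<in> S" "x0 + x - \<tau> - s \<in> D" using S by blast
    have "x0 + x - \<tau> - s + (\<tau> - x0) \<in> C" unfolding C_def using \<tau>(1) s(2) by blast
    then have "x - s \<in> C" by (simp add: algebra_simps)
    then show ?thesis using s(1) by (intro bexI[of _ s] bexI[of _ "x - s"]) auto
  qed
  have "{s + c | s c. s \<in> S \<and> c \<in> C} = UNIV" using ex by blast
  with \<open>compact C\<close> show ?thesis unfolding relatively_dense_def by blast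
qed

context flc_measure
begin

text \<open>
  The number of terms does not depend on \<open>t\<close>: the points of \<open>\<Lambda>\<close> in a translate of \<open>supp H\<close>
  differ from any one of them by elements of a fixed finite subset of \<open>\<Lambda> - \<Lambda>\<close>.
\<close>

lemma \<gamma>_translate_trig_poly:
  assumes H: "H \<in> Cc"
  obtains n K C where "compact K" "K \<noteq> {}" "C \<ge> 0"
    "\<And>t. (\<lambda>\<psi>. \<gamma> (\<lambda>x. cnj (eval_char \<psi> (x - t)) * H (x - t))) \<in> trig_polys n K C"
proof -
  obtain A where A: "A > 0" "\<And>x. x \<in> \<Lambda> \<Longrightarrow> norm (\<gamma> (atom_bump x)) \<le> A" using atoms_bounded by metis
  obtain M where M: "M > 0" "\<And>x. norm (H x) \<le> M" using Cc_bounded[OF H] by metis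
  define E where "E = {x - y | x y. x \<in> \<Lambda> \<and> y \<in> \<Lambda>} \<inter> (\<lambda>(x, y). x - y) ` (supp H \<times> supp H)"
  have E: "finite E" unfolding E_def using flc compact_minus_set[OF Cc_compact[OF H] Cc_compact[OF
      H]]
    by (simp add: finite_local_complexity_def)
  \<comment> \<open>The conjugated character turns a point \<open>x - t\<close> of the support into
    the frequency \<open>- (x - t)\<close>. The extra 0 is the frequency of the padding terms and
    makes \<open>K\<close> nonempty.\<close>
  define K where "K = uminus ` supp H \<union> {0}"
  have K: "compact K" unfolding K_def by (intro compact_Un compact_uminus_image Cc_compact H) auto
  have "(\<lambda>\<psi>. \<gamma> (\<lambda>x. cnj (eval_char \<psi> (x - t)) * H (x - t))) \<in> trig_polys (card E) K (M * A)" for t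
  proof -
    define F where "F = \<Lambda> \<inter> (\<lambda>x. x + t) ` supp H"
    have F: "finite F"
      unfolding F_def by (intro flc_finite_Int_compact flc compact_translation_image Cc_compact H)
    have FH: "x - t \<in> supp H" "x \<in> \<Lambda>" if "x \<in> F" for x using that by (auto simp: F_def)
    have "card F \<le> card E"
    proof (cases "F = {}")
      case False
      then obtain x0 where x0: "x0 \<in> F" by blast
      have "(\<lambda>x. x - x0) ` F \<subseteq> E"
      proof (rule image_subsetI)
        fix x assume x: "x \<in> F"
        have "(\<lambda>(x, y). x - y) (x - t, x0 - t) \<in> (\<lambda>(x, y). x - y) ` (supp H \<times> supp H)"
          using FH[OF x] FH[OF x0] by (intro imageI SigmaI)
        then show "x - x0 \<in> E" using FH[OF x] FH[OF x0] by (auto simp: E_def)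
      qed
      moreover have "inj_on (\<lambda>x. x - x0) F" by (auto simp: inj_on_def)
      ultimately show ?thesis using E card_inj_on_le by blast
    qed simp
    obtain e where e: "bij_betw e {0..<card F} F" using ex_bij_betw_nat_finite[OF F] by blast
    have eF: "e j \<in> F" if "j < card F" for j using e that by (auto simp: bij_betw_def)
    define a where "a j = (if j < card F then H (e j - t) * \<gamma> (atom_bump (e j)) else 0)" for j
    define y where "y j = (if j < card F then - (e j - t) else 0)" for j
    have "\<gamma> (\<lambda>x. cnj (eval_char \<psi> (x - t)) * H (x - t)) = (\<Sum>j<card E. a j * eval_char \<psi> (y j))" for
        \<psi>
    proof -
      have "(\<lambda>x. cnj (eval_char \<psi> x) * H x) \<in> Cc" by (intro Cc_mult H continuous_intros
          eval_char_continuous)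
      then have "\<gamma> (\<lambda>x. cnj (eval_char \<psi> (x - t)) * H (x - t))
          = (\<Sum>x\<in>F. cnj (eval_char \<psi> (x - t)) * H (x - t) * \<gamma> (atom_bump x))"
      proof (intro \<gamma>_eq_sum F Cc_translate(1))
        fix x assume "x \<in> \<Lambda> - F"
        then have "x \<notin> (\<lambda>x. x + t) ` supp H" by (auto simp: F_def)
        then have "x - t \<notin> supp H" by (metis diff_add_cancel imageI)
        then show "cnj (eval_char \<psi> (x - t)) * H (x - t) = 0" by (simp add: notin_supp)
      qed (auto simp: F_def)
      also have "\<dots> = (\<Sum>j=0..<card F. cnj (eval_char \<psi> (e j - t)) * H (e j - t) * \<gamma> (atom_bump (e
          j)))"
        by (rule sum.reindex_bij_betw[OF e, symmetric])
      also have "\<dots> = (\<Sum>j=0..<card F. a j * eval_char \<psi> (y j))"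
        by (intro sum.cong refl) (simp add: a_def y_def mult_ac flip: eval_char_uminus)
      also have "\<dots> = (\<Sum>j<card E. a j * eval_char \<psi> (y j))"
        using \<open>card F \<le> card E\<close> by (intro sum.mono_neutral_left) (auto simp: a_def)
      finally show ?thesis .
    qed
    moreover have "norm (a j) \<le> M * A" for j
      unfolding a_def using M A FH(2)[OF eF] by (auto simp: norm_mult intro!: mult_mono)
    moreover have "y j \<in> K" for j 
      unfolding y_def K_def using FH(1)[OF eF[of j]] by (cases "j < card F") (simp_all only: if_True
          if_False imageI UnI1 UnI2 singletonI)
    ultimately show ?thesis unfolding trig_polys_def by blast
  qed
  then show thesis using K M A by (intro that[of K "M * A" "card E"]) (auto simp: K_def)
qed

text \<open>\<open>c\<close> is factored as \<open>u\<close> times the weight \<open>s\<close>.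
  Approximating only \<open>u\<close> uniformly leaves an error that is a small multiple of
  \<open>s\<close>, whose translates have uniformly bounded \<open>\<nu>\<close>-integral; the error
  is therefore uniform in both \<open>t\<close> and \<open>\<psi>\<close>.\<close>

lemma twist_convolution_approximation:
  assumes c: "c \<in> Cc" and e: "e > 0"
  obtains J n K C where "compact K" "K \<noteq> {}" "C \<ge> 0" "\<And>t. J t \<in> trig_polys n K C"
    "\<And>t \<psi>. norm (\<nu> (twist t (\<lambda>\<xi>. c (\<psi> - \<xi>))) - J t \<psi>) \<le> e"
proof -
  \<comment> \<open>The reflection turns \<open>c (\<psi> - \<xi>)\<close> into a function of
    \<open>\<xi> - \<psi>\<close>, the argument in
    \<open>has_integral_cross_translate\<close>.\<close>
  define c' where "c' \<xi> = c (- \<xi>)" for \<xi>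
  have c': "c' \<in> Cc" unfolding c'_def[abs_def] by (rule Cc_translate[OF c])
  obtain f where f: "f \<in> Cc" "\<And>\<xi>. \<xi> \<in> supp c' \<Longrightarrow> inverse_Fourier \<theta> f \<xi> \<noteq> 0"
    using inverse_Fourier_nonzero_on_compact[OF Cc_compact[OF c']] by metis
  define s where "s \<xi> = (norm (inverse_Fourier \<theta> f \<xi>))\<^sup>2" for \<xi>
  have cs: "continuous_on A s" for A unfolding s_def by (intro continuous_intros
      continuous_inverse_Fourier f)
  obtain \<delta> where \<delta>: "\<delta> > 0" "\<And>\<xi>. \<xi> \<in> supp c' \<Longrightarrow> \<delta> \<le> s \<xi>"
  proof (cases "supp c' = {}")
    case True then show thesis using that[of 1] by auto
  next
    case False
    obtain m where m: "m \<in> supp c'" "\<forall>\<xi>\<in>supp c'. s m \<le> s \<xi>"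
      using continuous_attains_inf[OF Cc_compact[OF c'] False cs] by blast
    then show thesis using f(2)[OF m(1)] that[of "s m"] by (auto simp: s_def)
  qed
  \<comment> \<open>The maximum with \<open>\<delta>\<close> makes the quotient by \<open>s\<close>
    continuous everywhere and changes nothing on the support of \<open>c'\<close>, where
    \<open>s\<close> is at least \<open>\<delta>\<close>.\<close>
  define u where "u \<xi> = complex_of_real (1 / max \<delta> (s \<xi>)) * c' \<xi>" for \<xi>
  have mx: "max \<delta> (s \<xi>) \<noteq> 0" for \<xi> using \<delta>(1) by (simp add: max_def)
  have u: "u \<in> Cc" unfolding u_def[abs_def] using mx by (intro Cc_mult c' continuous_intros cs) auto
  have us: "u \<xi> * of_real (s \<xi>) = c' \<xi>" for \<xi>
  proof (cases "\<xi> \<in> supp c'")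
    case True
    then have "max \<delta> (s \<xi>) = s \<xi>" "s \<xi> \<noteq> 0" using \<delta> by fastforce+
    then show ?thesis by (simp add: u_def)
  qed (simp add: u_def notin_supp)
  obtain B where B: "B > 0" "\<And>\<psi>. nu.N (\<lambda>\<xi>. of_real ((norm (inverse_Fourier \<theta> f (\<xi> - \<psi>)))\<^sup>2)) \<le>
      ennreal B"
    using N_square_le[OF f(1)] by metis
  have eB: "e / B > 0" using e B by simp
  obtain h where h: "h \<in> Cc" "\<And>\<xi>. norm (u \<xi> - inverse_Fourier \<theta> h \<xi>) < e / B"
    using inverse_Fourier_dense[OF u eB] by metis
  \<comment> \<open>\<open>cross g f\<close> then has as transform that of \<open>h\<close> times
    the weight \<open>s\<close>.\<close>
  define g where "g = convolve_functions \<theta> h f"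
  have g: "g \<in> Cc" unfolding g_def by (rule convolve_functions_Cc[OF h(1) f(1)])
  obtain n K C where nKC: "compact K" "K \<noteq> {}" "C \<ge> 0"
    "\<And>t. (\<lambda>\<psi>. \<gamma> (\<lambda>x. cnj (eval_char \<psi> (x - t)) * cross g f (x - t))) \<in> trig_polys n K C"
    by (rule \<gamma>_translate_trig_poly[OF cross_Cc[OF g f(1)]]) (rule that)
  show thesis
  proof (rule that[OF nKC])
    fix t \<psi>
    let ?z = "\<gamma> (\<lambda>x. cnj (eval_char \<psi> (x - t)) * cross g f (x - t))"
    let ?F = "\<lambda>\<xi>. eval_char \<xi> t * (inverse_Fourier \<theta> g (\<xi> - \<psi>) * cnj (inverse_Fourier \<theta> f (\<xi> - \<psi>)))"
    let ?k = "twist t (\<lambda>\<xi>. c (\<psi> - \<xi>))"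
    have F: "continuous_on UNIV ?F"
      by (intro continuous_intros continuous_on_eval_dual continuous_on_compose2[OF
          continuous_inverse_Fourier]
          g f continuous_on_shifts) auto
    have i: "has_radon_integral \<nu> ?F ?z" by (rule has_integral_cross_translate[OF g f(1)])
    have k: "?k \<in> Cc" by (intro twist_Cc Cc_translate c)
    have "ennreal (norm (\<nu> ?k - ?z)) \<le> nu.N (\<lambda>\<xi>. ?k \<xi> - ?F \<xi>)" by (rule nu.has_integral_diff_le[OF F
        i k])
    also have "\<dots> \<le> nu.N (\<lambda>\<xi>. of_real (e / B) * of_real ((norm (inverse_Fourier \<theta> f (\<xi> - \<psi>)))\<^sup>2))"
    proof (rule nu.N_mono)
      fix \<xi>
      let ?\<eta> = "\<xi> - \<psi>"
      have "?k \<xi> - ?F \<xi> = eval_char \<xi> t * (c' ?\<eta> - inverse_Fourier \<theta> h ?\<eta> * of_real (s ?\<eta>))"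
        by (simp add: c'_def g_def inverse_Fourier_convolve h f s_def complex_norm_square
            algebra_simps del: of_real_power)
      also have "\<dots> = eval_char \<xi> t * ((u ?\<eta> - inverse_Fourier \<theta> h ?\<eta>) * of_real (s ?\<eta>))"
        by (simp add: us[symmetric] algebra_simps)
      finally have "norm (?k \<xi> - ?F \<xi>) = norm (u ?\<eta> - inverse_Fourier \<theta> h ?\<eta>) * s ?\<eta>"
        by (simp only: norm_mult norm_eval_char norm_of_real mult_1_left) (simp add: s_def)
      also have "\<dots> \<le> e / B * s ?\<eta>" using h(2)[of ?\<eta>] by (intro mult_right_mono) (auto simp: s_def)
      finally show "norm (?k \<xi> - ?F \<xi>) \<le> norm (complex_of_real (e / B) * of_real ((norm
          (inverse_Fourier \<theta> f (\<xi> - \<psi>)))\<^sup>2))"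
        unfolding norm_mult norm_of_real using e B by (simp add: s_def)
    qed
    also have "\<dots> \<le> ennreal (norm (complex_of_real (e / B))) * nu.N (\<lambda>\<xi>. of_real ((norm
        (inverse_Fourier \<theta> f (\<xi> - \<psi>)))\<^sup>2))"
      by (intro nu.N_cmult_le continuous_intros continuous_on_compose2[OF
          continuous_inverse_Fourier] f
          continuous_on_shifts) auto
    also have "\<dots> \<le> ennreal (e / B) * ennreal B"
      using eB B(2) unfolding norm_of_real by (intro mult_mono) auto
    also have "\<dots> = ennreal e" using e B by (simp add: ennreal_mult[symmetric])
    finally show "norm (\<nu> ?k - ?z) \<le> e" using e by simp
  qed
qed

text \<open>The discrete part is within \<open>e / 2\<close> of a twist of \<open>\<nu>\<close> on
  any finite set of \<open>\<psi>\<close>, and the twists all come from one class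
  \<open>trig_polys n K C\<close>; its compactness removes the restriction to finite sets.\<close>

lemma convolution_approximation:
  assumes c: "c \<in> Cc" and e: "e > 0"
  obtains n K C p q where "p \<in> trig_polys n K C" "\<And>\<psi>. norm (\<nu> (\<lambda>\<xi>. c (\<psi> - \<xi>)) - p \<psi>) \<le> e"
    "q \<in> trig_polys n K C" "\<And>\<psi>. norm (discrete_part \<nu> (\<lambda>\<xi>. c (\<psi> - \<xi>)) - q \<psi>) \<le> e"
proof -
  have "e / 2 > 0" using e by simp
  then obtain J n K C where J: "compact K" "K \<noteq> {}" "C \<ge> 0" "\<And>t. J t \<in> trig_polys n K C"
    "\<And>t \<psi>. norm (\<nu> (twist t (\<lambda>\<xi>. c (\<psi> - \<xi>))) - J t \<psi>) \<le> e / 2"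
    by (rule twist_convolution_approximation[OF c]) (rule that)
  have "\<exists>q\<in>trig_polys n K C. \<forall>\<psi>. norm (discrete_part \<nu> (\<lambda>\<xi>. c (\<psi> - \<xi>)) - q \<psi>) \<le> e"
  proof (rule trig_polys_finite_approximation[OF J(1-3)])
    fix \<Psi> :: "'a pontryagin_dual set" assume \<Psi>: "finite \<Psi>"
    let ?C = "(\<lambda>\<psi> \<xi>. c (\<psi> - \<xi>)) ` \<Psi>"
    have "finite ?C" "?C \<subseteq> Cc" using \<Psi> c by (auto intro: Cc_translate)
    then obtain t where t: "\<And>k. k \<in> ?C \<Longrightarrow> norm (\<nu> (twist t k) - discrete_part \<nu> k) < e / 2"
      by (rule twist_approximates_discrete_part[OF _ _ \<open>e / 2 > 0\<close>]) (rule that)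
    have "norm (discrete_part \<nu> (\<lambda>\<xi>. c (\<psi> - \<xi>)) - J t \<psi>) \<le> e" if "\<psi> \<in> \<Psi>" for \<psi>
    proof -
      let ?k = "\<lambda>\<xi>. c (\<psi> - \<xi>)"
      have "norm (discrete_part \<nu> ?k - J t \<psi>) \<le> norm (discrete_part \<nu> ?k - \<nu> (twist t ?k)) + norm (\<nu>
          (twist t ?k) - J t \<psi>)"
        using norm_triangle_ineq[of "discrete_part \<nu> ?k - \<nu> (twist t ?k)" "\<nu> (twist t ?k) - J t \<psi>"]
            by simp
      moreover have "norm (discrete_part \<nu> ?k - \<nu> (twist t ?k)) < e / 2"
        using t[of ?k] that by (subst norm_minus_commute) auto
      ultimately show ?thesis using J(5)[of t \<psi>] by linarith
    qed
    then show "\<exists>q\<in>trig_polys n K C. \<forall>\<psi>\<in>\<Psi>. norm (discrete_part \<nu> (\<lambda>\<xi>. c (\<psi> - \<xi>)) - q \<psi>) \<le> e"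
      using J(4) by blast
  qed
  then obtain q where q: "q \<in> trig_polys n K C"
      "\<And>\<psi>. norm (discrete_part \<nu> (\<lambda>\<xi>. c (\<psi> - \<xi>)) - q \<psi>) \<le> e" by blast
  \<comment> \<open>The twist by 0 is trivial, so \<open>\<nu>\<close> itself is the case
    \<open>t = 0\<close>.\<close>
  have "norm (\<nu> (\<lambda>\<xi>. c (\<psi> - \<xi>)) - J 0 \<psi>) \<le> e" for \<psi> using J(5)[of 0 \<psi>] e by simp
  then show thesis using that[OF J(4) _ q] by blast
qed

lemma convolution_almost_periodic:
  assumes c: "c \<in> Cc"
  shows "almost_periodic (convolve_function_measure c \<nu>)"
    and "almost_periodic (convolve_function_measure c (discrete_part \<nu>))"
    and "almost_periodic (convolve_function_measure c (continuous_part \<nu>))"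
proof -
  show "almost_periodic (convolve_function_measure c \<nu>)"
    unfolding convolve_function_measure_def
    by (rule almost_periodic_uniform_limit) (metis convolution_approximation[OF c]
        almost_periodic_trig_polys)
  show "almost_periodic (convolve_function_measure c (discrete_part \<nu>))"
    unfolding convolve_function_measure_def
    by (rule almost_periodic_uniform_limit) (metis convolution_approximation[OF c]
        almost_periodic_trig_polys)
  show "almost_periodic (convolve_function_measure c (continuous_part \<nu>))"
    unfolding convolve_function_measure_def
  proof (rule almost_periodic_uniform_limit)
    fix e :: real assume "e > 0"
    then have "e / 2 > 0" by simp
    then obtain n K C p q where pq: "p \<in> trig_polys n K C"
        "\<And>\<psi>. norm (\<nu> (\<lambda>\<xi>. c (\<psi> - \<xi>)) - p \<psi>) \<le> e / 2"
      "q \<in> trig_polys n K C" "\<And>\<psi>. norm (discrete_part \<nu> (\<lambda>\<xi>. c (\<psi> - \<xi>)) - q \<psi>) \<le> e / 2"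
      by (rule convolution_approximation[OF c]) (rule that)
    have "norm (continuous_part \<nu> (\<lambda>\<xi>. c (\<psi> - \<xi>)) - (p \<psi> - q \<psi>)) \<le> e" for \<psi>
    proof -
      have "continuous_part \<nu> (\<lambda>\<xi>. c (\<psi> - \<xi>)) - (p \<psi> - q \<psi>)
          = (\<nu> (\<lambda>\<xi>. c (\<psi> - \<xi>)) - p \<psi>) - (discrete_part \<nu> (\<lambda>\<xi>. c (\<psi> - \<xi>)) - q \<psi>)"
        by (simp add: continuous_part_def)
      then have "norm (continuous_part \<nu> (\<lambda>\<xi>. c (\<psi> - \<xi>)) - (p \<psi> - q \<psi>))
          \<le> norm (\<nu> (\<lambda>\<xi>. c (\<psi> - \<xi>)) - p \<psi>) + norm (discrete_part \<nu> (\<lambda>\<xi>. c (\<psi> - \<xi>)) - q \<psi>)"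
        by (simp only: norm_triangle_ineq4)
      also have "\<dots> \<le> e / 2 + e / 2" by (intro add_mono pq)
      finally show ?thesis by simp
    qed
    then show "\<exists>p. almost_periodic p \<and> (\<forall>\<psi>. norm (continuous_part \<nu> (\<lambda>\<xi>. c (\<psi> - \<xi>)) - p \<psi>) \<le> e)"
      using almost_periodic_diff_trig_polys[OF pq(1,3)] by blast
  qed
qed

text \<open>By positivity the mass of a translate of \<open>K\<close> is dominated by a convolution
  with a bump that is 1 on \<open>K\<close>, and almost periodic functions are bounded.\<close>

lemma positive_translation_bounded:
  assumes \<rho>: "positive_radon_measure \<rho>"
    and ap: "\<And>c. c \<in> Cc \<Longrightarrow> almost_periodic (convolve_function_measure c \<rho>)"
  shows "translation_bounded (\<rho> :: 'a pontryagin_dual functional)"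
  unfolding translation_bounded_def
proof (intro allI impI)
  interpret r: positive_radon \<rho> by unfold_locales (rule dual_locally_compact, rule \<rho>)
  fix K :: "'a pontryagin_dual set" assume K: "compact K"
  obtain b W where b: "(\<lambda>x. complex_of_real (b x)) \<in> Cc" "\<And>x. 0 \<le> b x" "K \<subseteq> W" "\<And>x. x \<in> W \<Longrightarrow> b x = 1"
    using lc_bump[OF dual_locally_compact K open_UNIV subset_UNIV] by metis
  define c where "c x = complex_of_real (b (- x))" for x
  have c: "c \<in> Cc" unfolding c_def[abs_def] using Cc_translate(3)[OF b(1)] .
  have "bounded (range (convolve_function_measure c \<rho>))"
    using ap[OF c] by (simp add: almost_periodic_def bounded_uniformly_continuous_def)
  then obtain B where B: "\<And>x. norm (convolve_function_measure c \<rho> x) \<le> B" unfolding bounded_iff by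
      auto
  have "variation \<rho> ((\<lambda>k. x + k) ` K) \<le> ennreal B" for x
  proof -
    let ?g = "\<lambda>y. complex_of_real (b (y - x))"
    have g: "?g \<in> Cc" using Cc_translate(1)[OF b(1)] .
    have le: "indicator ((\<lambda>k. x + k) ` K) y \<le> ennreal (norm (?g y))" for y
    proof (cases "y \<in> (\<lambda>k. x + k) ` K")
      case True
      then have "b (y - x) = 1" using b(3,4) by auto
      then show ?thesis using True by simp
    qed simp
    have "variation \<rho> ((\<lambda>k. x + k) ` K) \<le> r.N ?g"
      unfolding variation_def r.N_def variation_integral_def
      by (rule INF_superset_mono) (auto intro: order_trans[OF le])
    also have "\<dots> \<le> ennreal (Re (\<rho> (\<lambda>y. of_real (norm (?g y)))))" by (rule r.N_Cc_le[OF g])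
    also have "(\<lambda>y. complex_of_real (norm (?g y))) = (\<lambda>y. c (x - y))" using b(2) by (simp add:
        c_def)
    also have "ennreal (Re (\<rho> (\<lambda>y. c (x - y)))) \<le> ennreal B"
      using B[of x] complex_Re_le_cmod[of "\<rho> (\<lambda>y. c (x - y))"]
      by (intro ennreal_leI) (simp add: convolve_function_measure_def)
    finally show ?thesis .
  qed
  then have "(SUP x. variation \<rho> ((\<lambda>k. x + k) ` K)) \<le> ennreal B" by (rule SUP_least)
  then show "(SUP x. variation \<rho> ((\<lambda>k. x + k) ` K)) < \<infinity>"
    by (metis ennreal_less_top infinity_ennreal_def order_le_less_trans)
qed

section \<open>Strong almost periodicity of both parts and relative density of the spectra\<close>

lemma discrete_part_SAP: "discrete_part \<nu> \<in> SAP"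
  unfolding SAP_def
  using nud.radon convolution_almost_periodic(2) almost_periodic_imp_bohr
    positive_translation_bounded[OF nu.positive_discrete_part] by blast

lemma continuous_part_SAP: "continuous_part \<nu> \<in> SAP"
  unfolding SAP_def
  using nuc.radon convolution_almost_periodic(3) almost_periodic_imp_bohr
    positive_translation_bounded[OF nu.positive_continuous_part] by blast

text \<open>\<open>S\<close> is kept abstract because it is a closed support in one application and
  the set of atoms, which need not be closed, in the other. All that is used is that a nonzero value
  of the measure forces the support of the test function to meet \<open>S\<close>.\<close>

lemma relatively_dense_of_convolutions:
  fixes \<rho> :: "'a pontryagin_dual functional"
  assumes ap: "\<And>c. c \<in> Cc \<Longrightarrow> almost_periodic (convolve_function_measure c \<rho>)"
    and g: "g \<in> Cc" "\<rho> g \<noteq> 0"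
    and S: "\<And>f. f \<in> Cc \<Longrightarrow> \<rho> f \<noteq> 0 \<Longrightarrow> supp f \<inter> S \<noteq> {}"
  shows "relatively_dense S"
proof -
  define c where "c \<xi> = g (- \<xi>)" for \<xi>
  have c: "c \<in> Cc" unfolding c_def[abs_def] by (rule Cc_translate[OF g(1)])
  show ?thesis
  proof (rule relatively_dense_of_almost_periodic[where f="convolve_function_measure c \<rho>" and
      ?x0.0=0 and D="supp c"])
    show "translates_totally_bounded (convolve_function_measure c \<rho>)"
      using ap[OF c] by (simp add: almost_periodic_def)
    show "convolve_function_measure c \<rho> 0 \<noteq> 0" using g(2) by (simp add:
        convolve_function_measure_def c_def)
    show "compact (supp c)" by (rule Cc_compact[OF c])
    fix \<psi> assume \<psi>: "convolve_function_measure c \<rho> \<psi> \<noteq> 0"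
    have "supp (\<lambda>\<xi>. c (\<psi> - \<xi>)) \<inter> S \<noteq> {}"
      using \<psi> by (intro S Cc_translate c) (simp add: convolve_function_measure_def)
    then obtain s where s: "s \<in> supp (\<lambda>\<xi>. c (\<psi> - \<xi>))" "s \<in> S" by blast
    have "closed ((\<lambda>\<xi>. \<psi> - \<xi>) -` supp c)" by (intro closed_vimage closed_supp continuous_on_shifts)
    then have "supp (\<lambda>\<xi>. c (\<psi> - \<xi>)) \<subseteq> (\<lambda>\<xi>. \<psi> - \<xi>) -` supp c"
      by (rule supp_subset) (simp add: notin_supp)
    then show "\<exists>s\<in>S. \<psi> - s \<in> supp c" using s by blast
  qed
qed

lemma pure_point_spectrum_relatively_dense:
  assumes "pure_point_spectrum \<nu> \<noteq> {}"
  shows "relatively_dense (pure_point_spectrum \<nu>)"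
proof -
  have S: "pure_point_spectrum \<nu> = {\<xi>. nu.point_mass \<xi> \<noteq> 0}" by (simp add: pure_point_spectrum_def
      nu.mass_eq)
  obtain \<xi> where \<xi>: "nu.point_mass \<xi> > 0" using assms nu.point_mass_nonneg unfolding S
    by (metis (mono_tags, lifting) Collect_empty_eq order_le_less)
  obtain b W where b: "(\<lambda>x. complex_of_real (b x)) \<in> Cc" "\<And>x. 0 \<le> b x" "\<xi> \<in> W" "\<And>x. x \<in> W \<Longrightarrow> b x = 1"
    using lc_point_bump[OF dual_locally_compact open_UNIV, of \<xi>] by (metis UNIV_I)
  show ?thesis
  proof (rule relatively_dense_of_convolutions[OF convolution_almost_periodic(2) b(1)])
    show "discrete_part \<nu> (\<lambda>x. complex_of_real (b x)) \<noteq> 0"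
      using nu.discrete_part_nonneg(3)[OF b(1,2), of \<xi>] \<xi> b(3,4) by fastforce
    fix f assume f: "f \<in> Cc" "discrete_part \<nu> f \<noteq> 0"
    obtain \<zeta> where \<zeta>: "complex_of_real (nu.point_mass \<zeta>) * f \<zeta> \<noteq> 0"
      using f(2) infsum_0[of UNIV "\<lambda>x. complex_of_real (nu.point_mass x) * f x"]
      unfolding nu.discrete_part_eq by blast
    then have "\<zeta> \<in> supp f" using notin_supp[of \<zeta> f] by auto
    then show "supp f \<inter> pure_point_spectrum \<nu> \<noteq> {}" unfolding S using \<zeta> by auto
  qed
qed

lemma continuous_spectrum_relatively_dense:
  assumes "continuous_spectrum \<nu> \<noteq> {}"
  shows "relatively_dense (continuous_spectrum \<nu>)"
proof -
  obtain g where g: "g \<in> Cc" "continuous_part \<nu> g \<noteq> 0"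
    using assms unfolding continuous_spectrum_def measure_support_def by (auto dest: spec[of _
        UNIV])
  show ?thesis
    unfolding continuous_spectrum_def
  proof (rule relatively_dense_of_convolutions[OF convolution_almost_periodic(3) g])
    show "supp f \<inter> measure_support (continuous_part \<nu>) \<noteq> {}" if "f \<in> Cc" "continuous_part \<nu> f \<noteq> 0"
        for f
      using that measure_support_disjoint_imp_zero[OF dual_locally_compact nuc.radon] by blast
  qed
qed

end

theorem theorem6p9:
  fixes \<theta> :: "'a::{topological_ab_group_add, t2_space} measure"
    and \<mu> \<gamma> :: "'a functional"
    and \<gamma>_hat :: "'a pontryagin_dual functional"
    and \<Lambda> :: "'a set"
  assumes "locally compact (UNIV :: 'a set)"
    and "haar_measure \<theta>"
    and "radon_measure \<mu>" and "translation_bounded \<mu>"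
    and "is_autocorrelation \<theta> \<mu> \<gamma>"
    and "is_Fourier_transform \<theta> \<gamma> \<gamma>_hat"
    and "finite_local_complexity \<Lambda>" and "measure_support \<gamma> \<subseteq> \<Lambda>"
  shows "(discrete_part \<gamma>_hat \<in> SAP \<and> continuous_part \<gamma>_hat \<in> SAP) \<and>
    (pure_point_spectrum \<gamma>_hat = {} \<or> relatively_dense (pure_point_spectrum \<gamma>_hat)) \<and>
    (continuous_spectrum \<gamma>_hat = {} \<or> relatively_dense (continuous_spectrum \<gamma>_hat))"
proof -
  interpret flc_measure \<theta> \<gamma> \<gamma>_hat \<Lambda>
    using assms by unfold_locales (auto simp: is_autocorrelation_def)
  show ?thesis
    using discrete_part_SAP continuous_part_SAP pure_point_spectrum_relatively_dense
      continuous_spectrum_relatively_dense by blast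
qed

end
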